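(* Let $(M,g)$ be a connected compact Riemannian homogeneous space of dimension $d$, and let $r_0$ and $c$ be positive numbers. If $V(r)\ge c\cdot r^d$ for all $0<r\le r_0$, then for every $\lambda\ge(\pi/(2r_0))^2$, \[ N(\lambda)\ \le\ \frac{\operatorname{vol}(M)}{c\cdot m_d}\cdot\lambda^{d/2},\qquad\text{where } m_d:=\int_0^{\pi/2}\theta^d\sin(2\theta)\,d\theta . \]
   Context: A Riemannian homogeneous space is a smooth Riemannian manifold $(M,g)$ (without boundary) such that for every $x,y\in M$ there is an isometry $\iota:M\to M$ with $\iota(x)=y$. $\operatorname{vol}$ (also written $\mu$) is the Riemannian volume measure. $V(r)$ denotes the volume of an open ball of radius $r$ in $M$ for the Riemannian distance; by homogeneity it does not depend on the center. $\Delta=\Delta_g$ is the nonnegative Laplace--Beltrami operator, i.e. $\int_M (\Delta u)\,\overline{v}\,d\mu=\int_M g(\nabla u,\nabla\overline v)\,d\mu$. The eigenvalue counting function $N(\lambda)$ is the dimension of the direct sum of the eigenspaces of $\Delta$ with eigenvalue at most $\lambda$ (eigenvalues, including $0$, counted with multiplicity). *)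

theory Defs
  imports
    "HOL-Analysis.Analysis"
    "HOL-Library.Function_Algebras"
    "HOL-Library.Extended_Nat"
    "HOL-Library.Extended_Real"
begin

section \<open>Smooth maps between open subsets of normed spaces\<close>

text \<open>The set \<open>S\<close> is meant to be open. For maps between Euclidean spaces, continuity of all
  iterated directional derivatives up to order \<open>k\<close> is the same as being of class \<open>C^k\<close>.\<close>

primrec Ck_on ::
  "nat \<Rightarrow> 'a::real_normed_vector set \<Rightarrow> ('a \<Rightarrow> 'b::real_normed_vector) \<Rightarrow> bool" where
  "Ck_on 0 S f \<longleftrightarrow> continuous_on S f"
| "Ck_on (Suc k) S f \<longleftrightarrow>
     (\<forall>x\<in>S. f differentiable (at x)) \<and> (\<forall>v. Ck_on k S (\<lambda>x. frechet_derivative f (at x) v))"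

definition smooth_on :: "'a::real_normed_vector set \<Rightarrow> ('a \<Rightarrow> 'b::real_normed_vector) \<Rightarrow> bool" where
  "smooth_on S f \<longleftrightarrow> (\<forall>k. Ck_on k S f)"

section \<open>Smooth manifolds\<close>

text \<open>The manifold is the whole type \<open>'m\<close>, its dimension is \<open>CARD('n)\<close>. A chart is a pair of
  its domain and the coordinate map, whose values outside the domain are irrelevant.\<close>

type_synonym ('m, 'n) chart = "'m set \<times> ('m \<Rightarrow> real ^ 'n)"

abbreviation cdom :: "('m, 'n) chart \<Rightarrow> 'm set" where
  "cdom c \<equiv> fst c"

abbreviation cmap :: "('m, 'n) chart \<Rightarrow> 'm \<Rightarrow> real ^ 'n" where
  "cmap c \<equiv> snd c"

abbreviation cinv :: "('m, 'n) chart \<Rightarrow> real ^ 'n \<Rightarrow> 'm" where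
  "cinv c \<equiv> inv_into (cdom c) (cmap c)"

definition is_chart :: "('m::topological_space, 'n::finite) chart \<Rightarrow> bool" where
  "is_chart c \<longleftrightarrow> open (cdom c) \<and> open (cmap c ` cdom c) \<and>
     homeomorphism (cdom c) (cmap c ` cdom c) (cmap c) (cinv c)"

text \<open>Smoothness of a self-map of the manifold. Applied to the identity it says that all
  transition maps of the atlas are smooth.\<close>

definition smooth_map ::
  "('m::topological_space, 'n::finite) chart set \<Rightarrow> ('m \<Rightarrow> 'm) \<Rightarrow> bool" where
  "smooth_map A f \<longleftrightarrow> continuous_on UNIV f \<and>
     (\<forall>c\<in>A. \<forall>c'\<in>A. smooth_on (cmap c ` (cdom c \<inter> f -` cdom c')) (cmap c' \<circ> f \<circ> cinv c))"

definition smooth_atlas :: "('m::topological_space, 'n::finite) chart set \<Rightarrow> bool" where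
  "smooth_atlas A \<longleftrightarrow> (\<forall>c\<in>A. is_chart c) \<and> (\<Union>c\<in>A. cdom c) = UNIV \<and> smooth_map A id"

definition smooth_fun ::
  "('m::topological_space, 'n::finite) chart set \<Rightarrow> ('m \<Rightarrow> complex) \<Rightarrow> bool" where
  "smooth_fun A u \<longleftrightarrow> (\<forall>c\<in>A. smooth_on (cmap c ` cdom c) (u \<circ> cinv c))"

text \<open>Quantities that do not depend on the chart are computed in an arbitrary chart at the point.\<close>

definition chart_at :: "('m, 'n) chart set \<Rightarrow> 'm \<Rightarrow> ('m, 'n) chart" where
  "chart_at A p = (SOME c. c \<in> A \<and> p \<in> cdom c)"

section \<open>Riemannian metrics\<close>

text \<open>A metric is given by its components: \<open>g c p $ i $ j\<close> is the value at \<open>p\<close> of the metric on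
  the coordinate fields \<open>i\<close> and \<open>j\<close> of the chart \<open>c\<close>.\<close>

type_synonym ('m, 'n) metric_components = "('m, 'n) chart \<Rightarrow> 'm \<Rightarrow> real ^ 'n ^ 'n"

text \<open>Jacobian matrix at \<open>p\<close> of \<open>f\<close>, read in \<open>c\<close> at \<open>p\<close> and in \<open>c'\<close> at \<open>f p\<close>.\<close>

definition jacobian_at ::
  "('m, 'n::finite) chart \<Rightarrow> ('m, 'n) chart \<Rightarrow> ('m \<Rightarrow> 'm) \<Rightarrow> 'm \<Rightarrow> real ^ 'n ^ 'n" where
  "jacobian_at c c' f p = matrix (frechet_derivative (cmap c' \<circ> f \<circ> cinv c) (at (cmap c p)))"

text \<open>The pullback of the metric by \<open>f\<close> is the metric itself. Applied to the identity this is the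
  transformation law of a covariant 2-tensor under change of charts.\<close>

definition preserves_metric ::
  "('m, 'n::finite) chart set \<Rightarrow> ('m, 'n) metric_components \<Rightarrow> ('m \<Rightarrow> 'm) \<Rightarrow> bool" where
  "preserves_metric A g f \<longleftrightarrow>
     (\<forall>c\<in>A. \<forall>c'\<in>A. \<forall>p \<in> cdom c \<inter> f -` cdom c'.
        g c p = transpose (jacobian_at c c' f p) ** g c' (f p) ** jacobian_at c c' f p)"

definition riemannian_metric ::
  "('m::topological_space, 'n::finite) chart set \<Rightarrow> ('m, 'n) metric_components \<Rightarrow> bool" where
  "riemannian_metric A g \<longleftrightarrow>
     (\<forall>c\<in>A. smooth_on (cmap c ` cdom c) (g c \<circ> cinv c) \<and>
        (\<forall>p\<in>cdom c. transpose (g c p) = g c p \<and> (\<forall>v. v \<noteq> 0 \<longrightarrow> v \<bullet> (g c p *v v) > 0))) \<and>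
     preserves_metric A g id"

definition riemannian_manifold ::
  "('m::{t2_space, second_countable_topology}, 'n::finite) chart set
     \<Rightarrow> ('m, 'n) metric_components \<Rightarrow> bool" where
  "riemannian_manifold A g \<longleftrightarrow> smooth_atlas A \<and> riemannian_metric A g"

definition isometry_of ::
  "('m::topological_space, 'n::finite) chart set \<Rightarrow> ('m, 'n) metric_components
     \<Rightarrow> ('m \<Rightarrow> 'm) \<Rightarrow> bool" where
  "isometry_of A g f \<longleftrightarrow>
     bij f \<and> smooth_map A f \<and> smooth_map A (inv f) \<and> preserves_metric A g f"

definition riemannian_homogeneous_space ::
  "('m::{t2_space, second_countable_topology}, 'n::finite) chart set
     \<Rightarrow> ('m, 'n) metric_components \<Rightarrow> bool" where
  "riemannian_homogeneous_space A g \<longleftrightarrow>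
     riemannian_manifold A g \<and> (\<forall>x y. \<exists>f. isometry_of A g f \<and> f x = y)"

section \<open>Riemannian distance\<close>

text \<open>Continuous paths on the unit interval that are continuously differentiable, including
  one-sided derivatives at the end points, on each closed piece between break points.\<close>

definition piecewise_C1_path ::
  "('m::topological_space, 'n::finite) chart set \<Rightarrow> (real \<Rightarrow> 'm) \<Rightarrow> bool" where
  "piecewise_C1_path A \<gamma> \<longleftrightarrow> path \<gamma> \<and>
     (\<exists>S. finite S \<and>
        (\<forall>c\<in>A. \<forall>a b. 0 \<le> a \<and> a < b \<and> b \<le> 1 \<and> {a<..<b} \<inter> S = {} \<and> \<gamma> ` {a..b} \<subseteq> cdom c \<longrightarrow>
           (\<exists>D. continuous_on {a..b} D \<and>
              (\<forall>t\<in>{a..b}. (cmap c \<circ> \<gamma> has_vector_derivative D t) (at t within {a..b})))))"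

definition speed ::
  "('m, 'n::finite) chart set \<Rightarrow> ('m, 'n) metric_components \<Rightarrow> (real \<Rightarrow> 'm) \<Rightarrow> real \<Rightarrow> real" where
  "speed A g \<gamma> t =
     (let c = chart_at A (\<gamma> t); v = vector_derivative (cmap c \<circ> \<gamma>) (at t)
      in sqrt (v \<bullet> (g c (\<gamma> t) *v v)))"

definition path_len ::
  "('m, 'n::finite) chart set \<Rightarrow> ('m, 'n) metric_components \<Rightarrow> (real \<Rightarrow> 'm) \<Rightarrow> real" where
  "path_len A g \<gamma> = integral {0..1} (speed A g \<gamma>)"

text \<open>Used on connected manifolds only, where the infimum is over a nonempty set.\<close>

definition rdist ::
  "('m::topological_space, 'n::finite) chart set \<Rightarrow> ('m, 'n) metric_components
     \<Rightarrow> 'm \<Rightarrow> 'm \<Rightarrow> real" where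
  "rdist A g x y =
     Inf {path_len A g \<gamma> | \<gamma>. piecewise_C1_path A \<gamma> \<and> pathstart \<gamma> = x \<and> pathfinish \<gamma> = y}"

section \<open>Riemannian volume\<close>

text \<open>The unique Borel measure with density \<open>sqrt (det g)\<close> with respect to Lebesgue measure in
  every chart.\<close>

definition riemannian_volume ::
  "('m::topological_space, 'n::finite) chart set \<Rightarrow> ('m, 'n) metric_components \<Rightarrow> 'm measure" where
  "riemannian_volume A g =
     (THE \<mu>. sets \<mu> = sets borel \<and>
        (\<forall>c\<in>A. \<forall>B\<in>sets borel. B \<subseteq> cdom c \<longrightarrow>
           emeasure \<mu> B =
             (\<integral>\<^sup>+x\<in>(cmap c ` B). ennreal (sqrt (det (g c (cinv c x)))) \<partial>lborel)))"

definition ball_volume ::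
  "('m::topological_space, 'n::finite) chart set \<Rightarrow> ('m, 'n) metric_components
     \<Rightarrow> 'm \<Rightarrow> real \<Rightarrow> real" where
  "ball_volume A g p r = measure (riemannian_volume A g) {q. rdist A g p q < r}"

section \<open>The Laplace--Beltrami operator\<close>

text \<open>Components in the chart \<open>c\<close> of the gradient of a complex-valued function, and the
  complex-bilinear extension of the metric.\<close>

definition gradient ::
  "('m, 'n::finite) metric_components \<Rightarrow> ('m, 'n) chart \<Rightarrow> ('m \<Rightarrow> complex) \<Rightarrow> 'm
     \<Rightarrow> complex ^ 'n" where
  "gradient g c u p =
     (\<chi> i. \<Sum>j\<in>UNIV. complex_of_real (matrix_inv (g c p) $ i $ j) *
        frechet_derivative (u \<circ> cinv c) (at (cmap c p)) (axis j 1))"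

definition metric_pairing ::
  "('m, 'n::finite) metric_components \<Rightarrow> ('m, 'n) chart \<Rightarrow> 'm
     \<Rightarrow> complex ^ 'n \<Rightarrow> complex ^ 'n \<Rightarrow> complex" where
  "metric_pairing g c p X Y =
     (\<Sum>i\<in>UNIV. \<Sum>j\<in>UNIV. complex_of_real (g c p $ i $ j) * X $ i * Y $ j)"

definition gradient_product ::
  "('m, 'n::finite) chart set \<Rightarrow> ('m, 'n) metric_components
     \<Rightarrow> ('m \<Rightarrow> complex) \<Rightarrow> ('m \<Rightarrow> complex) \<Rightarrow> 'm \<Rightarrow> complex" where
  "gradient_product A g u v p =
     (let c = chart_at A p in metric_pairing g c p (gradient g c u p) (gradient g c v p))"

text \<open>\<open>has_laplacian A g u w\<close> means that \<open>w\<close> is the Laplacian of the smooth function \<open>u\<close>, for the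
  nonnegative Laplacian, on a compact manifold (so that every smooth function is a test
  function). The function \<open>w\<close> is determined by \<open>u\<close>.\<close>

definition has_laplacian ::
  "('m::topological_space, 'n::finite) chart set \<Rightarrow> ('m, 'n) metric_components
     \<Rightarrow> ('m \<Rightarrow> complex) \<Rightarrow> ('m \<Rightarrow> complex) \<Rightarrow> bool" where
  "has_laplacian A g u w \<longleftrightarrow> smooth_fun A u \<and> smooth_fun A w \<and>
     (\<forall>v. smooth_fun A v \<longrightarrow>
        (\<integral>p. w p * cnj (v p) \<partial>riemannian_volume A g) =
        (\<integral>p. gradient_product A g u (\<lambda>q. cnj (v q)) p \<partial>riemannian_volume A g))"

definition eigenspace ::
  "('m::topological_space, 'n::finite) chart set \<Rightarrow> ('m, 'n) metric_components
     \<Rightarrow> real \<Rightarrow> ('m \<Rightarrow> complex) set" where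
  "eigenspace A g \<kappa> = {u. has_laplacian A g u (\<lambda>p. complex_of_real \<kappa> * u p)}"

section \<open>The eigenvalue counting function\<close>

global_interpretation complex_funs: vector_space "\<lambda>(a::complex) (f :: 'm \<Rightarrow> complex) x. a * f x"
  by unfold_locales (auto simp: fun_eq_iff algebra_simps)

text \<open>Complex dimension, with value \<open>\<infinity>\<close> for infinite-dimensional spaces (where the library's
  \<open>dim\<close> is \<open>0\<close>).\<close>

definition edim :: "('m \<Rightarrow> complex) set \<Rightarrow> enat" where
  "edim V = Sup {enat (card B) | B. B \<subseteq> V \<and> finite B \<and> complex_funs.independent B}"

text \<open>Eigenvectors to different eigenvalues are independent, so the span of the union of the
  eigenspaces is their direct sum.\<close>

definition eigenvalue_count ::
  "('m::topological_space, 'n::finite) chart set \<Rightarrow> ('m, 'n) metric_components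
     \<Rightarrow> real \<Rightarrow> enat" where
  "eigenvalue_count A g \<Lambda> = edim (complex_funs.span (\<Union>\<kappa>\<in>{..\<Lambda>}. eigenspace A g \<kappa>))"

definition moment :: "nat \<Rightarrow> real" where
  "moment d = integral {0..pi/2} (\<lambda>\<theta>. \<theta> ^ d * sin (2 * \<theta>))"

end

theory Submission
  imports Defs
begin

text \<open>Let \<open>V\<close> be the sum of the eigenspaces with eigenvalue at most
  \<open>\<Lambda>\<close>, and let \<open>\<phi> 0, \<dots>, \<phi> (n - 1)\<close> be an
  \<open>L\<^sup>2\<close>-orthonormal basis of \<open>V\<close>. An isometry preserves the
  volume and the gradient product, so composition with it maps \<open>V\<close> to itself and
  changes the basis by a unitary matrix. The functions \<open>\<Sum> |\<phi> j|\<^sup>2\<close>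
  and \<open>\<Sum> |\<nabla> \<phi> j|\<^sup>2\<close> do not see this change
  (\<open>kernel_isometry\<close>, \<open>energy_isometry\<close>); as the isometries act
  transitively, they are constants \<open>k\<close> and \<open>G\<close>. Integrating them gives
  \<open>k * vol M = n\<close> and, because functions in \<open>V\<close> have energy at most
  \<open>\<Lambda>\<close> times their square norm (\<open>low_space_energy\<close>), \<open>G
  \<le> \<Lambda> * k\<close>.

  Hence \<open>\<Phi> = (\<phi> 0, \<dots>, \<phi> (n - 1))\<close> maps \<open>M\<close> into
  the sphere of radius \<open>sqrt k\<close> and stretches tangent vectors by a factor of at
  most \<open>sqrt (\<Lambda> * k)\<close>. Seen from the centre of the sphere, the image of a
  path of length \<open>l\<close> spans an angle of at most \<open>sqrt \<Lambda> * l\<close>,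
  so that the angle between \<open>\<Phi> x\<close> and \<open>\<Phi> y\<close> is at most
  \<open>sqrt \<Lambda>\<close> times the distance of \<open>x\<close> and \<open>y\<close>
  (\<open>cos_rdist_le_correlation\<close>).

  Now fix \<open>p\<close> and put \<open>u = \<Sum> cnj (\<phi> j p) * \<phi> j\<close>. The
  square norm of \<open>u\<close> is \<open>k\<close>, and \<open>Re (u y) / k\<close> is the
  cosine of the angle between \<open>\<Phi> p\<close> and \<open>\<Phi> y\<close>. With
  \<open>\<rho>\<close> the distance to \<open>p\<close> and \<open>R = pi / (2 * sqrt
  \<Lambda>)\<close>, the radius up to which the cosine stays nonnegative, \<open>1 / k\<close>
  is at least the integral of \<open>(cos (sqrt \<Lambda> * \<rho>))\<^sup>2\<close> over the
  ball of radius \<open>R\<close>. Integration over the level sets of \<open>\<rho>\<close>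
  turns this integral into that of \<open>sqrt \<Lambda> * sin (2 * sqrt \<Lambda> * r) * v
  r\<close> over \<open>0 \<le> r \<le> R\<close>, where \<open>v r\<close> is the volume of the
  ball of radius \<open>r\<close> (\<open>nn_integral_layer_cake_cos\<close>). The condition on
  \<open>\<Lambda>\<close> says that \<open>R \<le> r0\<close>, so the volume bound \<open>v r
  \<ge> c * r ^ d\<close> applies on the whole range and gives \<open>1 / k \<ge> c * moment d /
  sqrt \<Lambda> ^ d\<close> (\<open>kernel_lower_bound\<close>); multiplied by \<open>n = k *
  vol M\<close> this is the claim.

  The argument presupposes that \<open>V\<close> has finite dimension. This comes from a direct
  estimate: \<open>M\<close> is covered by finitely many cells that are convex in a chart and so
  small that a Poincare inequality with a small constant holds on them. On each cell, the means
  of the members of an orthonormal system contribute at most \<open>1\<close> by Bessel's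
  inequality, and the deviations from the means are absorbed by the energy bound, so an
  orthonormal system in \<open>V\<close> has at most twice as many members as there are cells
  (\<open>orthonormal_system_bound\<close>). An orthonormal system in \<open>V\<close> of
  maximal size spans \<open>V\<close> (\<open>maximal_system_expansion\<close>).

  Underneath lie the basic facts on the volume: a unique measure has density \<open>sqrt (det
  g)\<close> in all charts, it is finite, positive on nonempty open sets, and invariant under
  isometries. Existence and invariance are two cases of the same computation
  (\<open>glued_volume_vimage\<close>), which rests on the change of variables formula. In the
  same way, \<open>dual_product_comp\<close> yields both the chart independence of the gradient
  product and its invariance.\<close>

section \<open>Calculus of \<open>C\<^sup>k\<close> maps\<close>

lemma frechet_derivative_eq_on_open:
  assumes "open S" "x \<in> S" "\<And>y. y \<in> S \<Longrightarrow> f y = g y"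
  shows "frechet_derivative f (at x) = frechet_derivative g (at x)"
proof -
  have "(f has_derivative D) (at x) \<longleftrightarrow> (g has_derivative D) (at x)" for D
    using assms by (auto intro: has_derivative_transform_within_open)
  then show ?thesis by (simp add: frechet_derivative_def)
qed

lemma differentiable_eq_on_open:
  assumes "open S" "x \<in> S" "\<And>y. y \<in> S \<Longrightarrow> f y = g y" "f differentiable (at x)"
  shows "g differentiable (at x)"
proof -
  obtain D where "(f has_derivative D) (at x)"
    using assms(4) by (auto simp: differentiable_def)
  then have "(g has_derivative D) (at x)"
    using assms(1-3) by (rule has_derivative_transform_within_open)
  then show ?thesis by (auto simp: differentiable_def)
qed

text \<open>The derivatives in \<open>Ck_on\<close> are taken at points in the full space, so
  only on an open set do they depend on the values in the set alone.\<close>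

lemma Ck_on_cong:
  assumes "open S" "\<And>x. x \<in> S \<Longrightarrow> f x = g x" "Ck_on k S f"
  shows "Ck_on k S g"
  using assms(2,3)
proof (induction k arbitrary: f g)
  case 0
  then show ?case by (simp cong: continuous_on_cong)
next
  case (Suc k)
  have "frechet_derivative f (at x) v = frechet_derivative g (at x) v" if "x \<in> S" for x v
    using frechet_derivative_eq_on_open[OF assms(1) that, of f g] Suc.prems(1) by simp
  then have "Ck_on k S (\<lambda>x. frechet_derivative g (at x) v)" for v
    using Suc.IH[of "\<lambda>x. frechet_derivative f (at x) v" "\<lambda>x. frechet_derivative g (at x) v"]
      Suc.prems(2) by simp
  moreover have "g differentiable (at x)" if "x \<in> S" for x
    using differentiable_eq_on_open[OF assms(1) that, of f g] Suc.prems that by simp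
  ultimately show ?case by simp
qed

lemma Ck_on_local:
  assumes "\<And>x. x \<in> S \<Longrightarrow> \<exists>U. open U \<and> x \<in> U \<and> Ck_on k U f"
  shows "Ck_on k S f"
  using assms
proof (induction k arbitrary: f)
  case 0
  have "isCont f x" if "x \<in> S" for x
    using 0[OF that] by (auto simp: continuous_on_eq_continuous_at)
  then show ?case by (simp add: continuous_at_imp_continuous_on)
next
  case (Suc k)
  show ?case
    unfolding Ck_on.simps
  proof (intro conjI ballI allI)
    show "f differentiable (at x)" if "x \<in> S" for x
      using Suc.prems[OF that] by auto
    show "Ck_on k S (\<lambda>x. frechet_derivative f (at x) v)" for v
    proof (rule Suc.IH)
      fix x assume "x \<in> S"
      then show "\<exists>U. open U \<and> x \<in> U \<and> Ck_on k U (\<lambda>x. frechet_derivative f (at x) v)"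
        using Suc.prems[of x] by auto
    qed
  qed
qed

lemma Ck_on_Suc_imp:
  assumes "open S" "Ck_on (Suc k) S f"
  shows "Ck_on k S f"
  using assms(2)
proof (induction k arbitrary: f)
  case 0
  then show ?case
    by (auto intro!: continuous_at_imp_continuous_on differentiable_imp_continuous_within)
next
  case (Suc k)
  then show ?case by (metis Ck_on.simps(2))
qed

text \<open>A bounded linear map commutes with differentiation, so the induction on
  \<open>k\<close> closes on the same statement for the derivative of \<open>f\<close>. The
  following closure properties are proved by the same pattern: the derivative is rewritten by
  its differentiation rule into a term of the class under consideration.\<close>

lemma Ck_on_bounded_linear:
  assumes "bounded_linear L" "open S" "Ck_on k S f"
  shows "Ck_on k S (\<lambda>x. L (f x))"
  using assms(3)
proof (induction k arbitrary: f)
  case 0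
  then show ?case
    using assms(1) by (auto intro: bounded_linear.continuous_on)
next
  case (Suc k)
  have D: "((\<lambda>x. L (f x)) has_derivative (\<lambda>v. L (frechet_derivative f (at x) v))) (at x)"
    if "x \<in> S" for x
    using Suc.prems that assms(1)
    by (auto intro!: bounded_linear.has_derivative[OF assms(1)] simp: frechet_derivative_works)
  have "Ck_on k S (\<lambda>x. frechet_derivative (\<lambda>x. L (f x)) (at x) v)" for v
  proof (rule Ck_on_cong[OF assms(2)])
    show "Ck_on k S (\<lambda>x. L (frechet_derivative f (at x) v))"
      using Suc.prems by (intro Suc.IH) simp
    show "L (frechet_derivative f (at x) v) = frechet_derivative (\<lambda>x. L (f x)) (at x) v"
      if "x \<in> S" for x
      by (rule fun_cong[OF frechet_derivative_at[OF D[OF that]]])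
  qed
  with Derivative.differentiableI[OF D] show ?case by simp
qed

lemma Ck_on_const: "Ck_on k S (\<lambda>x. c)"
  by (induction k arbitrary: c) (auto simp: frechet_derivative_const)

lemma Ck_on_add:
  assumes "open S" "Ck_on k S f" "Ck_on k S g"
  shows "Ck_on k S (\<lambda>x. f x + g x)"
  using assms(2,3)
proof (induction k arbitrary: f g)
  case 0
  then show ?case by (auto intro: continuous_on_add)
next
  case (Suc k)
  have D: "((\<lambda>x. f x + g x) has_derivative
      (\<lambda>v. frechet_derivative f (at x) v + frechet_derivative g (at x) v)) (at x)"
    if "x \<in> S" for x
    using Suc.prems that by (auto intro!: has_derivative_add simp: frechet_derivative_works)
  have "Ck_on k S (\<lambda>x. frechet_derivative (\<lambda>x. f x + g x) (at x) v)" for v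
  proof (rule Ck_on_cong[OF assms(1)])
    show "Ck_on k S (\<lambda>x. frechet_derivative f (at x) v + frechet_derivative g (at x) v)"
      using Suc.prems by (intro Suc.IH) simp_all
    show "frechet_derivative f (at x) v + frechet_derivative g (at x) v =
        frechet_derivative (\<lambda>x. f x + g x) (at x) v" if "x \<in> S" for x
      by (rule fun_cong[OF frechet_derivative_at[OF D[OF that]]])
  qed
  with Derivative.differentiableI[OF D] show ?case by simp
qed

lemma Ck_on_sum:
  assumes "open S" "\<And>i. i \<in> I \<Longrightarrow> Ck_on k S (f i)"
  shows "Ck_on k S (\<lambda>x. \<Sum>i\<in>I. f i x)"
  using assms(2)
proof (induction I rule: infinite_finite_induct)
  case (insert i I)
  then show ?case using Ck_on_add[OF assms(1), of k "f i" "\<lambda>x. \<Sum>i\<in>I. f i x"] by simp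
qed (simp_all add: Ck_on_const)

lemma Ck_on_scaleR:
  fixes r :: "'a::real_normed_vector \<Rightarrow> real"
  assumes "open S" "Ck_on k S r" "Ck_on k S f"
  shows "Ck_on k S (\<lambda>x. r x *\<^sub>R f x)"
  using assms(2,3)
proof (induction k arbitrary: r f)
  case 0
  then show ?case by (auto intro: continuous_on_scaleR)
next
  case (Suc k)
  have D: "((\<lambda>x. r x *\<^sub>R f x) has_derivative
      (\<lambda>v. r x *\<^sub>R frechet_derivative f (at x) v + frechet_derivative r (at x) v *\<^sub>R f x)) (at x)"
    if "x \<in> S" for x
    using Suc.prems that by (auto intro!: has_derivative_scaleR simp: frechet_derivative_works)
  have "Ck_on k S (\<lambda>x. frechet_derivative (\<lambda>x. r x *\<^sub>R f x) (at x) v)" for v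
  proof (rule Ck_on_cong[OF assms(1)])
    show "Ck_on k S (\<lambda>x. r x *\<^sub>R frechet_derivative f (at x) v +
        frechet_derivative r (at x) v *\<^sub>R f x)"
      using Suc.prems by (intro Ck_on_add Suc.IH assms(1)) (auto intro: Ck_on_Suc_imp[OF assms(1)])
    show "r x *\<^sub>R frechet_derivative f (at x) v + frechet_derivative r (at x) v *\<^sub>R f x =
        frechet_derivative (\<lambda>x. r x *\<^sub>R f x) (at x) v" if "x \<in> S" for x
      by (rule fun_cong[OF frechet_derivative_at[OF D[OF that]]])
  qed
  with Derivative.differentiableI[OF D] show ?case by simp
qed

text \<open>The chain rule with the outer derivative expanded in a basis. In this form the
  derivative in a fixed direction is a finite sum of products of a function on the source and a
  partial derivative of \<open>u\<close>, composed with \<open>f\<close>, which is what the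
  induction for composites needs.\<close>

lemma frechet_derivative_chain_Basis:
  fixes f :: "'a::real_normed_vector \<Rightarrow> 'b::euclidean_space"
    and u :: "'b \<Rightarrow> 'c::real_normed_vector"
  assumes "f differentiable (at x)" "u differentiable (at (f x))"
  shows "((\<lambda>x. u (f x)) has_derivative (\<lambda>v. \<Sum>b\<in>Basis. (frechet_derivative f (at x) v \<bullet> b) *\<^sub>R
      frechet_derivative u (at (f x)) b)) (at x)"
proof -
  let ?u = "frechet_derivative u (at (f x))" and ?f = "frechet_derivative f (at x)"
  have "((u \<circ> f) has_derivative (?u \<circ> ?f)) (at x)"
    using assms by (intro diff_chain_at) (auto simp: frechet_derivative_works)
  moreover have "?u (?f v) = (\<Sum>b\<in>Basis. (?f v \<bullet> b) *\<^sub>R ?u b)" for v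
    using linear_frechet_derivative[OF assms(2)]
    by (subst euclidean_representation[symmetric]) (simp add: linear_sum linear_scale)
  ultimately show ?thesis by (simp add: o_def)
qed

text \<open>By induction on \<open>k\<close>: a derivative of the composite is a sum of products
  of a \<open>C\<^sup>k\<close> function (a component of the derivative of \<open>f\<close>)
  with a partial derivative of \<open>u\<close> composed with \<open>f\<close>, to which the
  induction hypothesis applies since \<open>u\<close> is generalised.\<close>

lemma Ck_on_compose:
  fixes f :: "'a::real_normed_vector \<Rightarrow> 'b::euclidean_space"
    and u :: "'b \<Rightarrow> 'c::real_normed_vector"
  assumes "open S" "open T" "f ` S \<subseteq> T" "Ck_on k S f" "Ck_on k T u"
  shows "Ck_on k S (\<lambda>x. u (f x))"
  using assms(4,5)
proof (induction k arbitrary: u)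
  case 0
  then show ?case
    using assms(3) by (auto intro: continuous_on_compose2)
next
  case (Suc k)
  have D: "((\<lambda>x. u (f x)) has_derivative (\<lambda>v. \<Sum>b\<in>Basis. (frechet_derivative f (at x) v \<bullet> b) *\<^sub>R
      frechet_derivative u (at (f x)) b)) (at x)" if "x \<in> S" for x
    using Suc.prems that assms(3) by (intro frechet_derivative_chain_Basis) auto
  have "Ck_on k S (\<lambda>x. frechet_derivative (\<lambda>x. u (f x)) (at x) v)" for v
  proof (rule Ck_on_cong[OF assms(1)])
    show "Ck_on k S (\<lambda>x. \<Sum>b\<in>Basis. (frechet_derivative f (at x) v \<bullet> b) *\<^sub>R
        frechet_derivative u (at (f x)) b)"
    proof (rule Ck_on_sum[OF assms(1)], rule Ck_on_scaleR[OF assms(1)])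
      fix b :: 'b
      show "Ck_on k S (\<lambda>x. frechet_derivative f (at x) v \<bullet> b)"
        using Suc.prems(1) Ck_on_bounded_linear[OF bounded_linear_inner_left[of b] assms(1)] by simp
      show "Ck_on k S (\<lambda>x. frechet_derivative u (at (f x)) b)"
        using Suc.prems Ck_on_Suc_imp[OF assms(1)]
        by (intro Suc.IH[of "\<lambda>y. frechet_derivative u (at y) b"]) auto
    qed
    show "(\<Sum>b\<in>Basis. (frechet_derivative f (at x) v \<bullet> b) *\<^sub>R frechet_derivative u (at (f x)) b) =
        frechet_derivative (\<lambda>x. u (f x)) (at x) v" if "x \<in> S" for x
      by (rule fun_cong[OF frechet_derivative_at[OF D[OF that]]])
  qed
  with Derivative.differentiableI[OF D] show ?case by simp
qed

lemma smooth_on_differentiable: "smooth_on S f \<Longrightarrow> x \<in> S \<Longrightarrow> f differentiable (at x)"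
  unfolding smooth_on_def by (metis Ck_on.simps(2))

lemma smooth_on_continuous: "smooth_on S f \<Longrightarrow> continuous_on S f"
  unfolding smooth_on_def by (metis Ck_on.simps(1))

lemma smooth_on_continuous_derivative:
  "smooth_on S f \<Longrightarrow> continuous_on S (\<lambda>x. frechet_derivative f (at x) v)"
  unfolding smooth_on_def by (auto dest!: spec[of _ 1])

section \<open>Positive definite matrices\<close>

definition pos_def :: "real ^ 'n ^ 'n \<Rightarrow> bool" where
  "pos_def H \<longleftrightarrow> transpose H = H \<and> (\<forall>v. v \<noteq> 0 \<longrightarrow> v \<bullet> (H *v v) > 0)"

lemma pos_def_nonneg: "pos_def H \<Longrightarrow> v \<bullet> (H *v v) \<ge> 0"
  unfolding pos_def_def by (cases "v = 0") (auto intro: less_imp_le)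

lemma pos_def_det_nz:
  assumes "\<And>v. v \<noteq> 0 \<Longrightarrow> v \<bullet> (H *v v) > 0"
  shows "det (H :: real ^ 'n ^ 'n) \<noteq> 0"
proof
  assume "det H = 0"
  then obtain v where "v \<noteq> 0" "H *v v = 0"
    using invertible_det_nz[of H] matrix_left_invertible_ker[of H] invertible_left_inverse by blast
  then show False using assms[of v] by simp
qed

text \<open>The segment from the identity to \<open>H\<close> consists of positive definite,
  hence invertible matrices, so the determinant keeps its sign along it.\<close>

lemma pos_def_det_pos:
  assumes "pos_def H"
  shows "det H > 0"
proof (rule ccontr)
  assume "\<not> det H > 0"
  let ?K = "\<lambda>t. t *\<^sub>R H + (1 - t) *\<^sub>R mat 1"
  have "\<exists>t\<ge>0. t \<le> 1 \<and> det (?K t) = 0"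
  proof (rule IVT2')
    show "det (?K 1) \<le> 0" "0 \<le> det (?K 0)"
      using \<open>\<not> det H > 0\<close> by simp_all
    show "continuous_on {0..1} (\<lambda>t. det (?K t))"
      unfolding det_def by (intro continuous_intros)
  qed simp
  then obtain t where t: "0 \<le> t" "t \<le> 1" "det (?K t) = 0" by blast
  have "v \<bullet> (?K t *v v) > 0" if "v \<noteq> 0" for v
  proof -
    have "v \<bullet> (?K t *v v) = t * (v \<bullet> (H *v v)) + (1 - t) * (v \<bullet> v)"
      by (simp add: matrix_vector_mult_add_rdistrib scaleR_matrix_vector_assoc[symmetric] inner_add_right)
    moreover have "v \<bullet> (H *v v) > 0" "v \<bullet> v > 0"
      using assms that by (auto simp: pos_def_def)
    ultimately show ?thesis
      using t by (cases "t = 0") (auto intro!: add_pos_nonneg)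
  qed
  then show False using pos_def_det_nz[of "?K t"] t(3) by blast
qed

lemma matrix_inv:
  assumes "invertible H"
  shows "H ** matrix_inv H = mat 1" "matrix_inv H ** H = mat 1"
  using someI_ex[OF assms[unfolded invertible_def]] by (simp_all add: matrix_inv_def)

lemma pos_def_inverse:
  assumes "pos_def H"
  shows "H ** matrix_inv H = mat 1" "matrix_inv H ** H = mat 1"
    "transpose (matrix_inv H) = matrix_inv H"
proof -
  have "invertible H"
    using pos_def_det_pos[OF assms] by (simp add: invertible_det_nz)
  then show 1: "H ** matrix_inv H = mat 1" "matrix_inv H ** H = mat 1"
    by (simp_all add: matrix_inv)
  have "transpose (matrix_inv H) ** H = mat 1"
    using arg_cong[OF 1(1), of transpose] assms
    by (simp add: matrix_transpose_mul pos_def_def transpose_mat)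
  then show "transpose (matrix_inv H) = matrix_inv H"
    by (metis 1(1) matrix_mul_assoc matrix_mul_lid matrix_mul_rid)
qed

lemma inner_matrix_transpose: "v \<bullet> (H *v w) = (transpose H *v v) \<bullet> (w :: real ^ 'n)"
  by (simp add: dot_lmul_matrix[symmetric])

lemma pos_def_Cauchy_Schwarz:
  fixes v w :: "real ^ 'n"
  assumes "pos_def H"
  shows "(v \<bullet> (H *v w))\<^sup>2 \<le> (v \<bullet> (H *v v)) * (w \<bullet> (H *v w))"
proof (cases "w = 0")
  case False
  define a b c where "a = v \<bullet> (H *v v)" and "b = v \<bullet> (H *v w)" and "c = w \<bullet> (H *v w)"
  have c: "c > 0" using assms False by (auto simp: pos_def_def c_def)
  have b: "w \<bullet> (H *v v) = b"
    using assms inner_matrix_transpose[of w H v] by (simp add: pos_def_def b_def inner_commute)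
  have "0 \<le> (v - (b / c) *\<^sub>R w) \<bullet> (H *v (v - (b / c) *\<^sub>R w))"
    by (rule pos_def_nonneg[OF assms])
  also have "\<dots> = a - (b / c) * b - (b / c) * b + (b / c) * (b / c) * c"
    by (simp add: matrix_vector_mult_diff_distrib matrix_vector_mult_scaleR inner_diff_left
        inner_diff_right a_def b_def[symmetric] c_def b algebra_simps)
  also have "\<dots> = a - b\<^sup>2 / c"
    using c by (simp add: field_simps power2_eq_square)
  finally have "b\<^sup>2 \<le> a * c" using c by (simp add: field_simps)
  then show ?thesis by (simp add: a_def b_def c_def)
qed simp

text \<open>The Cauchy-Schwarz inequality of \<open>H\<close> for \<open>v\<close> and the
  vector \<open>matrix_inv H *v x\<close> that represents the functional \<open>x\<close>: the
  inverse matrix is the form on covectors that is dual to \<open>H\<close>.\<close>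

lemma pos_def_Cauchy_Schwarz_dual:
  fixes x v :: "real ^ 'n"
  assumes "pos_def H"
  shows "(x \<bullet> v)\<^sup>2 \<le> (x \<bullet> (matrix_inv H *v x)) * (v \<bullet> (H *v v))"
proof -
  let ?y = "matrix_inv H *v x"
  have y: "H *v ?y = x"
    using pos_def_inverse(1)[OF assms] by (simp add: matrix_vector_mul_assoc)
  have "(x \<bullet> v)\<^sup>2 = (v \<bullet> (H *v ?y))\<^sup>2" by (simp only: y inner_commute)
  also have "\<dots> \<le> (v \<bullet> (H *v v)) * (?y \<bullet> (H *v ?y))"
    by (rule pos_def_Cauchy_Schwarz[OF assms])
  also have "?y \<bullet> (H *v ?y) = x \<bullet> ?y" by (simp only: y inner_commute)
  finally show ?thesis by (simp add: mult.commute)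
qed

lemma continuous_on_det:
  fixes f :: "'a::topological_space \<Rightarrow> real ^ 'n ^ 'n"
  assumes "continuous_on S f"
  shows "continuous_on S (\<lambda>x. det (f x))"
  unfolding det_def by (intro continuous_intros assms)

text \<open>Cramer's rule exhibits the entries of the inverse as quotients of determinants, from
  which their continuous dependence on the matrix is read off.\<close>

lemma matrix_inv_entry:
  fixes H :: "real ^ 'n ^ 'n"
  assumes "det H \<noteq> 0"
  shows "matrix_inv H $ i $ j = det (\<chi> a b. if b = i then axis j 1 $ a else H $ a $ b) / det H"
proof -
  have "H *v (matrix_inv H *v axis j 1) = axis j 1"
    using assms by (simp add: matrix_vector_mul_assoc matrix_inv invertible_det_nz)
  then have "matrix_inv H *v axis j 1 =
      (\<chi> k. det (\<chi> a b. if b = k then axis j 1 $ a else H $ a $ b) / det H)"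
    using cramer[OF assms] by blast
  moreover have "(matrix_inv H *v axis j 1) $ i = matrix_inv H $ i $ j"
    by (simp add: matrix_vector_mult_basis column_def)
  ultimately show ?thesis by simp
qed

lemma continuous_on_matrix_inv_entry:
  fixes f :: "'a::topological_space \<Rightarrow> real ^ 'n ^ 'n"
  assumes "continuous_on S f" "\<And>x. x \<in> S \<Longrightarrow> det (f x) \<noteq> 0"
  shows "continuous_on S (\<lambda>x. matrix_inv (f x) $ i $ j)"
proof -
  have "continuous_on S (\<lambda>x. \<chi> a b. if b = i then axis j 1 $ a else f x $ a $ b)"
  proof (intro continuous_on_vec_lambda)
    show "continuous_on S (\<lambda>x. if b = i then axis j 1 $ a else f x $ a $ b)" for a b
      using assms(1) by (cases "b = i") (auto intro!: continuous_on_component)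
  qed
  then have "continuous_on S (\<lambda>x. det (\<chi> a b. if b = i then axis j 1 $ a else f x $ a $ b) / det (f x))"
    by (intro continuous_on_divide continuous_on_det assms) (use assms in auto)
  then show ?thesis
    by (rule continuous_on_eq) (simp add: matrix_inv_entry assms)
qed

section \<open>Change of variables for nonnegative integrals\<close>

lemma nn_integral_eq_integral_on:
  fixes g :: "'a::euclidean_space \<Rightarrow> real"
  assumes "g absolutely_integrable_on S" "\<And>x. x \<in> S \<Longrightarrow> g x \<ge> 0"
    and m: "(\<lambda>x. indicator S x * g x) \<in> borel_measurable borel"
  shows "(\<integral>\<^sup>+x\<in>S. ennreal (g x) \<partial>lborel) = ennreal (integral S g)"
proof -
  have i: "integrable lebesgue (\<lambda>x. indicator S x * g x)"
    using assms(1) by (simp add: set_integrable_def)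
  have "(\<integral>\<^sup>+x\<in>S. ennreal (g x) \<partial>lborel) = (\<integral>\<^sup>+x. ennreal (indicator S x * g x) \<partial>lborel)"
    by (intro nn_integral_cong) (auto simp: indicator_def)
  also have "\<dots> = (\<integral>\<^sup>+x. ennreal (indicator S x * g x) \<partial>lebesgue)"
    using m by (simp add: nn_integral_completion)
  also have "\<dots> = ennreal (LINT x|lebesgue. indicator S x * g x)"
    using assms(2) by (intro nn_integral_eq_integral i) (auto simp: indicator_def)
  also have "(LINT x|lebesgue. indicator S x * g x) = integral S g"
    using set_lebesgue_integral_eq_integral(2)[OF assms(1)] by (simp add: set_lebesgue_integral_def)
  finally show ?thesis .
qed

text \<open>Together with the preceding lemma this characterises integrability of a nonnegative
  function by a finite integral in \<open>ennreal\<close>, so that a formula for integrable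
  functions extends to all nonnegative ones: if one side is infinite, the other one cannot be
  finite.\<close>

lemma absolutely_integrable_of_nn_integral:
  fixes g :: "'a::euclidean_space \<Rightarrow> real"
  assumes "(\<integral>\<^sup>+x\<in>S. ennreal (g x) \<partial>lborel) < \<infinity>" "\<And>x. x \<in> S \<Longrightarrow> g x \<ge> 0"
    and m: "(\<lambda>x. indicator S x * g x) \<in> borel_measurable borel"
  shows "g absolutely_integrable_on S"
proof -
  have "integrable lborel (\<lambda>x. indicator S x * g x)"
  proof (rule integrableI_nonneg)
    have "(\<integral>\<^sup>+x. ennreal (indicator S x * g x) \<partial>lborel) = (\<integral>\<^sup>+x\<in>S. ennreal (g x) \<partial>lborel)"
      by (intro nn_integral_cong) (auto simp: indicator_def)
    then show "(\<integral>\<^sup>+x. ennreal (indicator S x * g x) \<partial>lborel) < \<infinity>"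
      using assms(1) by simp
  qed (use m assms(2) in \<open>auto simp: indicator_def\<close>)
  then show ?thesis
    using m by (simp add: set_integrable_def integrable_completion)
qed

text \<open>The change of variables formula for functions with values in \<open>real ^
  1\<close>, carried over to real-valued functions.\<close>

lemma change_of_variables_real:
  fixes f :: "real ^ 'm::{finite,wellorder} \<Rightarrow> real" and g :: "real ^ 'm::_ \<Rightarrow> real ^ 'm::_"
  assumes "S \<in> sets lebesgue" "\<And>x. x \<in> S \<Longrightarrow> (g has_derivative g' x) (at x within S)" "inj_on g S"
  shows "(\<lambda>x. \<bar>det (matrix (g' x))\<bar> * f (g x)) absolutely_integrable_on S \<and>
      integral S (\<lambda>x. \<bar>det (matrix (g' x))\<bar> * f (g x)) = b
    \<longleftrightarrow> f absolutely_integrable_on (g ` S) \<and> integral (g ` S) f = b"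
proof -
  have ai: "(\<lambda>x. vec (h x) :: real ^ 1) absolutely_integrable_on T \<longleftrightarrow> h absolutely_integrable_on T"
    for h :: "real ^ 'm::{finite,wellorder} \<Rightarrow> real" and T
    by (subst absolutely_integrable_componentwise_iff) (auto simp: Basis_vec_def inner_axis)
  have i: "integral T (\<lambda>x. vec (h x) :: real ^ 1) = vec (integral T h)"
    if "h absolutely_integrable_on T" for h :: "real ^ 'm::{finite,wellorder} \<Rightarrow> real" and T
  proof -
    have "h integrable_on T"
      using that by (simp add: absolutely_integrable_on_def)
    then have "((\<lambda>x. vec (h x) :: real ^ 1) has_integral vec (integral T h)) T"
      by (subst has_integral_componentwise_iff) (auto simp: Basis_vec_def inner_axis integrable_integral)
    then show ?thesis by blast
  qed
  have v: "r *\<^sub>R (vec x :: real ^ 1) = vec (r * x)" for r x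
    by (simp add: vec_eq_iff)
  have vec_inj: "(vec x :: real ^ 1) = vec y \<longleftrightarrow> x = y" for x y
    by (simp add: vec_eq_iff)
  show ?thesis (is "?P \<and> ?p = b \<longleftrightarrow> ?Q \<and> ?q = b")
  proof -
    have "?P \<and> vec ?p = (vec b :: real ^ 1) \<longleftrightarrow> ?Q \<and> vec ?q = (vec b :: real ^ 1)"
    proof -
      have "(\<lambda>x. \<bar>det (matrix (g' x))\<bar> *\<^sub>R (vec (f (g x)) :: real ^ 1)) absolutely_integrable_on S \<and>
          integral S (\<lambda>x. \<bar>det (matrix (g' x))\<bar> *\<^sub>R (vec (f (g x)) :: real ^ 1)) = vec b \<longleftrightarrow>
        (\<lambda>x. vec (f x) :: real ^ 1) absolutely_integrable_on (g ` S) \<and>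
          integral (g ` S) (\<lambda>x. vec (f x) :: real ^ 1) = vec b"
        by (rule has_absolute_integral_change_of_variables) (use assms in auto)
      then show ?thesis
        unfolding v ai by (cases ?P; cases ?Q) (simp_all add: i)
    qed
    then show ?thesis by (simp only: vec_inj)
  qed
qed

lemma nn_integral_change_of_variables_wellorder:
  fixes f :: "real ^ 'm::{finite,wellorder} \<Rightarrow> real" and g :: "real ^ 'm::_ \<Rightarrow> real ^ 'm::_"
  assumes S: "S \<in> sets borel" and der: "\<And>x. x \<in> S \<Longrightarrow> (g has_derivative g' x) (at x)"
    and inj: "inj_on g S" and nonneg: "\<And>y. y \<in> g ` S \<Longrightarrow> f y \<ge> 0"
    and m1: "(\<lambda>y. indicator (g ` S) y * f y) \<in> borel_measurable borel"
    and m2: "(\<lambda>x. indicator S x * (\<bar>det (matrix (g' x))\<bar> * f (g x))) \<in> borel_measurable borel"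
  shows "(\<integral>\<^sup>+x\<in>S. ennreal (\<bar>det (matrix (g' x))\<bar> * f (g x)) \<partial>lborel) = (\<integral>\<^sup>+y\<in>g ` S. ennreal (f y) \<partial>lborel)"
proof -
  let ?h = "\<lambda>x. \<bar>det (matrix (g' x))\<bar> * f (g x)"
  have S': "S \<in> sets lebesgue" using S by simp
  have nonneg': "?h x \<ge> 0" if "x \<in> S" for x
    using nonneg that by simp
  have cov: "?h absolutely_integrable_on S \<and> integral S ?h = b \<longleftrightarrow>
      f absolutely_integrable_on (g ` S) \<and> integral (g ` S) f = b" for b
    by (rule change_of_variables_real[OF S' has_derivative_at_withinI[OF der] inj])
  show ?thesis
  proof (cases "f absolutely_integrable_on (g ` S)")
    case True
    then have "?h absolutely_integrable_on S" "integral S ?h = integral (g ` S) f"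
      using cov by blast+
    then show ?thesis
      using nn_integral_eq_integral_on[OF _ nonneg' m2] nn_integral_eq_integral_on[OF True nonneg m1]
      by simp
  next
    case False
    then have "\<not> ?h absolutely_integrable_on S"
      using cov by blast
    then have "\<not> (\<integral>\<^sup>+x\<in>S. ennreal (?h x) \<partial>lborel) < \<infinity>"
      using absolutely_integrable_of_nn_integral[OF _ nonneg' m2] by blast
    moreover have "\<not> (\<integral>\<^sup>+y\<in>g ` S. ennreal (f y) \<partial>lborel) < \<infinity>"
      using absolutely_integrable_of_nn_integral[OF _ nonneg m1] False by blast
    ultimately have "(\<integral>\<^sup>+x\<in>S. ennreal (?h x) \<partial>lborel) = \<infinity>" "(\<integral>\<^sup>+y\<in>g ` S. ennreal (f y) \<partial>lborel) = \<infinity>"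
      by (auto simp: less_top[symmetric])
    then show ?thesis by simp
  qed
qed

text \<open>The formula above is for coordinates indexed by a well-ordered type. An arbitrary
  finite index type is copied to \<open>'n wo\<close>, which is ordered by an arbitrary
  injection into the natural numbers. Renaming the coordinates is a linear isometry that
  preserves Lebesgue measure (\<open>distr_to_wo\<close>) and determinants
  (\<open>det_reindex_wo\<close>), so the formula is transported along it.\<close>

typedef ('n::finite) wo = "UNIV :: 'n set" by simp

instance wo :: (finite) finite
proof
  have "(UNIV :: 'a wo set) = range Abs_wo"
    by (metis Rep_wo_inverse surjI)
  then show "finite (UNIV :: 'a wo set)"
    by (metis finite finite_imageI)
qed

definition wo_pos :: "'n::finite wo \<Rightarrow> nat" where
  "wo_pos = (SOME f. inj f)"

lemma inj_wo_pos: "inj wo_pos"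
proof -
  have "\<exists>f :: 'a wo \<Rightarrow> nat. inj f"
    using finite_imp_inj_to_nat_seg[of "UNIV :: 'a wo set"] by auto
  then show ?thesis unfolding wo_pos_def by (rule someI_ex)
qed

instantiation wo :: (finite) wellorder
begin

definition less_eq_wo :: "'a wo \<Rightarrow> 'a wo \<Rightarrow> bool" where
  "less_eq_wo x y \<longleftrightarrow> wo_pos x \<le> wo_pos y"

definition less_wo :: "'a wo \<Rightarrow> 'a wo \<Rightarrow> bool" where
  "less_wo x y \<longleftrightarrow> wo_pos x < wo_pos y"

instance
proof
  fix x y :: "'a wo"
  show "x \<le> y \<Longrightarrow> y \<le> x \<Longrightarrow> x = y"
    using inj_wo_pos by (auto simp: less_eq_wo_def inj_def)
next
  fix P :: "'a wo \<Rightarrow> bool" and a :: "'a wo"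
  assume step: "\<And>x. (\<And>y. y < x \<Longrightarrow> P y) \<Longrightarrow> P x"
  show "P a"
    by (rule measure_induct_rule[of wo_pos P a], rule step) (simp add: less_wo_def)
qed (auto simp: less_eq_wo_def less_wo_def)

end

definition to_wo :: "real ^ 'n \<Rightarrow> real ^ ('n::finite) wo" where
  "to_wo x = (\<chi> i. x $ Rep_wo i)"

definition of_wo :: "real ^ ('n::finite) wo \<Rightarrow> real ^ 'n" where
  "of_wo y = (\<chi> i. y $ Abs_wo i)"

lemma of_to_wo [simp]: "of_wo (to_wo x) = x" and to_of_wo [simp]: "to_wo (of_wo y) = y"
  by (simp_all add: to_wo_def of_wo_def vec_eq_iff Abs_wo_inverse Rep_wo_inverse)

lemma linear_to_wo: "linear to_wo" and linear_of_wo: "linear of_wo"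
  by (auto intro!: linearI simp: to_wo_def of_wo_def vec_eq_iff)

lemma bounded_linear_to_wo: "bounded_linear to_wo" and bounded_linear_of_wo: "bounded_linear of_wo"
  using linear_to_wo linear_of_wo by (simp_all add: linear_conv_bounded_linear)

lemma measurable_to_wo [measurable]: "to_wo \<in> borel_measurable borel"
  and measurable_of_wo [measurable]: "of_wo \<in> borel_measurable borel"
  by (intro borel_measurable_continuous_onI linear_continuous_on bounded_linear_to_wo bounded_linear_of_wo)+

lemma bij_Abs_wo: "bij (Abs_wo :: 'n::finite \<Rightarrow> 'n wo)"
  by (metis Abs_wo_inverse Rep_wo_inverse UNIV_I bijI')

lemma prod_Basis_cart: "(\<Prod>b\<in>Basis. (x :: real ^ 'n) \<bullet> b) = (\<Prod>i\<in>UNIV. x $ i)"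
proof -
  have B: "(Basis :: (real ^ 'n) set) = range (\<lambda>i. axis i 1)"
    by (auto simp: Basis_vec_def)
  have "inj (\<lambda>i :: 'n. axis i (1 :: real))"
    by (auto simp: inj_def axis_eq_axis)
  then show ?thesis
    unfolding B by (subst prod.reindex) (auto simp: inner_axis)
qed

text \<open>Lebesgue measure is determined by its values on boxes, and renaming the coordinates
  permutes the factors of the product of the side lengths.\<close>

lemma distr_to_wo: "distr lborel borel (to_wo :: real ^ 'n::finite \<Rightarrow> _) = lborel"
proof (rule sym, rule lborel_eqI)
  fix l u :: "real ^ 'n wo"
  assume le: "\<And>b. b \<in> Basis \<Longrightarrow> l \<bullet> b \<le> u \<bullet> b"
  then have le': "l $ i \<le> u $ i" for i
    using le[of "axis i 1"] by (auto simp: Basis_vec_def inner_axis)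
  have "to_wo -` box l u = box (of_wo l) (of_wo u)"
    by (auto simp: mem_box_cart to_wo_def of_wo_def) (metis Abs_wo_cases Abs_wo_inverse UNIV_I Rep_wo_inverse)+
  then have "emeasure (distr lborel borel to_wo) (box l u) = emeasure lborel (box (of_wo l) (of_wo u))"
    by (subst emeasure_distr) auto
  also have "\<dots> = ennreal (\<Prod>b\<in>Basis. (of_wo u - of_wo l) \<bullet> b)"
    using le' by (intro emeasure_lborel_box) (auto simp: of_wo_def Basis_vec_def inner_axis)
  also have "(\<Prod>b\<in>Basis. (of_wo u - of_wo l) \<bullet> b) = (\<Prod>i\<in>UNIV. (u - l) $ Abs_wo i)"
    by (simp add: prod_Basis_cart of_wo_def)
  also have "\<dots> = (\<Prod>b\<in>Basis. (u - l) \<bullet> b)"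
    unfolding prod_Basis_cart using prod.reindex_bij_betw[OF bij_Abs_wo] .
  finally show "emeasure (distr lborel borel to_wo) (box l u) = ennreal (\<Prod>b\<in>Basis. (u - l) \<bullet> b)" .
qed simp

text \<open>Conjugation with the bijection of indices is a sign-preserving bijection between the
  permutations over which the Leibniz formula sums.\<close>

lemma det_reindex_wo:
  fixes H :: "real ^ 'n::finite ^ 'n"
  shows "det (\<chi> i j. H $ Rep_wo i $ Rep_wo j) = det H"
proof -
  let ?m = "map_permutation UNIV (Abs_wo :: 'n \<Rightarrow> _)"
  have bij: "bij_betw ?m {p. p permutes UNIV} {p. p permutes UNIV}"
  proof (rule bij_betw_byWitness[where f' = "map_permutation UNIV Rep_wo"])
    have bR: "bij (Rep_wo :: 'n wo \<Rightarrow> _)"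
      by (metis Abs_wo_inverse Rep_wo_inverse UNIV_I bijI')
    show "\<forall>p\<in>{p. p permutes UNIV}. map_permutation UNIV Rep_wo (?m p) = p"
      by (auto intro!: map_permutation_compose_inv[OF bij_Abs_wo] simp: Abs_wo_inverse)
    show "\<forall>p\<in>{p. p permutes UNIV}. ?m (map_permutation UNIV Rep_wo p) = p"
      by (auto intro!: map_permutation_compose_inv[OF bR] simp: Rep_wo_inverse)
    show "?m ` {p. p permutes UNIV} \<subseteq> {p. p permutes UNIV}"
      using map_permutation_permutes[OF bij_Abs_wo] by blast
    show "map_permutation UNIV (Rep_wo :: 'n wo \<Rightarrow> 'n) ` {p. p permutes UNIV} \<subseteq> {p. p permutes UNIV}"
      by (auto intro!: map_permutation_permutes[OF bR])
  qed
  have "det (\<chi> i j. H $ Rep_wo i $ Rep_wo j) =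
      (\<Sum>p | p permutes UNIV. of_int (sign (?m p)) * (\<Prod>i\<in>UNIV. H $ Rep_wo i $ Rep_wo (?m p i)))"
    unfolding det_def by (simp add: sum.reindex_bij_betw[OF bij, symmetric])
  also have "\<dots> = det H"
    unfolding det_def
  proof (intro sum.cong refl)
    fix p :: "'n \<Rightarrow> 'n" assume "p \<in> {p. p permutes UNIV}"
    then have p: "p permutes UNIV" by simp
    have "sign (?m p) = sign p"
      using bij_is_inj[OF bij_Abs_wo] p by (intro sign_map_permutation) auto
    moreover have "(\<Prod>i\<in>UNIV. H $ Rep_wo i $ Rep_wo (?m p i)) = (\<Prod>i\<in>UNIV. H $ i $ p i)"
      by (subst prod.reindex_bij_betw[OF bij_Abs_wo, symmetric])
        (simp add: Abs_wo_inverse map_permutation_apply bij_is_inj[OF bij_Abs_wo])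
    ultimately show "of_int (sign (?m p)) * (\<Prod>i\<in>UNIV. H $ Rep_wo i $ Rep_wo (?m p i)) =
        of_int (sign p) * (\<Prod>i\<in>UNIV. H $ i $ p i)" by simp
  qed
  finally show ?thesis .
qed

lemma nn_integral_to_wo:
  fixes f :: "real ^ ('n::finite) wo \<Rightarrow> ennreal"
  assumes "f \<in> borel_measurable borel"
  shows "(\<integral>\<^sup>+y. f y \<partial>lborel) = (\<integral>\<^sup>+x. f (to_wo x) \<partial>lborel)"
  by (subst distr_to_wo[symmetric], subst nn_integral_distr) (use assms in auto)

text \<open>In \<open>ennreal\<close> the formula compares infinite integrals as well, so it can
  be read as an identity between measures of Borel sets; this is how it is applied to the
  volume.\<close>

theorem nn_integral_change_of_variables:
  fixes f :: "real ^ 'n::finite \<Rightarrow> real" and g :: "real ^ 'n \<Rightarrow> real ^ 'n"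
  assumes S: "S \<in> sets borel" and der: "\<And>x. x \<in> S \<Longrightarrow> (g has_derivative g' x) (at x)"
    and inj: "inj_on g S" and nonneg: "\<And>y. y \<in> g ` S \<Longrightarrow> f y \<ge> 0"
    and m1: "(\<lambda>y. indicator (g ` S) y * f y) \<in> borel_measurable borel"
    and m2: "(\<lambda>x. indicator S x * (\<bar>det (matrix (g' x))\<bar> * f (g x))) \<in> borel_measurable borel"
  shows "(\<integral>\<^sup>+x\<in>S. ennreal (\<bar>det (matrix (g' x))\<bar> * f (g x)) \<partial>lborel) = (\<integral>\<^sup>+y\<in>g ` S. ennreal (f y) \<partial>lborel)"
proof -
  define S' where "S' = of_wo -` S"
  define G where "G = (\<lambda>y. to_wo (g (of_wo y)))"
  define G' where "G' = (\<lambda>y v. to_wo (g' (of_wo y) (of_wo v)))"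
  define F where "F = (\<lambda>y. f (of_wo y))"
  have S_iff: "to_wo x \<in> S' \<longleftrightarrow> x \<in> S" for x
    by (simp add: S'_def)
  have img: "G ` S' = of_wo -` (g ` S)"
  proof (intro set_eqI iffI)
    fix z assume "z \<in> of_wo -` (g ` S)"
    then obtain x where x: "x \<in> S" "of_wo z = g x" by auto
    then have "z = G (to_wo x)" by (metis G_def of_to_wo to_of_wo)
    then show "z \<in> G ` S'" using x(1) S_iff by blast
  qed (auto simp: S'_def G_def)
  have det_eq: "det (matrix (G' (to_wo x))) = det (matrix (g' x))" for x
  proof -
    have ax: "of_wo (axis j 1) = axis (Rep_wo j) 1" for j :: "'n wo"
      by (auto simp: of_wo_def vec_eq_iff axis_def Abs_wo_inverse Rep_wo_inverse)
    have "matrix (G' (to_wo x)) = (\<chi> i j. matrix (g' x) $ Rep_wo i $ Rep_wo j)"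
      by (simp add: matrix_def G'_def vec_eq_iff ax to_wo_def[of "g' _ _"])
    then show ?thesis by (simp add: det_reindex_wo)
  qed
  have m1': "(\<lambda>y. indicator (G ` S') y * F y) \<in> borel_measurable borel"
  proof -
    have "(\<lambda>y. indicator (G ` S') y * F y) = (\<lambda>y. indicator (g ` S) y * f y) \<circ> of_wo"
      by (auto simp: img F_def indicator_def)
    then show ?thesis using measurable_comp[OF measurable_of_wo m1] by simp
  qed
  have m2': "(\<lambda>y. indicator S' y * (\<bar>det (matrix (G' y))\<bar> * F (G y))) \<in> borel_measurable borel"
  proof -
    have "(\<lambda>y. indicator S' y * (\<bar>det (matrix (G' y))\<bar> * F (G y))) =
        (\<lambda>x. indicator S x * (\<bar>det (matrix (g' x))\<bar> * f (g x))) \<circ> of_wo"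
    proof
      fix y
      show "indicator S' y * (\<bar>det (matrix (G' y))\<bar> * F (G y)) =
        ((\<lambda>x. indicator S x * (\<bar>det (matrix (g' x))\<bar> * f (g x))) \<circ> of_wo) y"
        using det_eq[of "of_wo y"] by (auto simp: S'_def F_def G_def indicator_def)
    qed
    then show ?thesis using measurable_comp[OF measurable_of_wo m2] by simp
  qed
  have key: "(\<integral>\<^sup>+y\<in>S'. ennreal (\<bar>det (matrix (G' y))\<bar> * F (G y)) \<partial>lborel) =
      (\<integral>\<^sup>+y\<in>G ` S'. ennreal (F y) \<partial>lborel)"
  proof (rule nn_integral_change_of_variables_wellorder[OF _ _ _ _ m1' m2'])
    show "S' \<in> sets borel"
      using measurable_sets[OF measurable_of_wo S] by (simp add: S'_def)
    show "(G has_derivative G' y) (at y)" if "y \<in> S'" for y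
      unfolding G_def G'_def
      using that bounded_linear.has_derivative[OF bounded_linear_to_wo]
        has_derivative_compose[OF bounded_linear_imp_has_derivative[OF bounded_linear_of_wo] der[of "of_wo y"]]
      by (auto simp: S'_def)
    show "inj_on G S'"
      using inj unfolding inj_on_def G_def S'_def by (metis of_to_wo to_of_wo vimage_eq)
    show "F y \<ge> 0" if "y \<in> G ` S'" for y
      using that nonneg by (auto simp: img F_def)
  qed
  have "(\<integral>\<^sup>+x\<in>S. ennreal (\<bar>det (matrix (g' x))\<bar> * f (g x)) \<partial>lborel) =
      (\<integral>\<^sup>+x. ennreal (indicator S' (to_wo x) * (\<bar>det (matrix (G' (to_wo x)))\<bar> * F (G (to_wo x)))) \<partial>lborel)"
    by (intro nn_integral_cong) (auto simp: indicator_def S_iff det_eq F_def G_def)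
  also have "\<dots> = (\<integral>\<^sup>+y. ennreal (indicator S' y * (\<bar>det (matrix (G' y))\<bar> * F (G y))) \<partial>lborel)"
    using m2' by (subst nn_integral_to_wo) auto
  also have "\<dots> = (\<integral>\<^sup>+y\<in>S'. ennreal (\<bar>det (matrix (G' y))\<bar> * F (G y)) \<partial>lborel)"
    by (intro nn_integral_cong) (auto simp: indicator_def)
  also have "\<dots> = (\<integral>\<^sup>+y\<in>G ` S'. ennreal (F y) \<partial>lborel)" by (rule key)
  also have "\<dots> = (\<integral>\<^sup>+y. ennreal (indicator (G ` S') y * F y) \<partial>lborel)"
    by (intro nn_integral_cong) (auto simp: indicator_def)
  also have "\<dots> = (\<integral>\<^sup>+x. ennreal (indicator (G ` S') (to_wo x) * F (to_wo x)) \<partial>lborel)"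
    using m1' by (subst nn_integral_to_wo) auto
  also have "\<dots> = (\<integral>\<^sup>+y\<in>g ` S. ennreal (f y) \<partial>lborel)"
    by (intro nn_integral_cong) (auto simp: indicator_def img F_def)
  finally show ?thesis .
qed

section \<open>Charts\<close>

abbreviation cimg :: "('m, 'n) chart \<Rightarrow> (real ^ 'n) set" where
  "cimg c \<equiv> cmap c ` cdom c"

definition density_in :: "('m, 'n::finite) metric_components \<Rightarrow> ('m, 'n) chart \<Rightarrow> real ^ 'n \<Rightarrow> real" where
  "density_in g c x = sqrt (det (g c (cinv c x)))"

definition chart_volume :: "('m, 'n::finite) metric_components \<Rightarrow> ('m, 'n) chart \<Rightarrow> 'm set \<Rightarrow> ennreal" where
  "chart_volume g c B = (\<integral>\<^sup>+x\<in>cmap c ` B. ennreal (density_in g c x) \<partial>lborel)"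

lemma borel_vimage_Int:
  assumes "continuous_on S f" "S \<in> sets borel" "B \<in> sets borel"
  shows "f -` B \<inter> S \<in> sets borel"
proof -
  have "f \<in> borel_measurable (restrict_space borel S)"
    by (rule borel_measurable_continuous_on_restrict[OF assms(1)])
  from measurable_sets[OF this assms(3)] show ?thesis
    using assms(2) by (simp add: space_restrict_space sets_restrict_space_iff)
qed

lemma borel_measurable_indicator_times:
  fixes f :: "'a::topological_space \<Rightarrow> real"
  assumes "continuous_on U f" "open U" "S \<in> sets borel" "S \<subseteq> U"
  shows "(\<lambda>x. indicator S x * f x) \<in> borel_measurable borel"
proof -
  have "(\<lambda>x. indicator U x *\<^sub>R f x) \<in> borel_measurable borel"
    using assms(1,2) by (intro borel_measurable_continuous_on_indicator) auto
  then have "(\<lambda>x. indicator S x * (indicator U x *\<^sub>R f x)) \<in> borel_measurable borel"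
    using assms(3) by (intro borel_measurable_times) auto
  moreover have "(\<lambda>x. indicator S x * (indicator U x *\<^sub>R f x)) = (\<lambda>x. indicator S x * f x)"
    using assms(4) by (auto simp: indicator_def fun_eq_iff)
  ultimately show ?thesis by simp
qed

text \<open>Transition maps are the coordinate expressions of the identity, which preserves the
  metric (\<open>preserves_id\<close>). Facts on metric-preserving maps therefore turn into
  independence of the chart when they are specialised to it.\<close>

locale riem =
  fixes A :: "('m::{t2_space, second_countable_topology}, 'n::finite) chart set"
    and g :: "('m, 'n) metric_components"
  assumes manifold: "riemannian_manifold A g"
begin

lemma atlas: "smooth_atlas A" and metric: "riemannian_metric A g"
  using manifold by (auto simp: riemannian_manifold_def)

lemma chart: "c \<in> A \<Longrightarrow> is_chart c"
  using atlas by (auto simp: smooth_atlas_def)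

lemma chart_exists: "\<exists>c\<in>A. p \<in> cdom c"
  using atlas by (auto simp: smooth_atlas_def)

lemma chart_at: "chart_at A p \<in> A" "p \<in> cdom (chart_at A p)"
proof -
  have "chart_at A p \<in> A \<and> p \<in> cdom (chart_at A p)"
    unfolding chart_at_def by (rule someI_ex) (use chart_exists[of p] in blast)
  then show "chart_at A p \<in> A" "p \<in> cdom (chart_at A p)" by auto
qed

lemma smooth_id: "smooth_map A id"
  using atlas by (simp add: smooth_atlas_def)

lemma preserves_id: "preserves_metric A g id"
  using metric by (simp add: riemannian_metric_def)

context
  fixes c assumes c: "c \<in> A"
begin

lemma open_cdom: "open (cdom c)" and open_cimg: "open (cimg c)"
  using chart[OF c] by (auto simp: is_chart_def)

lemma homeo: "homeomorphism (cdom c) (cimg c) (cmap c) (cinv c)"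
  using chart[OF c] by (auto simp: is_chart_def)

lemma cinv_cmap: "p \<in> cdom c \<Longrightarrow> cinv c (cmap c p) = p"
  using homeo by (rule homeomorphism_apply1)

lemma cmap_cinv: "x \<in> cimg c \<Longrightarrow> cmap c (cinv c x) = x"
  using homeo by (rule homeomorphism_apply2)

lemma cinv_in: "x \<in> cimg c \<Longrightarrow> cinv c x \<in> cdom c"
  by (rule inv_into_into)

lemma inj_cmap: "inj_on (cmap c) (cdom c)"
  using cinv_cmap by (metis inj_onI)

lemma continuous_cmap: "continuous_on (cdom c) (cmap c)"
  and continuous_cinv: "continuous_on (cimg c) (cinv c)"
  using homeo by (auto simp: homeomorphism_def)

lemma cmap_image: "U \<subseteq> cdom c \<Longrightarrow> cmap c ` U = cinv c -` U \<inter> cimg c"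
  by (auto simp: cinv_cmap image_iff)

lemma cinv_image: "X \<subseteq> cimg c \<Longrightarrow> cinv c ` X = cmap c -` X \<inter> cdom c"
  by (auto simp: cmap_cinv cinv_cmap cinv_in subset_iff image_iff) (metis cinv_cmap)

lemma open_cmap_image: "open U \<Longrightarrow> U \<subseteq> cdom c \<Longrightarrow> open (cmap c ` U)"
  using continuous_open_preimage[OF continuous_cinv open_cimg, of U]
  by (subst cmap_image) (simp_all add: Int_commute)

lemma open_cinv_image: "open X \<Longrightarrow> X \<subseteq> cimg c \<Longrightarrow> open (cinv c ` X)"
  using continuous_open_preimage[OF continuous_cmap open_cdom, of X]
  by (simp add: cinv_image Int_commute)

lemma borel_cmap_image: "B \<in> sets borel \<Longrightarrow> B \<subseteq> cdom c \<Longrightarrow> cmap c ` B \<in> sets borel"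
  using borel_vimage_Int[OF continuous_cinv borel_open[OF open_cimg], of B] by (subst cmap_image) simp_all

lemma borel_cinv_image: "X \<in> sets borel \<Longrightarrow> X \<subseteq> cimg c \<Longrightarrow> cinv c ` X \<in> sets borel"
  using borel_vimage_Int[OF continuous_cmap borel_open[OF open_cdom], of X] by (simp add: cinv_image)

lemma pos_def_metric: "p \<in> cdom c \<Longrightarrow> pos_def (g c p)"
  using metric c by (auto simp: riemannian_metric_def pos_def_def)

lemma continuous_metric: "continuous_on (cimg c) (\<lambda>x. g c (cinv c x))"
  using metric c by (auto simp: riemannian_metric_def o_def intro: smooth_on_continuous)

lemma continuous_density: "continuous_on (cimg c) (density_in g c)"
  unfolding density_in_def by (intro continuous_on_real_sqrt continuous_on_det continuous_metric)

lemma density_pos: "x \<in> cimg c \<Longrightarrow> density_in g c x > 0"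
  using pos_def_det_pos[OF pos_def_metric[OF cinv_in]] by (simp add: density_in_def)

end

subsection \<open>Metric-preserving maps read in charts\<close>

text \<open>The determinant of the transformation law of the metric: the square root of the
  determinant of \<open>g\<close> is a density.\<close>

lemma jacobian_det:
  assumes "preserves_metric A g f" "c \<in> A" "c' \<in> A" "p \<in> cdom c" "f p \<in> cdom c'"
  shows "sqrt (det (g c p)) = \<bar>det (jacobian_at c c' f p)\<bar> * sqrt (det (g c' (f p)))"
proof -
  have "g c p = transpose (jacobian_at c c' f p) ** g c' (f p) ** jacobian_at c c' f p"
    using assms by (auto simp: preserves_metric_def)
  then have "det (g c p) = (det (jacobian_at c c' f p))\<^sup>2 * det (g c' (f p))"
    by (simp add: det_mul power2_eq_square)
  then show ?thesis by (simp add: real_sqrt_mult)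
qed

context
  fixes f :: "'m \<Rightarrow> 'm"
  assumes f: "smooth_map A f"
begin

lemma continuous_smooth_map: "continuous_on UNIV f"
  using f by (simp add: smooth_map_def)

lemma open_transition_dom:
  assumes "c \<in> A" "c' \<in> A"
  shows "open (cmap c ` (cdom c \<inter> f -` cdom c'))"
  using assms open_vimage[OF open_cdom[OF assms(2)] continuous_smooth_map]
  by (intro open_cmap_image) (auto intro: open_cdom)

lemma smooth_transition:
  assumes "c \<in> A" "c' \<in> A"
  shows "smooth_on (cmap c ` (cdom c \<inter> f -` cdom c')) (cmap c' \<circ> f \<circ> cinv c)"
  using f assms by (auto simp: smooth_map_def)

lemma transition_has_derivative:
  assumes "c \<in> A" "c' \<in> A" "p \<in> cdom c" "f p \<in> cdom c'"
  shows "((cmap c' \<circ> f \<circ> cinv c) has_derivative (\<lambda>v. jacobian_at c c' f p *v v)) (at (cmap c p))"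
proof -
  have d: "(cmap c' \<circ> f \<circ> cinv c) differentiable (at (cmap c p))"
    using smooth_transition[OF assms(1,2)] assms by (auto intro: smooth_on_differentiable)
  have "(\<lambda>v. jacobian_at c c' f p *v v) = frechet_derivative (cmap c' \<circ> f \<circ> cinv c) (at (cmap c p))"
    unfolding jacobian_at_def using matrix_vector_mul(2)[OF linear_frechet_derivative[OF d]] by simp
  then show ?thesis using d by (simp only: frechet_derivative_works)
qed

text \<open>The volume density transforms with the absolute value of the Jacobian determinant,
  so the change of variables formula applies to the map read in the two charts.\<close>

lemma chart_volume_transform:
  assumes "inj f" "preserves_metric A g f" "c \<in> A" "c' \<in> A"
    "B \<in> sets borel" "B \<subseteq> cdom c \<inter> f -` cdom c'" "f ` B \<in> sets borel"
  shows "chart_volume g c B = chart_volume g c' (f ` B)"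
proof -
  let ?T = "cmap c' \<circ> f \<circ> cinv c" and ?S = "cmap c ` B"
  define T' where "T' x = (\<lambda>v. jacobian_at c c' f (cinv c x) *v v)" for x
  have T: "?T (cmap c p) = cmap c' (f p)" if "p \<in> B" for p
    using that assms(3,6) by (auto simp: cinv_cmap)
  then have TS: "?T ` ?S = cmap c' ` f ` B"
    by (simp add: image_image)
  have fB: "f ` B \<subseteq> cdom c'" and B: "B \<subseteq> cdom c" using assms(6) by auto
  have S: "?S \<in> sets borel" "?S \<subseteq> cimg c"
    using assms B by (auto intro: borel_cmap_image)
  have TSb: "cmap c' ` f ` B \<in> sets borel" "cmap c' ` f ` B \<subseteq> cimg c'"
    using assms fB by (auto intro: borel_cmap_image)
  have dens: "density_in g c x = \<bar>det (matrix (T' x))\<bar> * density_in g c' (?T x)" if "x \<in> ?S" for x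
  proof -
    obtain p where p: "p \<in> B" "x = cmap c p" using \<open>x \<in> ?S\<close> by auto
    then have "cinv c x = p" "cinv c' (?T x) = f p"
      using B fB assms(3,4) by (auto simp: cinv_cmap subset_iff)
    then show ?thesis
      unfolding density_in_def T'_def
      using jacobian_det[OF assms(2-4), of p] p assms(6) by (auto simp del: o_apply)
  qed
  have "chart_volume g c B = (\<integral>\<^sup>+x\<in>?S. ennreal (\<bar>det (matrix (T' x))\<bar> * density_in g c' (?T x)) \<partial>lborel)"
    unfolding chart_volume_def
    using dens by (intro nn_integral_cong) (simp add: indicator_def del: o_apply)
  also have "\<dots> = (\<integral>\<^sup>+y\<in>?T ` ?S. ennreal (density_in g c' y) \<partial>lborel)"
  proof (rule nn_integral_change_of_variables[OF S(1)])
    show "(?T has_derivative T' x) (at x)" if "x \<in> ?S" for x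
    proof -
      obtain p where p: "p \<in> B" "x = cmap c p" using \<open>x \<in> ?S\<close> by auto
      then show ?thesis
        using transition_has_derivative[OF assms(3,4), of p] assms(6) cinv_cmap[OF assms(3), of p]
        by (auto simp: T'_def subset_iff)
    qed
    show "inj_on ?T ?S"
    proof (rule inj_onI)
      fix x y assume xy: "x \<in> ?S" "y \<in> ?S" "?T x = ?T y"
      then obtain p q where pq: "p \<in> B" "x = cmap c p" "q \<in> B" "y = cmap c q" by auto
      then have "cmap c' (f p) = cmap c' (f q)" using xy(3) by (simp only: pq T)
      then have "f p = f q" using inj_onD[OF inj_cmap[OF assms(4)]] pq fB by blast
      then show "x = y" using assms(1) pq by (auto dest: injD)
    qed
    show "density_in g c' y \<ge> 0" if "y \<in> ?T ` ?S" for y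
      using that density_pos[OF assms(4)] TSb(2) unfolding TS by (meson less_imp_le subsetD)
    show "(\<lambda>y. indicator (?T ` ?S) y * density_in g c' y) \<in> borel_measurable borel"
      unfolding TS using assms(4) TSb
      by (intro borel_measurable_indicator_times[OF continuous_density open_cimg]) auto
    have "(\<lambda>x. indicator ?S x * density_in g c x) \<in> borel_measurable borel"
      using assms(3) S by (intro borel_measurable_indicator_times[OF continuous_density open_cimg]) auto
    also have "(\<lambda>x. indicator ?S x * density_in g c x) =
        (\<lambda>x. indicator ?S x * (\<bar>det (matrix (T' x))\<bar> * density_in g c' (?T x)))"
      using dens by (auto simp: indicator_def fun_eq_iff simp del: o_apply)
    finally show "\<dots> \<in> borel_measurable borel" .
  qed
  also have "\<dots> = chart_volume g c' (f ` B)"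
    unfolding chart_volume_def TS ..
  finally show ?thesis .
qed

end

section \<open>The Riemannian volume\<close>

text \<open>The volume of the chart, extended by zero to a measure on the whole coordinate
  space. Countable additivity of \<open>chart_volume\<close> is inherited from it.\<close>

definition chart_measure :: "('m, 'n) chart \<Rightarrow> (real ^ 'n) measure" where
  "chart_measure c = density lborel (\<lambda>x. indicator (cimg c) x * density_in g c x)"

lemma chart_volume_eq_emeasure:
  assumes "c \<in> A" "B \<in> sets borel" "B \<subseteq> cdom c"
  shows "chart_volume g c B = emeasure (chart_measure c) (cmap c ` B)"
proof -
  have m: "(\<lambda>x. indicator (cimg c) x * density_in g c x) \<in> borel_measurable lborel"
    using borel_measurable_indicator_times[OF continuous_density open_cimg borel_open[OF open_cimg]] assms(1)
    by simp
  then have "emeasure (chart_measure c) (cmap c ` B) =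
      (\<integral>\<^sup>+x. ennreal (indicator (cimg c) x * density_in g c x) * indicator (cmap c ` B) x \<partial>lborel)"
    unfolding chart_measure_def using borel_cmap_image[OF assms] by (subst emeasure_density) auto
  also have "\<dots> = chart_volume g c B"
    unfolding chart_volume_def using assms(3) by (intro nn_integral_cong) (auto simp: indicator_def)
  finally show ?thesis ..
qed

lemma chart_volume_suminf:
  assumes "c \<in> A" "\<And>i. B i \<in> sets borel" "\<And>i. B i \<subseteq> cdom c" "disjoint_family B"
  shows "(\<Sum>i. chart_volume g c (B i)) = chart_volume g c (\<Union>i. B i)"
proof -
  have "(\<Sum>i. chart_volume g c (B i)) = (\<Sum>i. emeasure (chart_measure c) (cmap c ` B i))"
    using assms by (simp add: chart_volume_eq_emeasure)
  also have "\<dots> = emeasure (chart_measure c) (\<Union>i. cmap c ` B i)"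
  proof (rule suminf_emeasure)
    show "range (\<lambda>i. cmap c ` B i) \<subseteq> sets (chart_measure c)"
      using borel_cmap_image[OF assms(1-3)] by (auto simp: chart_measure_def)
    show "disjoint_family (\<lambda>i. cmap c ` B i)"
      using assms(3,4) inj_on_image_Int[OF inj_cmap[OF assms(1)]]
      unfolding disjoint_family_on_def by (metis image_empty)
  qed
  also have "(\<Union>i. cmap c ` B i) = cmap c ` (\<Union>i. B i)" by auto
  also have "emeasure (chart_measure c) \<dots> = chart_volume g c (\<Union>i. B i)"
    using assms by (subst chart_volume_eq_emeasure) auto
  finally show ?thesis .
qed

lemma chart_volume_empty [simp]: "chart_volume g c {} = 0"
  by (simp add: chart_volume_def)

lemma chart_volume_sum:
  assumes "c \<in> A" "\<And>i. i < N \<Longrightarrow> B i \<in> sets borel" "\<And>i. i < N \<Longrightarrow> B i \<subseteq> cdom c"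
    "disjoint_family_on B {..<N::nat}"
  shows "(\<Sum>i<N. chart_volume g c (B i)) = chart_volume g c (\<Union>i<N. B i)"
proof -
  let ?B = "\<lambda>i. if i < N then B i else {}"
  have "(\<Sum>i. chart_volume g c (?B i)) = chart_volume g c (\<Union>i. ?B i)"
    using assms by (intro chart_volume_suminf) (auto simp: disjoint_family_on_def)
  moreover have "(\<Sum>i. chart_volume g c (?B i)) = (\<Sum>i<N. chart_volume g c (?B i))"
    by (rule suminf_finite) auto
  moreover have "(\<Union>i. ?B i) = (\<Union>i<N. B i)" by (auto split: if_splits)
  ultimately show ?thesis by simp
qed

end

locale compact_riem = riem +
  assumes compact_space: "compact (UNIV :: 'a set)"
begin

text \<open>Finitely many chart domains cover \<open>M\<close>; subtracting from each domain the
  earlier ones makes them disjoint. A Borel measure is determined by its restrictions to the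
  resulting pieces, and conversely the chart volumes on the pieces can be summed up to a
  measure.\<close>

lemma ex_chart_partition:
  "\<exists>(e :: nat \<Rightarrow> ('a, 'b) chart) D N. (\<forall>i<N. e i \<in> A \<and> D i \<in> sets borel \<and> D i \<subseteq> cdom (e i)) \<and>
     disjoint_family_on D {..<N} \<and> (\<Union>i<N. D i) = UNIV"
proof -
  have "UNIV \<subseteq> (\<Union>c\<in>A. cdom c)" using chart_exists by blast
  then obtain F where F: "F \<subseteq> A" "finite F" "UNIV \<subseteq> (\<Union>c\<in>F. cdom c)"
    by (rule compactE_image[OF compact_space, of A cdom, rotated]) (auto intro: open_cdom)
  obtain e :: "nat \<Rightarrow> ('a, 'b) chart" and N where e: "F = e ` {..<N}"
    using F(2) by (metis finite_imp_nat_seg_image_inj_on lessThan_def)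
  define D where "D i = cdom (e i) - (\<Union>j<i. cdom (e j))" for i
  have eA: "e i \<in> A" if "i < N" for i using e F(1) that by auto
  have "(\<Union>i<N. D i) = UNIV"
  proof -
    have "p \<in> (\<Union>i<N. D i)" for p
    proof -
      have "\<exists>i. i < N \<and> p \<in> cdom (e i)" using F(3) e by blast
      then obtain i where i: "i < N \<and> p \<in> cdom (e i)" "\<And>j. j < i \<Longrightarrow> \<not> (j < N \<and> p \<in> cdom (e j))"
        using exists_least_iff[of "\<lambda>i. i < N \<and> p \<in> cdom (e i)"] by blast
      then have "p \<in> D i" by (auto simp: D_def)
      then show ?thesis using i(1) by blast
    qed
    then show ?thesis by blast
  qed
  moreover have "disjoint_family_on D {..<N}"
    unfolding disjoint_family_on_def
  proof (intro ballI impI)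
    fix i j :: nat assume "i \<noteq> j"
    then show "D i \<inter> D j = {}"
      by (cases "i < j") (auto simp: D_def)
  qed
  moreover have "D i \<in> sets borel" if "i < N" for i
    unfolding D_def using that eA open_cdom by (intro sets.Diff borel_open open_UN) auto
  moreover have "D i \<subseteq> cdom (e i)" for i by (auto simp: D_def)
  ultimately show ?thesis using eA by blast
qed

text \<open>One partition is fixed once and for all, so that the glued volume is a single set
  function.\<close>

definition partition_data where
  "partition_data = (SOME (e :: nat \<Rightarrow> ('a, 'b) chart, D, N).
     (\<forall>i<N. e i \<in> A \<and> D i \<in> sets borel \<and> D i \<subseteq> cdom (e i)) \<and>
     disjoint_family_on D {..<N} \<and> (\<Union>i<N. D i) = (UNIV :: 'a set))"

definition pchart :: "nat \<Rightarrow> ('a, 'b) chart" where "pchart = fst partition_data"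
definition piece :: "nat \<Rightarrow> 'a set" where "piece = fst (snd partition_data)"
definition pieces :: nat where "pieces = snd (snd partition_data)"

lemma partition:
  shows "i < pieces \<Longrightarrow> pchart i \<in> A" "i < pieces \<Longrightarrow> piece i \<in> sets borel"
    "i < pieces \<Longrightarrow> piece i \<subseteq> cdom (pchart i)" "disjoint_family_on piece {..<pieces}"
    "(\<Union>i<pieces. piece i) = UNIV"
proof -
  have "case partition_data of (e, D, N) \<Rightarrow>
     (\<forall>i<N. e i \<in> A \<and> D i \<in> sets borel \<and> D i \<subseteq> cdom (e i)) \<and>
     disjoint_family_on D {..<N} \<and> (\<Union>i<N. D i) = (UNIV :: 'a set)"
    unfolding partition_data_def by (rule someI_ex) (use ex_chart_partition in auto)
  then show "i < pieces \<Longrightarrow> pchart i \<in> A" "i < pieces \<Longrightarrow> piece i \<in> sets borel"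
    "i < pieces \<Longrightarrow> piece i \<subseteq> cdom (pchart i)" "disjoint_family_on piece {..<pieces}"
    "(\<Union>i<pieces. piece i) = UNIV"
    by (auto simp: pchart_def piece_def pieces_def split: prod.splits)
qed

definition glued_volume :: "'a set \<Rightarrow> ennreal" where
  "glued_volume B = (\<Sum>i<pieces. chart_volume g (pchart i) (B \<inter> piece i))"

text \<open>The set \<open>B\<close> is cut along the images of the pieces under
  \<open>f\<close>, and each part is transported by \<open>f\<close> from the chart of its piece
  to \<open>c\<close>. With \<open>f = id\<close> this says that the glued volume has the right
  density in every chart; with an isometry \<open>f\<close> it says that the volume is
  invariant.\<close>

lemma glued_volume_vimage:
  assumes f: "smooth_map A f" "bij f" "continuous_on UNIV (inv f)" "preserves_metric A g f"
    and "c \<in> A" "B \<in> sets borel" "B \<subseteq> cdom c"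
  shows "glued_volume (f -` B) = chart_volume g c B"
proof -
  have fb: "f \<in> borel_measurable borel" "inv f \<in> borel_measurable borel"
    using continuous_smooth_map[OF f(1)] f(3) by (auto intro: borel_measurable_continuous_onI)
  have img: "f ` (f -` B \<inter> piece i) = B \<inter> inv f -` piece i" for i
  proof (intro set_eqI iffI)
    fix y assume "y \<in> B \<inter> inv f -` piece i"
    then show "y \<in> f ` (f -` B \<inter> piece i)"
      using surj_f_inv_f[OF bij_is_surj[OF f(2)], of y] by (intro image_eqI[of _ _ "inv f y"]) auto
  qed (auto simp: inv_f_f[OF bij_is_inj[OF f(2)]])
  have b1: "f -` B \<inter> piece i \<in> sets borel" "B \<inter> inv f -` piece i \<in> sets borel" if "i < pieces" for i
    using measurable_sets[OF fb(1) assms(6)] measurable_sets[OF fb(2) partition(2)[OF that]]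
      partition(2)[OF that] assms(6) by (auto intro!: sets.Int)
  have "glued_volume (f -` B) = (\<Sum>i<pieces. chart_volume g c (B \<inter> inv f -` piece i))"
    unfolding glued_volume_def
  proof (rule sum.cong)
    fix i assume "i \<in> {..<pieces}"
    then have i: "i < pieces" by simp
    show "chart_volume g (pchart i) (f -` B \<inter> piece i) = chart_volume g c (B \<inter> inv f -` piece i)"
      unfolding img[symmetric] using partition(1,3)[OF i] assms(7) b1[OF i] img[of i]
      by (intro chart_volume_transform[OF f(1) bij_is_inj[OF f(2)] f(4) _ \<open>c \<in> A\<close>]) auto
  qed simp
  also have "\<dots> = chart_volume g c (\<Union>i<pieces. B \<inter> inv f -` piece i)"
    using partition(4) assms(5,7) b1(2)
    by (intro chart_volume_sum) (auto simp: disjoint_family_on_def)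
  also have "(\<Union>i<pieces. B \<inter> inv f -` piece i) = B"
    using partition(5) by blast
  finally show ?thesis .
qed

text \<open>The property by which the Riemannian volume is characterised.\<close>

definition is_volume :: "'a measure \<Rightarrow> bool" where
  "is_volume \<mu> \<longleftrightarrow> sets \<mu> = sets borel \<and>
     (\<forall>c\<in>A. \<forall>B\<in>sets borel. B \<subseteq> cdom c \<longrightarrow> emeasure \<mu> B = chart_volume g c B)"

text \<open>Additivity over the pieces. This is the uniqueness of the volume, and it identifies
  any volume with the glued one.\<close>

lemma is_volume_glued:
  assumes "is_volume \<mu>" "B \<in> sets borel"
  shows "emeasure \<mu> B = glued_volume B"
proof -
  have b: "B \<inter> piece i \<in> sets borel" if "i < pieces" for i
    using partition(2)[OF that] assms(2) by auto
  have "emeasure \<mu> B = emeasure \<mu> (\<Union>i<pieces. B \<inter> piece i)"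
    using partition(5) by (intro arg_cong[where f = "emeasure \<mu>"]) blast
  also have "\<dots> = (\<Sum>i<pieces. emeasure \<mu> (B \<inter> piece i))"
    using partition(4) b assms(1)
    by (intro sum_emeasure[symmetric]) (auto simp: disjoint_family_on_def is_volume_def)
  also have "\<dots> = glued_volume B"
    unfolding glued_volume_def
  proof (rule sum.cong)
    fix i assume "i \<in> {..<pieces}"
    then show "emeasure \<mu> (B \<inter> piece i) = chart_volume g (pchart i) (B \<inter> piece i)"
      using partition(1,3)[of i] b[of i] assms(1) unfolding is_volume_def by blast
  qed simp
  finally show ?thesis .
qed

lemma is_volume_unique:
  assumes "is_volume \<mu>" "is_volume \<nu>"
  shows "\<mu> = \<nu>"
  using assms is_volume_glued by (intro measure_eqI) (auto simp: is_volume_def)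

lemma is_volume_exists: "\<exists>\<mu>. is_volume \<mu>"
proof -
  define \<mu> :: "'a measure" where "\<mu> = measure_of UNIV (sets borel) glued_volume"
  have sets_\<mu>: "sets \<mu> = sets borel"
    unfolding \<mu>_def using sets.sigma_sets_eq[of "borel :: 'a measure"] by (simp add: sets_measure_of)
  have em: "emeasure \<mu> B = glued_volume B" if "B \<in> sets borel" for B
  proof (rule emeasure_measure_of_sigma[of UNIV "sets borel" glued_volume, folded \<mu>_def])
    show "sigma_algebra UNIV (sets (borel :: 'a measure))"
      using sets.sigma_algebra_axioms[of "borel :: 'a measure"] by simp
    show "positive (sets borel) glued_volume"
      by (simp add: positive_def glued_volume_def)
    show "countably_additive (sets borel) glued_volume"
    proof (rule countably_additiveI)
      fix B :: "nat \<Rightarrow> 'a set"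
      assume B: "range B \<subseteq> sets borel" "disjoint_family B"
      have "(\<Sum>j. glued_volume (B j)) = (\<Sum>i<pieces. \<Sum>j. chart_volume g (pchart i) (B j \<inter> piece i))"
        unfolding glued_volume_def by (rule suminf_sum) simp
      also have "\<dots> = (\<Sum>i<pieces. chart_volume g (pchart i) (\<Union>j. B j \<inter> piece i))"
      proof (intro sum.cong refl chart_volume_suminf)
        fix i assume "i \<in> {..<pieces}"
        then have i: "i < pieces" by simp
        show "pchart i \<in> A" by (rule partition(1)[OF i])
        show "B j \<inter> piece i \<in> sets borel" "B j \<inter> piece i \<subseteq> cdom (pchart i)" for j
          using B(1) partition(2,3)[OF i] by auto
        show "disjoint_family (\<lambda>j. B j \<inter> piece i)"
          using B(2) by (auto simp: disjoint_family_on_def)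
      qed
      also have "\<dots> = glued_volume (\<Union>j. B j)"
        unfolding glued_volume_def by (intro sum.cong refl arg_cong[where f = "chart_volume g _"]) auto
      finally show "(\<Sum>j. glued_volume (B j)) = glued_volume (\<Union>j. B j)" .
    qed
  qed (use that in auto)
  have "is_volume \<mu>"
    unfolding is_volume_def
  proof (intro conjI ballI impI sets_\<mu>)
    fix c B assume *: "c \<in> A" "B \<in> sets borel" "B \<subseteq> cdom c"
    show "emeasure \<mu> B = chart_volume g c B"
      using glued_volume_vimage[OF smooth_id bij_id _ preserves_id *] em[OF *(2)]
      by (simp add: continuous_on_id)
  qed
  then show ?thesis ..
qed

abbreviation vol :: "'a measure" where "vol \<equiv> riemannian_volume A g"

lemma is_volume_vol: "is_volume vol"
proof -
  have "vol = (THE \<mu>. is_volume \<mu>)"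
    unfolding riemannian_volume_def is_volume_def chart_volume_def density_in_def ..
  moreover obtain \<mu> where \<mu>: "is_volume \<mu>" using is_volume_exists by blast
  have "is_volume (THE \<mu>. is_volume \<mu>)"
    by (rule theI[of is_volume, OF \<mu>]) (rule is_volume_unique[OF _ \<mu>])
  ultimately show ?thesis by simp
qed

lemma sets_vol [measurable_cong, simp]: "sets vol = sets borel"
  using is_volume_vol by (simp add: is_volume_def)

lemma space_vol [simp]: "space vol = UNIV"
  using sets_eq_imp_space_eq[OF sets_vol] by simp

lemma emeasure_vol_chart:
  "c \<in> A \<Longrightarrow> B \<in> sets borel \<Longrightarrow> B \<subseteq> cdom c \<Longrightarrow> emeasure vol B = chart_volume g c B"
  using is_volume_vol by (simp add: is_volume_def)

text \<open>The image of the volume under an isometry has the right density in every chart, so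
  it is the volume by uniqueness.\<close>

lemma distr_isometry:
  assumes "isometry_of A g f"
  shows "distr vol borel f = vol"
proof (rule is_volume_unique[OF _ is_volume_vol])
  have f: "smooth_map A f" "bij f" "continuous_on UNIV (inv f)" "preserves_metric A g f"
    using assms by (auto simp: isometry_of_def smooth_map_def)
  have fb: "f \<in> borel_measurable borel"
    using continuous_smooth_map[OF f(1)] by (rule borel_measurable_continuous_onI)
  then have fb': "f \<in> measurable vol borel" by (simp cong: measurable_cong_sets)
  show "is_volume (distr vol borel f)"
    unfolding is_volume_def
  proof (intro conjI ballI impI)
    fix c B assume *: "c \<in> A" "B \<in> sets borel" "B \<subseteq> cdom c"
    have "emeasure (distr vol borel f) B = emeasure vol (f -` B)"
      using fb' *(2) by (simp add: emeasure_distr)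
    also have "\<dots> = glued_volume (f -` B)"
      using measurable_sets[OF fb *(2)] by (intro is_volume_glued[OF is_volume_vol]) simp
    also have "\<dots> = chart_volume g c B" by (rule glued_volume_vimage[OF f *])
    finally show "emeasure (distr vol borel f) B = chart_volume g c B" .
  qed simp
qed

lemma compact_ball_in_chart:
  "\<exists>c\<in>A. \<exists>r>0. p \<in> cdom c \<and> cball (cmap c p) r \<subseteq> cimg c"
proof -
  obtain c where c: "c \<in> A" "p \<in> cdom c" using chart_exists by blast
  then show ?thesis using open_cimg[OF c(1)] by (meson imageI open_contains_cball)
qed

text \<open>The density is bounded on compact balls in charts, so every point has a
  neighbourhood of finite volume, and finitely many of these cover \<open>M\<close>.\<close>

lemma emeasure_vol_finite: "emeasure vol UNIV < \<infinity>"
proof -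
  have "\<exists>U. open U \<and> p \<in> U \<and> emeasure vol U < \<infinity>" for p
  proof -
    obtain c r where c: "c \<in> A" "r > 0" "p \<in> cdom c" "cball (cmap c p) r \<subseteq> cimg c"
      using compact_ball_in_chart by blast
    let ?X = "ball (cmap c p) r"
    have X: "?X \<subseteq> cimg c" using c(4) ball_subset_cball by blast
    have U: "open (cinv c ` ?X)" "cinv c ` ?X \<subseteq> cdom c"
      using X c(1) by (auto intro: open_cinv_image cinv_in)
    have img: "cmap c ` cinv c ` ?X = ?X"
      using X cmap_cinv[OF c(1)] by (force simp: image_iff)
    obtain K where "\<forall>x\<in>cball (cmap c p) r. \<bar>density_in g c x\<bar> \<le> K"
      using compact_imp_bounded[OF compact_continuous_image[OF
          continuous_on_subset[OF continuous_density[OF c(1)] c(4)] compact_cball]]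
      by (auto simp: bounded_iff)
    then have K: "density_in g c x \<le> K" if "x \<in> ball (cmap c p) r" for x
      using that by (force simp: abs_le_iff)
    have "emeasure vol (cinv c ` ?X) = (\<integral>\<^sup>+x\<in>?X. ennreal (density_in g c x) \<partial>lborel)"
      using emeasure_vol_chart[OF c(1) borel_open[OF U(1)] U(2)] by (simp add: chart_volume_def img)
    also have "\<dots> \<le> (\<integral>\<^sup>+x. ennreal K * indicator ?X x \<partial>lborel)"
      using K by (intro nn_integral_mono) (auto simp: indicator_def intro!: ennreal_leI)
    also have "\<dots> = ennreal K * emeasure lborel ?X" by (simp add: nn_integral_cmult_indicator)
    also have "\<dots> < \<infinity>" using emeasure_bounded_finite[OF bounded_ball, of "cmap c p" r]
      by (simp add: ennreal_mult_less_top)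
    finally have "emeasure vol (cinv c ` ?X) < \<infinity>" .
    moreover have "p \<in> cinv c ` ?X"
      using c(1-3) cinv_cmap[OF c(1,3)] by (metis centre_in_ball imageI)
    ultimately show ?thesis using U(1) by blast
  qed
  then obtain U where U: "\<And>p. open (U p) \<and> p \<in> U p \<and> emeasure vol (U p) < \<infinity>" by metis
  have "UNIV \<subseteq> (\<Union>p\<in>UNIV. U p)" using U by blast
  then obtain F where "finite F" "UNIV \<subseteq> (\<Union>p\<in>F. U p)"
    by (rule compactE_image[OF compact_space, of UNIV U, rotated]) (use U in auto)
  then have F: "finite F" "(\<Union>p\<in>F. U p) = UNIV" by auto
  have "emeasure vol UNIV \<le> (\<Sum>p\<in>F. emeasure vol (U p))"
    unfolding F(2)[symmetric] using U F(1) by (intro emeasure_subadditive_finite) auto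
  also have "\<dots> < \<infinity>" using U F(1) by (simp add: ennreal_sum_less_top)
  finally show ?thesis .
qed

sublocale vol: finite_measure vol
  by (rule finite_measureI) (use emeasure_vol_finite in auto)

text \<open>In a chart, the density is positive and nonempty open sets have positive Lebesgue
  measure.\<close>

lemma emeasure_vol_open_pos:
  assumes "open U" "U \<noteq> {}"
  shows "emeasure vol U > 0"
proof -
  obtain p where "p \<in> U" using assms by auto
  obtain c where c: "c \<in> A" "p \<in> cdom c" using chart_exists by blast
  let ?V = "U \<inter> cdom c"
  have V: "open ?V" "?V \<subseteq> cdom c" using assms open_cdom[OF c(1)] by auto
  have oV: "open (cmap c ` ?V)" by (rule open_cmap_image[OF c(1) V])
  have "chart_volume g c ?V \<noteq> 0"
  proof
    assume "chart_volume g c ?V = 0"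
    moreover have "(\<lambda>x. ennreal (density_in g c x) * indicator (cmap c ` ?V) x) =
        (\<lambda>x. ennreal (indicator (cmap c ` ?V) x * density_in g c x))"
      by (auto simp: indicator_def)
    moreover have m: "(\<lambda>x. indicator (cmap c ` ?V) x * density_in g c x) \<in> borel_measurable borel"
      using oV by (intro borel_measurable_indicator_times[OF continuous_density[OF c(1)] open_cimg[OF c(1)]]) auto
    ultimately have "AE x in lborel. ennreal (indicator (cmap c ` ?V) x * density_in g c x) = 0"
      unfolding chart_volume_def by (subst nn_integral_0_iff_AE[symmetric]) auto
    then have "AE x in lborel. x \<notin> cmap c ` ?V"
      by eventually_elim (use density_pos[OF c(1)] in \<open>force simp: indicator_def split: if_splits\<close>)
    then have "emeasure lborel (cmap c ` ?V) = 0"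
      using oV by (subst (asm) AE_iff_measurable[of "cmap c ` ?V"]) auto
    then have "negligible (cmap c ` ?V)"
      using oV by (simp add: negligible_iff_emeasure0)
    then show False
      using open_not_negligible[OF oV] \<open>p \<in> U\<close> c(2) by blast
  qed
  moreover have "emeasure vol ?V \<le> emeasure vol U"
    using assms(1) by (intro emeasure_mono) auto
  ultimately show ?thesis
    using emeasure_vol_chart[OF c(1) borel_open[OF V(1)] V(2)] by (metis le_zero_eq zero_less_iff_neq_zero)
qed

end

section \<open>Smooth functions and the gradient product\<close>

lemma linear_axis_expansion:
  fixes L :: "real ^ 'n \<Rightarrow> 'b::real_vector"
  assumes "linear L"
  shows "L v = (\<Sum>i\<in>UNIV. v $ i *\<^sub>R L (axis i 1))"
proof -
  have "L v = L (\<Sum>i\<in>UNIV. v $ i *\<^sub>R axis i 1)"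
    using basis_expansion[of v] by (simp add: scalar_mult_eq_scaleR)
  then show ?thesis using assms by (simp add: linear_sum linear_scale)
qed

abbreviation differential :: "('m, 'n::finite) chart \<Rightarrow> ('m \<Rightarrow> complex) \<Rightarrow> 'm \<Rightarrow> real ^ 'n \<Rightarrow> complex" where
  "differential c u p \<equiv> frechet_derivative (u \<circ> cinv c) (at (cmap c p))"

text \<open>The inverse metric, extended to a complex bilinear form, on the differentials of
  \<open>u\<close> and \<open>v\<close>. It equals the metric on their gradients
  (\<open>metric_pairing_gradient\<close>), but transforms more simply under maps.\<close>

definition dual_product ::
  "('m, 'n::finite) metric_components \<Rightarrow> ('m, 'n) chart \<Rightarrow> ('m \<Rightarrow> complex) \<Rightarrow> ('m \<Rightarrow> complex) \<Rightarrow> 'm \<Rightarrow> complex" where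
  "dual_product g c u v p = (\<Sum>i\<in>UNIV. \<Sum>j\<in>UNIV. complex_of_real (matrix_inv (g c p) $ i $ j) *
     differential c u p (axis i 1) * differential c v p (axis j 1))"

text \<open>If \<open>H\<close> is the pullback of \<open>H'\<close> by \<open>J\<close>, then
  the inverse of \<open>H'\<close> is the pushforward of the inverse of \<open>H\<close>: the
  inverse metric is a contravariant tensor.\<close>

lemma pos_def_congruence_inverse:
  fixes H H' J :: "real ^ 'n ^ 'n"
  assumes "pos_def H" "pos_def H'" "H = transpose J ** H' ** J"
  shows "J ** matrix_inv H ** transpose J = matrix_inv H'"
proof -
  have "transpose J ** (H' ** J ** matrix_inv H) = mat 1"
    using pos_def_inverse(1)[OF assms(1)] assms(3) by (simp add: matrix_mul_assoc)
  then have "H' ** (J ** matrix_inv H ** transpose J) = mat 1"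
    using matrix_left_right_inverse[of "transpose J" "H' ** J ** matrix_inv H"] by (simp add: matrix_mul_assoc)
  then have "matrix_inv H' ** (H' ** (J ** matrix_inv H ** transpose J)) = matrix_inv H'"
    by simp
  then show ?thesis
    using pos_def_inverse(2)[OF assms(2)] by (simp add: matrix_mul_assoc)
qed

lemma symmetric_entry:
  assumes "transpose H = H"
  shows "H $ i $ j = H $ j $ i"
proof -
  have "H $ i $ j = transpose H $ i $ j" by (simp only: assms)
  then show ?thesis by (simp add: transpose_def)
qed

text \<open>Raising both indices and then contracting with the metric cancels one of the two
  inverse matrices.\<close>

lemma pos_def_sum_inverse:
  fixes X Y :: "'n::finite \<Rightarrow> complex"
  assumes "pos_def H"
  shows "(\<Sum>i\<in>UNIV. \<Sum>j\<in>UNIV. complex_of_real (H $ i $ j) *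
      (\<Sum>a\<in>UNIV. complex_of_real (matrix_inv H $ i $ a) * X a) *
      (\<Sum>b\<in>UNIV. complex_of_real (matrix_inv H $ j $ b) * Y b)) =
    (\<Sum>j\<in>UNIV. \<Sum>b\<in>UNIV. complex_of_real (matrix_inv H $ j $ b) * X j * Y b)"
proof -
  let ?G = "matrix_inv H"
  have sym: "H $ i $ j = H $ j $ i" for i j
    using assms by (intro symmetric_entry) (simp add: pos_def_def)
  have inv: "(\<Sum>i\<in>UNIV. H $ j $ i * ?G $ i $ a) = (if j = a then 1 else 0)" for j a
  proof -
    have "(H ** ?G) $ j $ a = mat 1 $ j $ a" using pos_def_inverse(1)[OF assms] by simp
    then show ?thesis by (simp add: matrix_matrix_mult_def mat_def)
  qed
  have X: "(\<Sum>i\<in>UNIV. complex_of_real (H $ i $ j) * (\<Sum>a\<in>UNIV. complex_of_real (?G $ i $ a) * X a)) = X j" for j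
  proof -
    have "(\<Sum>i\<in>UNIV. complex_of_real (H $ i $ j) * (\<Sum>a\<in>UNIV. complex_of_real (?G $ i $ a) * X a)) =
        (\<Sum>i\<in>UNIV. \<Sum>a\<in>UNIV. complex_of_real (H $ j $ i * ?G $ i $ a) * X a)"
      by (simp add: sum_distrib_left sym[of _ j] mult.assoc)
    also have "\<dots> = (\<Sum>a\<in>UNIV. \<Sum>i\<in>UNIV. complex_of_real (H $ j $ i * ?G $ i $ a) * X a)"
      by (rule sum.swap)
    also have "\<dots> = (\<Sum>a\<in>UNIV. complex_of_real (\<Sum>i\<in>UNIV. H $ j $ i * ?G $ i $ a) * X a)"
      by (simp add: sum_distrib_right)
    also have "\<dots> = (\<Sum>a\<in>UNIV. if j = a then X a else 0)"
      unfolding inv by (intro sum.cong) auto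
    also have "\<dots> = X j" by simp
    finally show ?thesis .
  qed
  have "(\<Sum>i\<in>UNIV. \<Sum>j\<in>UNIV. complex_of_real (H $ i $ j) *
      (\<Sum>a\<in>UNIV. complex_of_real (?G $ i $ a) * X a) * (\<Sum>b\<in>UNIV. complex_of_real (?G $ j $ b) * Y b)) =
    (\<Sum>j\<in>UNIV. (\<Sum>i\<in>UNIV. complex_of_real (H $ i $ j) * (\<Sum>a\<in>UNIV. complex_of_real (?G $ i $ a) * X a)) *
      (\<Sum>b\<in>UNIV. complex_of_real (?G $ j $ b) * Y b))"
    by (subst sum.swap) (simp only: sum_distrib_right)
  also have "\<dots> = (\<Sum>j\<in>UNIV. X j * (\<Sum>b\<in>UNIV. complex_of_real (?G $ j $ b) * Y b))"
    by (simp only: X)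
  also have "\<dots> = (\<Sum>j\<in>UNIV. \<Sum>b\<in>UNIV. complex_of_real (?G $ j $ b) * X j * Y b)"
    by (simp add: sum_distrib_left mult_ac)
  finally show ?thesis .
qed

lemma sum_congruence:
  fixes X Y :: "'n::finite \<Rightarrow> complex" and G J :: "real ^ 'n ^ 'n"
  shows "(\<Sum>i\<in>UNIV. \<Sum>j\<in>UNIV. complex_of_real (G $ i $ j) *
      (\<Sum>a\<in>UNIV. complex_of_real (J $ a $ i) * X a) * (\<Sum>b\<in>UNIV. complex_of_real (J $ b $ j) * Y b)) =
    (\<Sum>a\<in>UNIV. \<Sum>b\<in>UNIV. complex_of_real ((J ** G ** transpose J) $ a $ b) * X a * Y b)"
proof -
  have "(\<Sum>i\<in>UNIV. \<Sum>j\<in>UNIV. complex_of_real (G $ i $ j) *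
      (\<Sum>a\<in>UNIV. complex_of_real (J $ a $ i) * X a) * (\<Sum>b\<in>UNIV. complex_of_real (J $ b $ j) * Y b)) =
    (\<Sum>i\<in>UNIV. \<Sum>j\<in>UNIV. \<Sum>a\<in>UNIV. \<Sum>b\<in>UNIV.
      complex_of_real (J $ a $ i * G $ i $ j * J $ b $ j) * X a * Y b)"
    by (simp add: sum_distrib_left sum_distrib_right mult_ac)
  also have "\<dots> = (\<Sum>i\<in>UNIV. \<Sum>a\<in>UNIV. \<Sum>j\<in>UNIV. \<Sum>b\<in>UNIV.
      complex_of_real (J $ a $ i * G $ i $ j * J $ b $ j) * X a * Y b)"
    by (intro sum.cong refl sum.swap)
  also have "\<dots> = (\<Sum>a\<in>UNIV. \<Sum>i\<in>UNIV. \<Sum>b\<in>UNIV. \<Sum>j\<in>UNIV.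
      complex_of_real (J $ a $ i * G $ i $ j * J $ b $ j) * X a * Y b)"
    by (subst sum.swap) (intro sum.cong refl sum.swap)
  also have "\<dots> = (\<Sum>a\<in>UNIV. \<Sum>b\<in>UNIV. \<Sum>i\<in>UNIV. \<Sum>j\<in>UNIV.
      complex_of_real (J $ a $ i * G $ i $ j * J $ b $ j) * X a * Y b)"
    by (intro sum.cong refl sum.swap)
  also have "\<dots> = (\<Sum>a\<in>UNIV. \<Sum>b\<in>UNIV. \<Sum>j\<in>UNIV. \<Sum>i\<in>UNIV.
      complex_of_real (J $ a $ i * G $ i $ j * J $ b $ j) * X a * Y b)"
    by (intro sum.cong refl sum.swap)
  also have "\<dots> = (\<Sum>a\<in>UNIV. \<Sum>b\<in>UNIV. complex_of_real ((J ** G ** transpose J) $ a $ b) * X a * Y b)"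
    by (simp add: matrix_matrix_mult_def transpose_def sum_distrib_right)
  finally show ?thesis .
qed

context riem
begin

lemma smooth_fun_iff_Ck: "smooth_fun A u \<longleftrightarrow> (\<forall>c\<in>A. \<forall>k. Ck_on k (cimg c) (u \<circ> cinv c))"
  by (simp add: smooth_fun_def smooth_on_def)

text \<open>Smoothness is a local property in the chart of the source: near a point, \<open>u
  \<circ> f\<close> read in \<open>c\<close> is the composite of \<open>u\<close> read in a
  chart \<open>c'\<close> at the image point with \<open>f\<close> read in \<open>c\<close> and
  \<open>c'\<close>.\<close>

lemma smooth_fun_comp:
  assumes f: "smooth_map A f" and u: "smooth_fun A u"
  shows "smooth_fun A (u \<circ> f)"
  unfolding smooth_fun_iff_Ck
proof (intro ballI allI Ck_on_local)
  fix c k x assume c: "c \<in> A" and x: "x \<in> cimg c"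
  define p where "p = cinv c x"
  have p: "p \<in> cdom c" "cmap c p = x" using x c by (simp_all add: p_def cinv_in cmap_cinv)
  obtain c' where c': "c' \<in> A" "f p \<in> cdom c'" using chart_exists by blast
  let ?U = "cmap c ` (cdom c \<inter> f -` cdom c')" and ?T = "cmap c' \<circ> f \<circ> cinv c"
  have U: "open ?U" by (rule open_transition_dom[OF f c c'(1)])
  have eq: "f (cinv c y) \<in> cdom c'" if "y \<in> ?U" for y
    using that c by (auto simp: cinv_cmap)
  have "Ck_on k ?U (\<lambda>y. (u \<circ> cinv c') (?T y))"
  proof (rule Ck_on_compose[OF U open_cimg[OF c'(1)]])
    show "?T ` ?U \<subseteq> cimg c'" using eq by auto
    show "Ck_on k ?U ?T" using smooth_transition[OF f c c'(1)] by (simp add: smooth_on_def)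
    show "Ck_on k (cimg c') (u \<circ> cinv c')" using u c'(1) by (simp add: smooth_fun_iff_Ck)
  qed
  then have "Ck_on k ?U (u \<circ> f \<circ> cinv c)"
    by (rule Ck_on_cong[OF U, rotated]) (use eq c'(1) in \<open>simp add: cinv_cmap\<close>)
  then show "\<exists>U. open U \<and> x \<in> U \<and> Ck_on k U (u \<circ> f \<circ> cinv c)"
    using U p c' by blast
qed

lemma smooth_fun_bounded_linear:
  assumes "bounded_linear L" "smooth_fun A u"
  shows "smooth_fun A (\<lambda>x. L (u x))"
  unfolding smooth_fun_iff_Ck
proof (intro ballI allI)
  fix c k assume c: "c \<in> A"
  then have "Ck_on k (cimg c) (u \<circ> cinv c)" using assms(2) by (simp add: smooth_fun_iff_Ck)
  from Ck_on_bounded_linear[OF assms(1) open_cimg[OF c] this]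
  show "Ck_on k (cimg c) ((\<lambda>x. L (u x)) \<circ> cinv c)" by (simp add: o_def)
qed

lemma smooth_fun_add: "smooth_fun A u \<Longrightarrow> smooth_fun A v \<Longrightarrow> smooth_fun A (\<lambda>x. u x + v x)"
  unfolding smooth_fun_iff_Ck
proof (intro ballI allI)
  fix c k assume u: "\<forall>c\<in>A. \<forall>k. Ck_on k (cimg c) (u \<circ> cinv c)"
    and v: "\<forall>c\<in>A. \<forall>k. Ck_on k (cimg c) (v \<circ> cinv c)" and c: "c \<in> A"
  from Ck_on_add[OF open_cimg[OF c] u[rule_format, OF c] v[rule_format, OF c]]
  show "Ck_on k (cimg c) ((\<lambda>x. u x + v x) \<circ> cinv c)" by (simp add: o_def)
qed

lemma smooth_fun_cmult: "smooth_fun A u \<Longrightarrow> smooth_fun A (\<lambda>x. a * u x)"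
  by (rule smooth_fun_bounded_linear[OF bounded_linear_mult_right])

lemma smooth_fun_cnj: "smooth_fun A u \<Longrightarrow> smooth_fun A (\<lambda>x. cnj (u x))"
  by (rule smooth_fun_bounded_linear[OF bounded_linear_cnj])

lemma smooth_fun_zero: "smooth_fun A (\<lambda>x. 0)"
  by (simp add: smooth_fun_iff_Ck o_def Ck_on_const)

lemma smooth_fun_sum: "(\<And>i. i \<in> I \<Longrightarrow> smooth_fun A (u i)) \<Longrightarrow> smooth_fun A (\<lambda>x. \<Sum>i\<in>I. u i x)"
  by (induction I rule: infinite_finite_induct) (simp_all add: smooth_fun_zero smooth_fun_add)

lemma continuous_on_charts:
  fixes h :: "'m \<Rightarrow> 'x::topological_space"
  assumes "\<And>c. c \<in> A \<Longrightarrow> continuous_on (cdom c) h"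
  shows "continuous_on UNIV h"
proof -
  have "isCont h p" for p
    using chart_exists[of p] assms open_cdom continuous_on_eq_continuous_at by metis
  then show ?thesis by (simp add: continuous_at_imp_continuous_on)
qed

lemma smooth_fun_continuous:
  assumes "smooth_fun A u"
  shows "continuous_on UNIV u"
proof (rule continuous_on_charts)
  fix c assume c: "c \<in> A"
  have "continuous_on (cimg c) (u \<circ> cinv c)"
    using assms c unfolding smooth_fun_def by (intro smooth_on_continuous) blast
  then have "continuous_on (cdom c) (\<lambda>p. (u \<circ> cinv c) (cmap c p))"
    by (rule continuous_on_compose2[OF _ continuous_cmap[OF c]]) simp
  then show "continuous_on (cdom c) u"
    by (rule continuous_on_eq) (simp add: cinv_cmap c)
qed

context
  fixes c p assumes c: "c \<in> A" and p: "p \<in> cdom c"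
begin

lemma smooth_fun_differentiable:
  "smooth_fun A u \<Longrightarrow> (u \<circ> cinv c) differentiable (at (cmap c p))"
  using c p by (auto simp: smooth_fun_def intro: smooth_on_differentiable)

lemma differential_works:
  "smooth_fun A u \<Longrightarrow> ((u \<circ> cinv c) has_derivative differential c u p) (at (cmap c p))"
  using smooth_fun_differentiable by (simp add: frechet_derivative_works)

lemma linear_differential: "smooth_fun A u \<Longrightarrow> linear (differential c u p)"
  using smooth_fun_differentiable by (rule linear_frechet_derivative)

lemma differential_bounded_linear:
  assumes "bounded_linear L" "smooth_fun A u"
  shows "differential c (\<lambda>x. L (u x)) p v = L (differential c u p v)"
  using frechet_derivative_at[OF bounded_linear.has_derivative[OF assms(1) differential_works[OF assms(2)]]]
  by (simp add: o_def fun_eq_iff)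

lemma differential_add:
  assumes "smooth_fun A u" "smooth_fun A w"
  shows "differential c (\<lambda>x. u x + w x) p v = differential c u p v + differential c w p v"
  using frechet_derivative_at[OF has_derivative_add[OF differential_works[OF assms(1)] differential_works[OF assms(2)]]]
  by (simp add: o_def fun_eq_iff)

lemmas differential_cmult = differential_bounded_linear[OF bounded_linear_mult_right]
lemmas differential_cnj = differential_bounded_linear[OF bounded_linear_cnj]

lemma metric_pairing_gradient:
  "metric_pairing g c p (gradient g c u p) (gradient g c v p) = dual_product g c u v p"
  unfolding metric_pairing_def gradient_def dual_product_def
  using pos_def_sum_inverse[OF pos_def_metric[OF c p], of
      "\<lambda>i. differential c u p (axis i 1)" "\<lambda>i. differential c v p (axis i 1)"]
  by simp

end

lemma differential_comp:
  assumes f: "smooth_map A f" and u: "smooth_fun A u" and c: "c \<in> A" "c' \<in> A" "p \<in> cdom c" "f p \<in> cdom c'"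
  shows "differential c (u \<circ> f) p v = differential c' u (f p) (jacobian_at c c' f p *v v)"
proof -
  let ?U = "cmap c ` (cdom c \<inter> f -` cdom c')" and ?T = "cmap c' \<circ> f \<circ> cinv c"
  have Tp: "?T (cmap c p) = cmap c' (f p)" using c by (simp add: cinv_cmap)
  have "((u \<circ> cinv c') \<circ> ?T has_derivative differential c' u (f p) \<circ> (\<lambda>v. jacobian_at c c' f p *v v)) (at (cmap c p))"
  proof (rule diff_chain_at)
    show "(?T has_derivative (\<lambda>v. jacobian_at c c' f p *v v)) (at (cmap c p))"
      by (rule transition_has_derivative[OF f c])
    show "(u \<circ> cinv c' has_derivative differential c' u (f p)) (at (?T (cmap c p)))"
      unfolding Tp by (rule differential_works[OF c(2,4) u])
  qed
  then have "((u \<circ> f) \<circ> cinv c has_derivative differential c' u (f p) \<circ> (\<lambda>v. jacobian_at c c' f p *v v)) (at (cmap c p))"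
  proof (rule has_derivative_transform_within_open)
    show "open ?U" by (rule open_transition_dom[OF f c(1,2)])
    show "cmap c p \<in> ?U" using c by blast
    show "((u \<circ> cinv c') \<circ> ?T) y = ((u \<circ> f) \<circ> cinv c) y" if "y \<in> ?U" for y
      using that c by (auto simp: cinv_cmap)
  qed
  from frechet_derivative_at[OF this] show ?thesis by (simp add: fun_eq_iff)
qed

text \<open>The differentials transform with the transposed Jacobian matrix and the inverse
  metric with the Jacobian matrix, and the two cancel. The statement covers two uses: with
  \<open>f = id\<close> the product is independent of the chart, and with an isometry
  \<open>f\<close> it is invariant.\<close>

lemma dual_product_comp:
  assumes f: "smooth_map A f" "preserves_metric A g f" and u: "smooth_fun A u" "smooth_fun A v"
    and c: "c \<in> A" "c' \<in> A" "p \<in> cdom c" "f p \<in> cdom c'"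
  shows "dual_product g c (u \<circ> f) (v \<circ> f) p = dual_product g c' u v (f p)"
proof -
  let ?J = "jacobian_at c c' f p"
  have d: "differential c (w \<circ> f) p (axis i 1) =
      (\<Sum>a\<in>UNIV. complex_of_real (?J $ a $ i) * differential c' w (f p) (axis a 1))"
    if w: "smooth_fun A w" for w i
    unfolding differential_comp[OF f(1) w c]
    by (subst linear_axis_expansion[OF linear_differential[OF c(2,4) w]])
      (simp add: matrix_vector_mult_basis column_def scaleR_conv_of_real)
  have "?J ** matrix_inv (g c p) ** transpose ?J = matrix_inv (g c' (f p))"
    using c f(2) by (intro pos_def_congruence_inverse pos_def_metric) (auto simp: preserves_metric_def)
  then show ?thesis
    unfolding dual_product_def d[OF u(1)] d[OF u(2)] by (simp only: sum_congruence)
qed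

lemma gradient_product_chart:
  assumes "smooth_fun A u" "smooth_fun A v" "c \<in> A" "p \<in> cdom c"
  shows "gradient_product A g u v p = dual_product g c u v p"
proof -
  have "gradient_product A g u v p = dual_product g (chart_at A p) u v p"
    unfolding gradient_product_def Let_def by (rule metric_pairing_gradient[OF chart_at])
  also have "\<dots> = dual_product g c u v p"
    using dual_product_comp[OF smooth_id preserves_id assms(1,2) assms(3) chart_at(1) assms(4)] chart_at(2)[of p]
    by simp
  finally show ?thesis .
qed

lemma gradient_product_comp:
  assumes "smooth_map A f" "preserves_metric A g f" "smooth_fun A u" "smooth_fun A v"
  shows "gradient_product A g (u \<circ> f) (v \<circ> f) p = gradient_product A g u v (f p)"
  unfolding gradient_product_chart[OF smooth_fun_comp[OF assms(1,3)] smooth_fun_comp[OF assms(1,4)] chart_at]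
    gradient_product_chart[OF assms(3,4) chart_at]
  by (rule dual_product_comp[OF assms chart_at(1) chart_at(1) chart_at(2) chart_at(2)])

definition grad_ip :: "('m \<Rightarrow> complex) \<Rightarrow> ('m \<Rightarrow> complex) \<Rightarrow> 'm \<Rightarrow> complex" where
  "grad_ip u v = gradient_product A g u (\<lambda>q. cnj (v q))"

lemma grad_ip_comp:
  assumes "smooth_map A f" "preserves_metric A g f" "smooth_fun A u" "smooth_fun A v"
  shows "grad_ip (u \<circ> f) (v \<circ> f) p = grad_ip u v (f p)"
  using gradient_product_comp[OF assms(1-3) smooth_fun_cnj[OF assms(4)]] by (simp add: grad_ip_def o_def)

lemma grad_ip_chart:
  assumes "smooth_fun A u" "smooth_fun A v" "c \<in> A" "p \<in> cdom c"
  shows "grad_ip u v p = (\<Sum>i\<in>UNIV. \<Sum>j\<in>UNIV. complex_of_real (matrix_inv (g c p) $ i $ j) *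
     differential c u p (axis i 1) * cnj (differential c v p (axis j 1)))"
  unfolding grad_ip_def gradient_product_chart[OF assms(1) smooth_fun_cnj[OF assms(2)] assms(3,4)]
    dual_product_def differential_cnj[OF assms(3,4,2)] ..

lemma grad_ip_add_left:
  assumes "smooth_fun A u" "smooth_fun A v" "smooth_fun A w"
  shows "grad_ip (\<lambda>x. u x + v x) w p = grad_ip u w p + grad_ip v w p"
  unfolding grad_ip_chart[OF assms(1,3) chart_at] grad_ip_chart[OF assms(2,3) chart_at]
    grad_ip_chart[OF smooth_fun_add[OF assms(1,2)] assms(3) chart_at]
  by (simp add: differential_add[OF chart_at assms(1,2)] algebra_simps sum.distrib)

lemma grad_ip_cmult_left:
  assumes "smooth_fun A u" "smooth_fun A w"
  shows "grad_ip (\<lambda>x. a * u x) w p = a * grad_ip u w p"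
  unfolding grad_ip_chart[OF assms chart_at]
    grad_ip_chart[OF smooth_fun_cmult[OF assms(1)] assms(2) chart_at]
  by (simp add: differential_cmult[OF chart_at assms(1)] sum_distrib_left mult_ac)

lemma inverse_metric_sym:
  "c \<in> A \<Longrightarrow> p \<in> cdom c \<Longrightarrow> matrix_inv (g c p) $ i $ j = matrix_inv (g c p) $ j $ i"
  by (intro symmetric_entry pos_def_inverse(3) pos_def_metric)

lemma grad_ip_hermitian:
  assumes "smooth_fun A u" "smooth_fun A w"
  shows "grad_ip w u p = cnj (grad_ip u w p)"
proof -
  let ?c = "chart_at A p"
  have "cnj (grad_ip u w p) = (\<Sum>i\<in>UNIV. \<Sum>j\<in>UNIV. complex_of_real (matrix_inv (g ?c p) $ i $ j) *
     differential ?c w p (axis j 1) * cnj (differential ?c u p (axis i 1)))"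
    unfolding grad_ip_chart[OF assms chart_at] by (simp add: mult_ac)
  also have "\<dots> = (\<Sum>j\<in>UNIV. \<Sum>i\<in>UNIV. complex_of_real (matrix_inv (g ?c p) $ j $ i) *
     differential ?c w p (axis j 1) * cnj (differential ?c u p (axis i 1)))"
    by (subst sum.swap) (simp add: inverse_metric_sym[OF chart_at])
  also have "\<dots> = grad_ip w u p"
    unfolding grad_ip_chart[OF assms(2,1) chart_at] ..
  finally show ?thesis ..
qed

text \<open>The squared length of the gradient; \<open>grad_ip u u\<close> is real by
  \<open>grad_ip_self\<close>.\<close>

definition grad_sq :: "('m \<Rightarrow> complex) \<Rightarrow> 'm \<Rightarrow> real" where
  "grad_sq u p = Re (grad_ip u u p)"

lemma grad_ip_self:
  assumes "smooth_fun A u"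
  shows "grad_ip u u p = complex_of_real (grad_sq u p)"
  using grad_ip_hermitian[OF assms assms, of p] by (simp add: grad_sq_def complex_eq_iff)

text \<open>The real and imaginary parts of the differential are real covectors, which splits
  the squared length into two values of the real quadratic form of the inverse metric.\<close>

lemma grad_sq_chart:
  assumes "smooth_fun A u" "c \<in> A" "p \<in> cdom c"
  defines "x \<equiv> \<chi> i. Re (differential c u p (axis i 1))"
    and "y \<equiv> \<chi> i. Im (differential c u p (axis i 1))"
  shows "grad_sq u p = x \<bullet> (matrix_inv (g c p) *v x) + y \<bullet> (matrix_inv (g c p) *v y)"
  unfolding grad_sq_def grad_ip_chart[OF assms(1) assms(1-3)]
  by (simp add: x_def y_def inner_vec_def matrix_vector_mult_def sum_distrib_left
      algebra_simps sum.distrib)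

text \<open>The dual Cauchy-Schwarz inequality for \<open>x = v\<close> forces the inverse of a
  positive definite form to be nonnegative.\<close>

lemma grad_sq_nonneg:
  assumes "smooth_fun A u"
  shows "grad_sq u p \<ge> 0"
proof -
  obtain c where c: "c \<in> A" "p \<in> cdom c" using chart_exists by blast
  have "v \<bullet> (matrix_inv (g c p) *v v) \<ge> 0" for v
  proof (cases "v = 0")
    case False
    then have "0 \<le> (v \<bullet> v)\<^sup>2" "0 < v \<bullet> (g c p *v v)"
      using pos_def_metric[OF c] by (auto simp: pos_def_def)
    then show ?thesis
      using pos_def_Cauchy_Schwarz_dual[OF pos_def_metric[OF c], of v v] by (metis mult_less_0_iff not_le order_trans)
  qed simp
  then show ?thesis unfolding grad_sq_chart[OF assms c] by (intro add_nonneg_nonneg) auto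
qed

text \<open>The length of the gradient bounds the derivative along a tangent vector: the dual
  Cauchy-Schwarz inequality, applied to the real and to the imaginary part of the
  differential.\<close>

lemma differential_Cauchy_Schwarz:
  assumes "smooth_fun A u" "c \<in> A" "p \<in> cdom c"
  shows "(cmod (differential c u p v))\<^sup>2 \<le> grad_sq u p * (v \<bullet> (g c p *v v))"
proof -
  define x where "x = (\<chi> i. Re (differential c u p (axis i 1)))"
  define y where "y = (\<chi> i. Im (differential c u p (axis i 1)))"
  note e = linear_axis_expansion[OF linear_differential[OF assms(2,3,1)], of v]
  have "Re (differential c u p v) = x \<bullet> v" "Im (differential c u p v) = y \<bullet> v"
    by (subst e, simp add: x_def y_def inner_vec_def mult.commute)+
  then have "(cmod (differential c u p v))\<^sup>2 = (x \<bullet> v)\<^sup>2 + (y \<bullet> v)\<^sup>2"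
    by (simp add: cmod_power2)
  also have "\<dots> \<le> (x \<bullet> (matrix_inv (g c p) *v x)) * (v \<bullet> (g c p *v v)) +
      (y \<bullet> (matrix_inv (g c p) *v y)) * (v \<bullet> (g c p *v v))"
    by (intro add_mono pos_def_Cauchy_Schwarz_dual pos_def_metric assms)
  also have "\<dots> = grad_sq u p * (v \<bullet> (g c p *v v))"
    unfolding grad_sq_chart[OF assms] x_def y_def by (simp add: algebra_simps)
  finally show ?thesis .
qed

lemma continuous_grad_ip:
  assumes "smooth_fun A u" "smooth_fun A v"
  shows "continuous_on UNIV (grad_ip u v)"
proof (rule continuous_on_charts)
  fix c assume c: "c \<in> A"
  have G: "continuous_on (cdom c) (\<lambda>p. matrix_inv (g c p) $ i $ j)" for i j
  proof -
    have "continuous_on (cimg c) (\<lambda>x. matrix_inv (g c (cinv c x)) $ i $ j)"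
      using pos_def_det_pos[OF pos_def_metric[OF c cinv_in[OF c]]]
      by (intro continuous_on_matrix_inv_entry continuous_metric c) force
    then have "continuous_on (cdom c) (\<lambda>p. matrix_inv (g c (cinv c (cmap c p))) $ i $ j)"
      by (rule continuous_on_compose2[OF _ continuous_cmap[OF c]]) simp
    then show ?thesis by (rule continuous_on_eq) (simp add: cinv_cmap c)
  qed
  have D: "continuous_on (cdom c) (\<lambda>p. differential c w p e)" if "smooth_fun A w" for w e
  proof -
    have "continuous_on (cimg c) (\<lambda>x. frechet_derivative (w \<circ> cinv c) (at x) e)"
      using that c by (intro smooth_on_continuous_derivative) (simp add: smooth_fun_def)
    then show ?thesis
      by (rule continuous_on_compose2[OF _ continuous_cmap[OF c]]) simp
  qed
  have "continuous_on (cdom c) (\<lambda>p. \<Sum>i\<in>UNIV. \<Sum>j\<in>UNIV. complex_of_real (matrix_inv (g c p) $ i $ j) *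
     differential c u p (axis i 1) * cnj (differential c v p (axis j 1)))"
    by (intro continuous_on_sum continuous_on_mult continuous_on_of_real continuous_on_cnj G D assms)
  then show "continuous_on (cdom c) (grad_ip u v)"
    by (rule continuous_on_eq) (rule grad_ip_chart[OF assms c, symmetric])
qed

lemma continuous_grad_sq: "smooth_fun A u \<Longrightarrow> continuous_on UNIV (grad_sq u)"
  unfolding grad_sq_def by (intro continuous_on_Re continuous_grad_ip)

end

section \<open>Paths and the Riemannian distance\<close>

context riem
begin

text \<open>The differentiability condition of \<open>piecewise_C1_path\<close>, for given break
  points \<open>S\<close>.\<close>

definition C1_off :: "real set \<Rightarrow> (real \<Rightarrow> 'm) \<Rightarrow> bool" where
  "C1_off S \<gamma> \<longleftrightarrow> (\<forall>c\<in>A. \<forall>a b. 0 \<le> a \<and> a < b \<and> b \<le> 1 \<and> {a<..<b} \<inter> S = {} \<and> \<gamma> ` {a..b} \<subseteq> cdom c \<longrightarrow>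
     (\<exists>D. continuous_on {a..b} D \<and>
        (\<forall>t\<in>{a..b}. (cmap c \<circ> \<gamma> has_vector_derivative D t) (at t within {a..b}))))"

lemma piecewise_C1_path_iff: "piecewise_C1_path A \<gamma> \<longleftrightarrow> path \<gamma> \<and> (\<exists>S. finite S \<and> C1_off S \<gamma>)"
  unfolding piecewise_C1_path_def C1_off_def ..

lemma C1_offE:
  assumes "C1_off S \<gamma>" "c \<in> A" "0 \<le> a" "a < b" "b \<le> 1" "{a<..<b} \<inter> S = {}" "\<gamma> ` {a..b} \<subseteq> cdom c"
  obtains D where "continuous_on {a..b} D"
    "\<And>t. t \<in> {a..b} \<Longrightarrow> (cmap c \<circ> \<gamma> has_vector_derivative D t) (at t within {a..b})"
  using assms unfolding C1_off_def by meson

lemma transition_line: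
  assumes c: "c \<in> A" "c' \<in> A" and l: "X + t *\<^sub>R V \<in> cimg c" "cinv c (X + t *\<^sub>R V) \<in> cdom c'"
  defines "T \<equiv> cmap c' \<circ> id \<circ> cinv c"
  shows "X + t *\<^sub>R V \<in> cmap c ` (cdom c \<inter> id -` cdom c')"
    "((\<lambda>s. T (X + s *\<^sub>R V)) has_vector_derivative frechet_derivative T (at (X + t *\<^sub>R V)) V) (at t)"
proof -
  let ?y = "X + t *\<^sub>R V"
  show y: "?y \<in> cmap c ` (cdom c \<inter> id -` cdom c')"
    using l cinv_in[OF c(1) l(1)] cmap_cinv[OF c(1) l(1)] by (intro image_eqI[of _ _ "cinv c ?y"]) auto
  have "T differentiable (at ?y)"
    unfolding T_def by (rule smooth_on_differentiable[OF smooth_transition[OF smooth_id c] y])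
  then have 1: "(T has_derivative frechet_derivative T (at ?y)) (at ?y)" and lin: "linear (frechet_derivative T (at ?y))"
    by (simp_all add: frechet_derivative_works linear_frechet_derivative)
  have "((\<lambda>s. X + s *\<^sub>R V) has_derivative (\<lambda>s. s *\<^sub>R V)) (at t)"
    by (auto intro!: derivative_eq_intros)
  from has_derivative_compose[OF this 1]
  show "((\<lambda>s. T (X + s *\<^sub>R V)) has_vector_derivative frechet_derivative T (at ?y) V) (at t)"
    by (simp add: has_vector_derivative_def linear_scale[OF lin])
qed

text \<open>A straight line in one chart is, read in any other chart, the composite with a
  smooth transition map, so it has continuous derivatives there up to the end points.\<close>

lemma piecewise_C1_segment:
  assumes c: "c \<in> A" and seg: "\<And>t. 0 \<le> t \<Longrightarrow> t \<le> 1 \<Longrightarrow> X + t *\<^sub>R V \<in> cimg c"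
  shows "piecewise_C1_path A (\<lambda>t. cinv c (X + t *\<^sub>R V))"
proof -
  let ?\<gamma> = "\<lambda>t. cinv c (X + t *\<^sub>R V)"
  have "path ?\<gamma>"
    unfolding path_def using seg
    by (intro continuous_on_compose2[OF continuous_cinv[OF c]] continuous_intros) auto
  moreover have "\<exists>D. continuous_on {a..b} D \<and>
      (\<forall>t\<in>{a..b}. (cmap c' \<circ> ?\<gamma> has_vector_derivative D t) (at t within {a..b}))"
    if c': "c' \<in> A" and ab: "0 \<le> a" "a < b" "b \<le> 1" and img: "?\<gamma> ` {a..b} \<subseteq> cdom c'" for c' a b
  proof -
    let ?T = "cmap c' \<circ> id \<circ> cinv c" and ?U = "cmap c ` (cdom c \<inter> id -` cdom c')"
    let ?D = "\<lambda>t. frechet_derivative ?T (at (X + t *\<^sub>R V)) V"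
    have in_c: "X + t *\<^sub>R V \<in> cimg c" if "t \<in> {a..b}" for t
      using seg[of t] that ab by auto
    have in_c': "?\<gamma> t \<in> cdom c'" if "t \<in> {a..b}" for t
      using img that by blast
    have "continuous_on ?U (\<lambda>x. frechet_derivative ?T (at x) V)"
      by (rule smooth_on_continuous_derivative[OF smooth_transition[OF smooth_id c c']])
    then have "continuous_on {a..b} ?D"
      by (rule continuous_on_compose2)
        (use transition_line(1)[OF c c' in_c in_c'] in \<open>auto intro!: continuous_intros\<close>)
    moreover have "(cmap c' \<circ> ?\<gamma> has_vector_derivative ?D t) (at t within {a..b})" if "t \<in> {a..b}" for t
      using transition_line(2)[OF c c' in_c[OF that] in_c'[OF that]]
      by (auto simp: o_def intro: has_vector_derivative_at_within)
    ultimately show ?thesis by blast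
  qed
  then have "C1_off {} ?\<gamma>" unfolding C1_off_def by blast
  ultimately show ?thesis
    unfolding piecewise_C1_path_iff by blast
qed

text \<open>The two halves of a concatenation traverse the given paths at double speed, as
  \<open>t \<mapsto> \<gamma> (2 * t - m)\<close> with \<open>m = 0\<close> and \<open>m =
  1\<close>; break points move accordingly.\<close>

lemma C1_piece_reparam:
  fixes \<gamma> :: "real \<Rightarrow> 'm"
  assumes \<gamma>: "C1_off S \<gamma>"
    and c: "c \<in> A" and ab: "a < b" "0 \<le> 2 * a - m" "2 * b - m \<le> 1" "\<And>t. t \<in> S \<Longrightarrow> (t + m) / 2 \<notin> {a<..<b}"
    and \<beta>: "\<And>t. t \<in> {a..b} \<Longrightarrow> \<beta> t = \<gamma> (2 * t - m)" "\<beta> ` {a..b} \<subseteq> cdom c"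
  shows "\<exists>D. continuous_on {a..b} D \<and>
      (\<forall>t\<in>{a..b}. (cmap c \<circ> \<beta> has_vector_derivative D t) (at t within {a..b}))"
proof -
  let ?h = "\<lambda>t. 2 * t - m"
  have img: "?h ` {a..b} = {2 * a - m..2 * b - m}"
  proof -
    have "?h ` {a..b} = (\<lambda>x. 2 * x + (- m)) ` {a..b}" by simp
    also have "\<dots> = {2 * a + (- m)..2 * b + (- m)}"
      using ab(1) by (subst image_affinity_atLeastAtMost) auto
    finally show ?thesis by simp
  qed
  have "{2 * a - m<..<2 * b - m} \<inter> S = {}"
    using ab(4) by (auto simp: field_simps)
  moreover have "\<gamma> ` {2 * a - m..2 * b - m} \<subseteq> cdom c"
    unfolding img[symmetric] using \<beta> by auto
  ultimately obtain D where D: "continuous_on {2 * a - m..2 * b - m} D"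
    "\<And>t. t \<in> {2 * a - m..2 * b - m} \<Longrightarrow>
      (cmap c \<circ> \<gamma> has_vector_derivative D t) (at t within {2 * a - m..2 * b - m})"
    using ab(1-3) by (elim C1_offE[OF \<gamma> c, rotated -1]) auto
  show ?thesis
  proof (intro exI conjI ballI)
    show "continuous_on {a..b} (\<lambda>t. 2 *\<^sub>R D (?h t))"
      by (intro continuous_intros continuous_on_compose2[OF D(1)]) (use img in auto)
    fix t assume t: "t \<in> {a..b}"
    have "(?h has_vector_derivative 2) (at t within {a..b})"
      by (auto intro!: derivative_eq_intros simp: has_real_derivative_iff_has_vector_derivative[symmetric])
    moreover have "(cmap c \<circ> \<gamma> has_vector_derivative D (?h t)) (at (?h t) within ?h ` {a..b})"
      unfolding img using t by (intro D(2)) auto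
    ultimately have "((cmap c \<circ> \<gamma>) \<circ> ?h has_vector_derivative 2 *\<^sub>R D (?h t)) (at t within {a..b})"
      by (rule vector_diff_chain_within)
    then show "(cmap c \<circ> \<beta> has_vector_derivative 2 *\<^sub>R D (?h t)) (at t within {a..b})"
      by (rule has_vector_derivative_transform[OF t, rotated]) (simp add: \<beta>(1))
  qed
qed

lemma piecewise_C1_join:
  assumes "piecewise_C1_path A \<gamma>1" "piecewise_C1_path A \<gamma>2" "pathfinish \<gamma>1 = pathstart \<gamma>2"
  shows "piecewise_C1_path A (\<gamma>1 +++ \<gamma>2)"
proof -
  obtain S1 S2 where S: "finite S1" "finite S2" and C1: "C1_off S1 \<gamma>1" "C1_off S2 \<gamma>2"
    using assms(1,2) unfolding piecewise_C1_path_iff by blast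
  let ?\<gamma> = "\<gamma>1 +++ \<gamma>2"
  let ?S = "{1/2} \<union> (\<lambda>t. (t + 0) / 2) ` S1 \<union> (\<lambda>t. (t + 1) / 2) ` S2"
  have "path ?\<gamma>"
    using assms by (intro path_join_imp) (auto simp: piecewise_C1_path_iff)
  moreover have "finite ?S" using S by auto
  moreover have "\<exists>D. continuous_on {a..b} D \<and>
      (\<forall>t\<in>{a..b}. (cmap c \<circ> ?\<gamma> has_vector_derivative D t) (at t within {a..b}))"
    if c: "c \<in> A" and ab: "0 \<le> a" "a < b" "b \<le> 1" "{a<..<b} \<inter> ?S = {}" and img: "?\<gamma> ` {a..b} \<subseteq> cdom c" for c a b
  proof -
    have "1/2 \<notin> {a<..<b}" using ab(4) by blast
    then consider "b \<le> 1/2" | "a \<ge> 1/2" by fastforce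
    then show ?thesis
    proof cases
      case 1
      have "(t + 0) / 2 \<notin> {a<..<b}" if "t \<in> S1" for t using ab(4) that by blast
      moreover have "?\<gamma> t = \<gamma>1 (2 * t - 0)" if "t \<in> {a..b}" for t
        using that 1 by (auto simp: joinpaths_def)
      ultimately show ?thesis
        using ab 1 by (intro C1_piece_reparam[OF C1(1) c _ _ _ _ _ img, of 0]) auto
    next
      case 2
      have "?\<gamma> t = \<gamma>2 (2 * t - 1)" if "t \<in> {a..b}" for t
      proof (cases "t = 1/2")
        case True
        show ?thesis using assms(3) unfolding True by (simp add: joinpaths_def pathfinish_def pathstart_def)
      next
        case False
        with that 2 show ?thesis by (auto simp: joinpaths_def)
      qed
      moreover have "(t + 1) / 2 \<notin> {a<..<b}" if "t \<in> S2" for t using ab(4) that by blast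
      ultimately show ?thesis
        using ab 2 by (intro C1_piece_reparam[OF C1(2) c _ _ _ _ _ img, of 1]) auto
    qed
  qed
  then have "C1_off ?S ?\<gamma>" unfolding C1_off_def by blast
  ultimately show ?thesis
    unfolding piecewise_C1_path_iff by (intro conjI exI[of _ ?S])
qed

definition joined :: "'m \<Rightarrow> 'm \<Rightarrow> bool" where
  "joined x y \<longleftrightarrow> (\<exists>\<gamma>. piecewise_C1_path A \<gamma> \<and> pathstart \<gamma> = x \<and> pathfinish \<gamma> = y)"

lemma joined_trans: "joined x y \<Longrightarrow> joined y z \<Longrightarrow> joined x z"
  unfolding joined_def using piecewise_C1_join by (metis pathfinish_join pathstart_join)

lemma joined_locally: "\<exists>U. open U \<and> p \<in> U \<and> (\<forall>q\<in>U. joined p q \<and> joined q p)"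
proof -
  obtain c where c: "c \<in> A" "p \<in> cdom c" using chart_exists by blast
  obtain r where r: "r > 0" "ball (cmap c p) r \<subseteq> cimg c"
    using open_cimg[OF c(1)] c(2) by (meson imageI open_contains_ball)
  let ?B = "ball (cmap c p) r"
  have seg: "joined (cinv c X) (cinv c Y)" if XY: "X \<in> ?B" "Y \<in> ?B" for X Y
  proof -
    have "X + t *\<^sub>R (Y - X) \<in> ?B" if "0 \<le> t" "t \<le> 1" for t
    proof -
      have "(1 - t) *\<^sub>R X + t *\<^sub>R Y \<in> ?B"
        using convexD_alt[OF convex_ball XY that] .
      then show ?thesis by (simp add: algebra_simps)
    qed
    then have "piecewise_C1_path A (\<lambda>t. cinv c (X + t *\<^sub>R (Y - X)))"
      using r(2) by (intro piecewise_C1_segment[OF c(1)]) auto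
    then show ?thesis
      unfolding joined_def
      by (intro exI[of _ "\<lambda>t. cinv c (X + t *\<^sub>R (Y - X))"]) (simp add: pathstart_def pathfinish_def)
  qed
  show ?thesis
  proof (intro exI conjI ballI)
    show "open (cinv c ` ?B)" using open_cinv_image[OF c(1) open_ball r(2)] .
    have p: "p = cinv c (cmap c p)" using cinv_cmap[OF c] by simp
    then show "p \<in> cinv c ` ?B" using r(1) by (intro image_eqI[of _ _ "cmap c p"]) auto
    fix q assume "q \<in> cinv c ` ?B"
    then obtain Y where "Y \<in> ?B" "q = cinv c Y" by blast
    then show "joined p q" "joined q p"
      using seg[of "cmap c p" Y] seg[of Y "cmap c p"] p r(1) by auto
  qed
qed

text \<open>The set of points that can be reached from \<open>x\<close> is open and closed. This
  makes the infimum in the definition of the distance one over a nonempty set.\<close>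

lemma joined_connected:
  assumes "connected (UNIV :: 'm set)"
  shows "joined x y"
proof -
  let ?R = "{y. joined x y}"
  obtain N where N: "\<And>p. open (N p) \<and> p \<in> N p \<and> (\<forall>q\<in>N p. joined p q \<and> joined q p)"
    using joined_locally by metis
  have "open ?R"
  proof (rule topological_space_class.openI)
    fix y assume "y \<in> ?R"
    then have "N y \<subseteq> ?R" using N[of y] joined_trans by auto
    then show "\<exists>T. open T \<and> y \<in> T \<and> T \<subseteq> ?R" using N[of y] by blast
  qed
  moreover have "open (- ?R)"
  proof (rule topological_space_class.openI)
    fix y assume "y \<in> - ?R"
    then have "N y \<subseteq> - ?R" using N[of y] joined_trans by auto
    then show "\<exists>T. open T \<and> y \<in> T \<and> T \<subseteq> - ?R" using N[of y] by blast
  qed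
  moreover have "\<forall>T :: 'm set. open T \<and> open (- T) \<longrightarrow> T = {} \<or> T = UNIV"
    using assms unfolding connected_clopen by (simp add: closed_def)
  ultimately have "?R = {} \<or> ?R = UNIV" by blast
  moreover have "x \<in> ?R"
  proof -
    have "joined x x" using N by blast
    then show ?thesis by simp
  qed
  ultimately show ?thesis by blast
qed

lemma continuous_metric_cdom:
  assumes c: "c \<in> A"
  shows "continuous_on (cdom c) (g c)"
proof -
  have "continuous_on (cdom c) (\<lambda>p. g c (cinv c (cmap c p)))"
    by (rule continuous_on_compose2[OF continuous_metric[OF c] continuous_cmap[OF c]]) simp
  then show ?thesis by (rule continuous_on_eq) (simp add: cinv_cmap c)
qed

text \<open>The velocity transforms with the Jacobian matrix \<open>J\<close> of the transition
  map, and the metric is pulled back by \<open>J\<close>, so the speed may be computed in any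
  chart around the point.\<close>

lemma speed_chart:
  assumes c: "c \<in> A" and V: "open V" "t \<in> V" "\<gamma> ` V \<subseteq> cdom c"
    and d: "(cmap c \<circ> \<gamma> has_vector_derivative d) (at t)"
  shows "speed A g \<gamma> t = sqrt (d \<bullet> (g c (\<gamma> t) *v d))"
proof -
  let ?c = "chart_at A (\<gamma> t)" and ?p = "\<gamma> t"
  let ?T = "cmap ?c \<circ> id \<circ> cinv c" and ?J = "jacobian_at c (chart_at A (\<gamma> t)) id (\<gamma> t)"
  have p: "?p \<in> cdom c" using V by blast
  have "(?T has_derivative (\<lambda>v. ?J *v v)) (at ((cmap c \<circ> \<gamma>) t))"
    using transition_has_derivative[OF smooth_id c chart_at(1) p] chart_at(2)[of ?p] by simp
  from diff_chain_at[OF d[unfolded has_vector_derivative_def] this]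
  have "(?T \<circ> (cmap c \<circ> \<gamma>) has_vector_derivative ?J *v d) (at t)"
    by (simp add: has_vector_derivative_def o_def matrix_vector_mult_scaleR)
  then have "(cmap ?c \<circ> \<gamma> has_vector_derivative ?J *v d) (at t)"
    by (rule has_vector_derivative_transform_within_open[OF _ V(1,2)]) (use V(3) c in \<open>auto simp: cinv_cmap\<close>)
  then have vd: "vector_derivative (cmap ?c \<circ> \<gamma>) (at t) = ?J *v d"
    by (rule vector_derivative_at)
  have "g c ?p = transpose ?J ** g ?c ?p ** ?J"
    using preserves_id[unfolded preserves_metric_def, rule_format, OF c chart_at(1), of ?p ?p]
      p chart_at(2)[of ?p] by simp
  then have "d \<bullet> (g c ?p *v d) = d \<bullet> (transpose ?J *v (g ?c ?p *v (?J *v d)))"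
    by (simp add: matrix_vector_mul_assoc matrix_mul_assoc)
  also have "\<dots> = (?J *v d) \<bullet> (g ?c ?p *v (?J *v d))"
    using inner_matrix_transpose[of d "transpose ?J" "g ?c ?p *v (?J *v d)"]
    by (simp only: transpose_transpose)
  finally show ?thesis
    by (simp add: speed_def Let_def vd)
qed

lemma speed_nonneg: "speed A g \<gamma> t \<ge> 0"
  using pos_def_nonneg[OF pos_def_metric[OF chart_at]] by (simp add: speed_def Let_def)

lemma path_len_nonneg: "path_len A g \<gamma> \<ge> 0"
  unfolding path_len_def using speed_nonneg
  by (cases "speed A g \<gamma> integrable_on {0..1}")
    (auto intro!: integral_nonneg simp: not_integrable_integral)

lemma rdist_nonneg:
  assumes "connected (UNIV :: 'm set)"
  shows "rdist A g x y \<ge> 0"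
  unfolding rdist_def using joined_connected[OF assms, of x y]
  by (intro cInf_greatest) (auto simp: joined_def path_len_nonneg)

text \<open>Away from the break points, a small interval around \<open>t\<close> is mapped into
  one chart, and the one-sided conditions on closed subintervals give an ordinary derivative in
  its interior.\<close>

lemma piecewise_C1_derivative:
  assumes "piecewise_C1_path A \<gamma>"
  shows "\<exists>S. finite S \<and> (\<forall>t\<in>{0<..<1} - S. \<exists>c V d. c \<in> A \<and> open V \<and> t \<in> V \<and> \<gamma> ` V \<subseteq> cdom c \<and>
     (cmap c \<circ> \<gamma> has_vector_derivative d) (at t))"
proof -
  obtain S where S: "finite S" and
    D: "C1_off S \<gamma>"
    and "path \<gamma>"
    using assms unfolding piecewise_C1_path_iff by blast
  show ?thesis
  proof (rule exI[of _ S], intro conjI ballI S)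
    fix t assume t: "t \<in> {0<..<1} - S"
    obtain c where c: "c \<in> A" "\<gamma> t \<in> cdom c" using chart_exists by blast
    have "continuous_on {0<..<1} \<gamma>"
      using \<open>path \<gamma>\<close> by (auto simp: path_def intro: continuous_on_subset)
    then have "open ({0<..<1} \<inter> \<gamma> -` cdom c)"
      using open_cdom[OF c(1)] by (intro continuous_open_preimage) auto
    then have "open ({0<..<1} \<inter> \<gamma> -` cdom c - S)"
      using S by (intro open_Diff finite_imp_closed)
    moreover have "t \<in> {0<..<1} \<inter> \<gamma> -` cdom c - S" using t c(2) by auto
    ultimately obtain e where e: "e > 0" "cball t e \<subseteq> {0<..<1} \<inter> \<gamma> -` cdom c - S"
      by (meson open_contains_cball)
    have ab: "cball t e = {t - e..t + e}" by (simp add: cball_eq_atLeastAtMost)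
    have "t - e \<in> cball t e" "t + e \<in> cball t e" using e(1) by (auto simp: ab)
    then have "t - e \<in> {0<..<1}" "t + e \<in> {0<..<1}" using e(2) by blast+
    then have "0 \<le> t - e" "t - e < t + e" "t + e \<le> 1" using e(1) by auto
    moreover have "{t - e<..<t + e} \<inter> S = {}" "\<gamma> ` {t - e..t + e} \<subseteq> cdom c"
      using e(2) unfolding ab by (auto simp: subset_iff)
    ultimately obtain D where "continuous_on {t - e..t + e} D" "\<And>s. s \<in> {t - e..t + e} \<Longrightarrow>
        (cmap c \<circ> \<gamma> has_vector_derivative D s) (at s within {t - e..t + e})"
      by (rule C1_offE[OF D c(1)]) blast
    then have "(cmap c \<circ> \<gamma> has_vector_derivative D t) (at t within {t - e..t + e})"
      using e(1) by auto
    then have "(cmap c \<circ> \<gamma> has_vector_derivative D t) (at t)"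
      using e(1) at_within_Icc_at[of "t - e" t "t + e"] by simp
    moreover have "\<gamma> ` {t - e<..<t + e} \<subseteq> cdom c"
      using e(2) unfolding ab by (auto simp: subset_iff)
    ultimately show "\<exists>c V d. c \<in> A \<and> open V \<and> t \<in> V \<and> \<gamma> ` V \<subseteq> cdom c \<and>
        (cmap c \<circ> \<gamma> has_vector_derivative d) (at t)"
      using c(1) e(1) by (intro exI[of _ c] exI[of _ "{t - e<..<t + e}"] exI[of _ "D t"]) auto
  qed
qed

lemma speed_integrable_piece:
  assumes c: "c \<in> A" and img: "\<gamma> ` {a..b} \<subseteq> cdom c" and cont: "continuous_on {a..b} \<gamma>"
    and D: "continuous_on {a..b} D" "\<And>t. t \<in> {a..b} \<Longrightarrow> (cmap c \<circ> \<gamma> has_vector_derivative D t) (at t within {a..b})"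
  shows "speed A g \<gamma> integrable_on {a..b}"
proof (rule integrable_spike_finite[of "{a, b}"])
  have "continuous_on {a..b} (\<lambda>t. g c (\<gamma> t))"
    by (rule continuous_on_compose2[OF continuous_metric_cdom[OF c] cont img])
  then have "continuous_on {a..b} (\<lambda>t. g c (\<gamma> t) *v D t)"
    unfolding matrix_vector_mult_def
    by (intro continuous_on_vec_lambda continuous_on_sum continuous_on_mult continuous_on_component D(1))
  then show "(\<lambda>t. sqrt (D t \<bullet> (g c (\<gamma> t) *v D t))) integrable_on {a..b}"
    by (intro integrable_continuous_interval continuous_on_real_sqrt continuous_on_inner D(1))
  fix t assume t: "t \<in> {a..b} - {a, b}"
  then have "(cmap c \<circ> \<gamma> has_vector_derivative D t) (at t)"
    using D(2)[of t] at_within_Icc_at[of a t b] by auto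
  then show "speed A g \<gamma> t = sqrt (D t \<bullet> (g c (\<gamma> t) *v D t))"
    using t img by (intro speed_chart[OF c, of "{a<..<b}"]) auto
qed simp

text \<open>The integral in \<open>path_len\<close> has the default value \<open>0\<close> for
  speeds that are not integrable, so integrability is what lets a path length bound anything
  from above. Locally the speed is continuous up to finitely many points, and local
  integrability on a compact interval suffices.\<close>

lemma speed_integrable:
  assumes "piecewise_C1_path A \<gamma>"
  shows "speed A g \<gamma> integrable_on {0..1}"
proof -
  obtain S where S: "finite S" and
    D: "C1_off S \<gamma>"
    and \<gamma>: "continuous_on {0..1} \<gamma>"
    using assms unfolding piecewise_C1_path_iff path_def by blast
  have piece: "speed A g \<gamma> integrable_on {a..b}"
    if sub: "c \<in> A" "0 \<le> a" "b \<le> 1" "{a<..<b} \<inter> S = {}" "\<gamma> ` {a..b} \<subseteq> cdom c" for c a b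
  proof (cases "a < b")
    case True
    obtain D where "continuous_on {a..b} D"
      "\<And>t. t \<in> {a..b} \<Longrightarrow> (cmap c \<circ> \<gamma> has_vector_derivative D t) (at t within {a..b})"
      by (rule C1_offE[OF D sub(1,2) True sub(3-5)]) blast
    then show ?thesis
      using sub continuous_on_subset[OF \<gamma>, of "{a..b}"] by (intro speed_integrable_piece) auto
  next
    case False
    then show ?thesis
      using integrable_on_refl[of "speed A g \<gamma>" a] by (cases "a = b") auto
  qed
  have "\<exists>d>0. \<forall>u v. x \<in> cbox u v \<and> cbox u v \<subseteq> ball x d \<and> cbox u v \<subseteq> cbox 0 1 \<longrightarrow>
      speed A g \<gamma> integrable_on cbox u v" if x: "x \<in> cbox 0 1" for x
  proof -
    obtain c where c: "c \<in> A" "\<gamma> x \<in> cdom c" using chart_exists by blast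
    obtain W where W: "open W" "W \<inter> {0..1} = \<gamma> -` cdom c \<inter> {0..1}"
      using continuous_on_open_invariant[THEN iffD1, OF \<gamma>, rule_format, OF open_cdom[OF c(1)]] by blast
    \<comment> \<open>The neighbourhood may contain \<open>x\<close> itself as a break point, at
      which the interval is then split.\<close>
    have "open (W - (S - {x}))" using W(1) S by (intro open_Diff finite_imp_closed) auto
    moreover have "x \<in> W - (S - {x})" using W(2) x c(2) by auto
    ultimately obtain d where d: "d > 0" "ball x d \<subseteq> W - (S - {x})"
      by (meson open_contains_ball)
    have "speed A g \<gamma> integrable_on cbox u v"
      if uv: "x \<in> cbox u v" "cbox u v \<subseteq> ball x d" "cbox u v \<subseteq> cbox 0 1" for u v
    proof -
      have le: "u \<le> x" "x \<le> v" using uv(1) by auto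
      then have bd: "0 \<le> u" "v \<le> 1" using uv(3) by auto
      have sub: "{u..v} \<subseteq> W - (S - {x})" using uv(2) d(2) by auto
      have img: "\<gamma> t \<in> cdom c" if "t \<in> {u..v}" for t
      proof -
        have "t \<in> W \<inter> {0..1}" using that sub bd by auto
        then show ?thesis using W(2) by auto
      qed
      have noS: "t \<notin> S" if "t \<in> {u..v}" "t \<noteq> x" for t using that sub by auto
      have "speed A g \<gamma> integrable_on {u..x}"
        using le bd img noS by (intro piece[OF c(1)]) force+
      moreover have "speed A g \<gamma> integrable_on {x..v}"
        using le bd img noS by (intro piece[OF c(1)]) force+
      ultimately show ?thesis
        using le by (auto intro: Henstock_Kurzweil_Integration.integrable_combine)
    qed
    then show ?thesis using d(1) by blast
  qed
  then have "speed A g \<gamma> integrable_on cbox 0 1"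
    by (intro integrable_on_little_subintervals) blast
  then show ?thesis by simp
qed

end

section \<open>Maps into a sphere and the Riemannian distance\<close>

lemma sum_inner_Cauchy_Schwarz:
  fixes x y :: "'i \<Rightarrow> 'a::real_inner"
  shows "\<bar>\<Sum>j\<in>I. x j \<bullet> y j\<bar> \<le> sqrt (\<Sum>j\<in>I. (norm (x j))\<^sup>2) * sqrt (\<Sum>j\<in>I. (norm (y j))\<^sup>2)"
proof -
  have "\<bar>\<Sum>j\<in>I. x j \<bullet> y j\<bar> \<le> (\<Sum>j\<in>I. \<bar>x j \<bullet> y j\<bar>)" by (rule sum_abs)
  also have "\<dots> \<le> (\<Sum>j\<in>I. \<bar>norm (x j)\<bar> * \<bar>norm (y j)\<bar>)"
    by (intro sum_mono) (simp add: Cauchy_Schwarz_ineq2)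
  also have "\<dots> \<le> L2_set (\<lambda>j. norm (x j)) I * L2_set (\<lambda>j. norm (y j)) I"
    by (rule L2_set_mult_ineq)
  finally show ?thesis by (simp add: L2_set_def)
qed

text \<open>A vector \<open>\<delta>\<close> tangent to the sphere at \<open>a\<close> pairs
  with \<open>b\<close> in the same way as with \<open>b - h a\<close>, the component of
  \<open>b\<close> orthogonal to \<open>a\<close>, whose length is the radius times the sine of
  the angle with cosine \<open>h\<close>.\<close>

lemma tangential_Cauchy_Schwarz:
  fixes a b \<delta> :: "'i \<Rightarrow> 'a::real_inner"
  assumes a: "(\<Sum>j\<in>I. (norm (a j))\<^sup>2) = k" and b: "(\<Sum>j\<in>I. (norm (b j))\<^sup>2) = k"
    and orth: "(\<Sum>j\<in>I. \<delta> j \<bullet> a j) = 0" and k: "k > 0"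
  defines "h \<equiv> (\<Sum>j\<in>I. a j \<bullet> b j) / k"
  shows "\<bar>\<Sum>j\<in>I. \<delta> j \<bullet> b j\<bar> \<le> sqrt (\<Sum>j\<in>I. (norm (\<delta> j))\<^sup>2) * sqrt (k * (1 - h\<^sup>2))"
proof -
  have "(\<Sum>j\<in>I. \<delta> j \<bullet> (b j - h *\<^sub>R a j)) = (\<Sum>j\<in>I. \<delta> j \<bullet> b j) - h * (\<Sum>j\<in>I. \<delta> j \<bullet> a j)"
    by (simp add: inner_diff_right sum_subtractf sum_distrib_left)
  then have 1: "(\<Sum>j\<in>I. \<delta> j \<bullet> b j) = (\<Sum>j\<in>I. \<delta> j \<bullet> (b j - h *\<^sub>R a j))"
    using orth by simp
  have "(norm (b j - h *\<^sub>R a j))\<^sup>2 = (norm (b j))\<^sup>2 - 2 * h * (a j \<bullet> b j) + h\<^sup>2 * (norm (a j))\<^sup>2" for j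
    unfolding power2_norm_eq_inner
    by (simp add: inner_diff_left inner_diff_right inner_commute power2_eq_square algebra_simps)
  then have "(\<Sum>j\<in>I. (norm (b j - h *\<^sub>R a j))\<^sup>2) =
      (\<Sum>j\<in>I. (norm (b j))\<^sup>2) - 2 * h * (\<Sum>j\<in>I. a j \<bullet> b j) + h\<^sup>2 * (\<Sum>j\<in>I. (norm (a j))\<^sup>2)"
    by (simp add: sum.distrib sum_subtractf sum_distrib_left)
  also have "(\<Sum>j\<in>I. a j \<bullet> b j) = h * k" using k by (simp add: h_def)
  finally have "(\<Sum>j\<in>I. (norm (b j - h *\<^sub>R a j))\<^sup>2) = k * (1 - h\<^sup>2)"
    using a b by (simp add: power2_eq_square algebra_simps)
  then show ?thesis
    unfolding 1 using sum_inner_Cauchy_Schwarz[of \<delta> "\<lambda>j. b j - h *\<^sub>R a j" I] by simp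
qed

lemma has_vector_derivative_inner_self:
  fixes f :: "real \<Rightarrow> 'a::real_inner"
  assumes "(f has_vector_derivative d) (at t)"
  shows "((\<lambda>s. f s \<bullet> f s) has_vector_derivative 2 * (d \<bullet> f t)) (at t)"
proof -
  have "((\<lambda>s. f s \<bullet> f s) has_derivative (\<lambda>h. f t \<bullet> (h *\<^sub>R d) + (h *\<^sub>R d) \<bullet> f t)) (at t)"
    using assms unfolding has_vector_derivative_def by (intro has_derivative_inner)
  then show ?thesis
    by (simp add: has_vector_derivative_def inner_commute algebra_simps)
qed

text \<open>If the vectors \<open>(\<phi> j x)\<^sub>j\<close> lie on the sphere of radius
  \<open>sqrt k\<close>, this is the cosine of the angle between the vectors at \<open>x\<close>
  and \<open>y\<close>, for the real inner product.\<close>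

definition correlation :: "'i set \<Rightarrow> ('i \<Rightarrow> 'm \<Rightarrow> complex) \<Rightarrow> real \<Rightarrow> 'm \<Rightarrow> 'm \<Rightarrow> real" where
  "correlation I \<phi> k x y = (\<Sum>j\<in>I. \<phi> j y \<bullet> \<phi> j x) / k"

context riem
begin

context
  fixes I :: "'i set" and \<phi> :: "'i \<Rightarrow> 'm \<Rightarrow> complex" and k L :: real
  assumes smooth: "\<And>j. j \<in> I \<Longrightarrow> smooth_fun A (\<phi> j)"
    and k: "k > 0" and L: "L \<ge> 0"
    and sphere: "\<And>p. (\<Sum>j\<in>I. (cmod (\<phi> j p))\<^sup>2) = k"
    and energy: "\<And>p. (\<Sum>j\<in>I. grad_sq (\<phi> j) p) \<le> L * k"
begin

lemma correlation_le_1: "\<bar>correlation I \<phi> k x y\<bar> \<le> 1"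
  using sum_inner_Cauchy_Schwarz[of "\<lambda>j. \<phi> j y" "\<lambda>j. \<phi> j x" I] k
  by (simp add: correlation_def sphere)

lemma correlation_refl: "correlation I \<phi> k x x = 1"
  using k sphere[of x] by (simp add: correlation_def power2_norm_eq_inner)

lemma smooth_along_path:
  assumes c: "c \<in> A" and V: "open V" "t \<in> V" "\<gamma> ` V \<subseteq> cdom c"
    and d: "(cmap c \<circ> \<gamma> has_vector_derivative d) (at t)" and u: "smooth_fun A u"
  shows "((\<lambda>s. u (\<gamma> s)) has_vector_derivative differential c u (\<gamma> t) d) (at t)"
proof -
  have p: "\<gamma> t \<in> cdom c" using V by blast
  have "((u \<circ> cinv c) has_derivative differential c u (\<gamma> t)) (at ((cmap c \<circ> \<gamma>) t))"
    using differential_works[OF c p u] by simp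
  from diff_chain_at[OF d[unfolded has_vector_derivative_def] this]
  have "((u \<circ> cinv c) \<circ> (cmap c \<circ> \<gamma>) has_derivative differential c u (\<gamma> t) \<circ> (\<lambda>s. s *\<^sub>R d)) (at t)" .
  moreover have "differential c u (\<gamma> t) \<circ> (\<lambda>s. s *\<^sub>R d) = (\<lambda>s. s *\<^sub>R differential c u (\<gamma> t) d)"
    by (rule ext) (simp only: o_apply linear_scale[OF linear_differential[OF c p u]])
  ultimately have "((u \<circ> cinv c) \<circ> (cmap c \<circ> \<gamma>) has_vector_derivative differential c u (\<gamma> t) d) (at t)"
    by (simp only: has_vector_derivative_def)
  then show ?thesis
    by (rule has_vector_derivative_transform_within_open[OF _ V(1,2)]) (use V(3) c in \<open>auto simp: cinv_cmap\<close>)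
qed

text \<open>The velocity of the image curve is tangent to the sphere and has length at most
  \<open>sqrt (L * k)\<close> times the speed of the path. In terms of the angle, whose cosine
  is the correlation, the estimate says that the angle changes at a rate of at most \<open>sqrt
  L\<close> times the speed.\<close>

lemma correlation_derivative:
  assumes c: "c \<in> A" and V: "open V" "t \<in> V" "\<gamma> ` V \<subseteq> cdom c"
    and d: "(cmap c \<circ> \<gamma> has_vector_derivative d) (at t)"
  shows "\<exists>h'. ((\<lambda>s. correlation I \<phi> k x (\<gamma> s)) has_real_derivative h') (at t) \<and>
    \<bar>h'\<bar> \<le> sqrt L * speed A g \<gamma> t * sqrt (1 - (correlation I \<phi> k x (\<gamma> t))\<^sup>2)"
proof -
  define \<delta> where "\<delta> j = differential c (\<phi> j) (\<gamma> t) d" for j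
  have p: "\<gamma> t \<in> cdom c" using V by blast
  have D: "((\<lambda>s. \<phi> j (\<gamma> s)) has_vector_derivative \<delta> j) (at t)" if "j \<in> I" for j
    unfolding \<delta>_def by (rule smooth_along_path[OF c V d smooth[OF that]])
  have "((\<lambda>s. \<Sum>j\<in>I. \<phi> j (\<gamma> s) \<bullet> \<phi> j (\<gamma> s)) has_vector_derivative (\<Sum>j\<in>I. 2 * (\<delta> j \<bullet> \<phi> j (\<gamma> t)))) (at t)"
    by (intro has_vector_derivative_sum has_vector_derivative_inner_self D)
  moreover have "(\<Sum>j\<in>I. \<phi> j (\<gamma> s) \<bullet> \<phi> j (\<gamma> s)) = k" for s
    using sphere[of "\<gamma> s"] by (simp add: power2_norm_eq_inner)
  ultimately have "((\<lambda>s. k) has_vector_derivative (\<Sum>j\<in>I. 2 * (\<delta> j \<bullet> \<phi> j (\<gamma> t)))) (at t)"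
    by simp
  then have "(\<Sum>j\<in>I. 2 * (\<delta> j \<bullet> \<phi> j (\<gamma> t))) = 0"
    using has_vector_derivative_const vector_derivative_unique_at by blast
  then have orth: "(\<Sum>j\<in>I. \<delta> j \<bullet> \<phi> j (\<gamma> t)) = 0"
    by (simp add: sum_distrib_left[symmetric])
  have sp: "(speed A g \<gamma> t)\<^sup>2 = d \<bullet> (g c (\<gamma> t) *v d)"
    using speed_chart[OF c V d] pos_def_nonneg[OF pos_def_metric[OF c p]] by simp
  have "(\<Sum>j\<in>I. (norm (\<delta> j))\<^sup>2) \<le> (\<Sum>j\<in>I. grad_sq (\<phi> j) (\<gamma> t) * (speed A g \<gamma> t)\<^sup>2)"
    unfolding sp \<delta>_def by (intro sum_mono differential_Cauchy_Schwarz smooth c p)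
  also have "\<dots> \<le> L * k * (speed A g \<gamma> t)\<^sup>2"
    using energy[of "\<gamma> t"] by (simp add: sum_distrib_right[symmetric] mult_right_mono)
  finally have \<delta>: "sqrt (\<Sum>j\<in>I. (norm (\<delta> j))\<^sup>2) \<le> sqrt (L * k * (speed A g \<gamma> t)\<^sup>2)"
    by (rule real_sqrt_le_mono)
  have "\<bar>\<Sum>j\<in>I. \<delta> j \<bullet> \<phi> j x\<bar> \<le>
      sqrt (\<Sum>j\<in>I. (norm (\<delta> j))\<^sup>2) * sqrt (k * (1 - (correlation I \<phi> k x (\<gamma> t))\<^sup>2))"
    unfolding correlation_def by (rule tangential_Cauchy_Schwarz[OF sphere sphere orth k])
  also have "\<dots> \<le> sqrt (L * k * (speed A g \<gamma> t)\<^sup>2) * sqrt (k * (1 - (correlation I \<phi> k x (\<gamma> t))\<^sup>2))"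
  proof (rule mult_right_mono[OF \<delta>])
    have "(correlation I \<phi> k x (\<gamma> t))\<^sup>2 \<le> 1"
      using correlation_le_1[of x "\<gamma> t"] by (simp add: abs_square_le_1)
    then show "0 \<le> sqrt (k * (1 - (correlation I \<phi> k x (\<gamma> t))\<^sup>2))" using k by simp
  qed
  also have "\<dots> = k * (sqrt L * speed A g \<gamma> t * sqrt (1 - (correlation I \<phi> k x (\<gamma> t))\<^sup>2))"
  proof -
    have "sqrt k * sqrt k = k" using k by simp
    then show ?thesis
      using speed_nonneg[of \<gamma> t] by (simp add: real_sqrt_mult mult_ac)
  qed
  finally have bound: "\<bar>(\<Sum>j\<in>I. \<delta> j \<bullet> \<phi> j x) / k\<bar> \<le> sqrt L * speed A g \<gamma> t * sqrt (1 - (correlation I \<phi> k x (\<gamma> t))\<^sup>2)"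
    using k by (simp add: abs_divide pos_divide_le_eq mult.commute)
  have "((\<lambda>s. \<Sum>j\<in>I. \<phi> j (\<gamma> s) \<bullet> \<phi> j x) has_vector_derivative (\<Sum>j\<in>I. \<delta> j \<bullet> \<phi> j x)) (at t)"
    by (intro has_vector_derivative_sum bounded_linear.has_vector_derivative[OF bounded_linear_inner_left] D)
  then have "((\<lambda>s. correlation I \<phi> k x (\<gamma> s)) has_real_derivative (\<Sum>j\<in>I. \<delta> j \<bullet> \<phi> j x) / k) (at t)"
    unfolding correlation_def has_real_derivative_iff_has_vector_derivative[symmetric]
    by (rule DERIV_cdivide)
  then show ?thesis using bound by blast
qed

text \<open>The angle is not differentiable where the correlation is \<open>1\<close> or
  \<open>-1\<close>, which happens at the start of the path in any case. Multiplying the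
  correlation by \<open>1 - \<epsilon>\<close> moves it into the open interval; the bound on the
  derivative survives since \<open>(1 - \<epsilon>) * sqrt (1 - h\<^sup>2) \<le> sqrt (1 - ((1 -
  \<epsilon>) * h)\<^sup>2)\<close>.\<close>

lemma arccos_correlation_increment:
  assumes \<gamma>: "piecewise_C1_path A \<gamma>" and \<epsilon>: "0 < \<epsilon>" "\<epsilon> < 1"
  shows "arccos ((1 - \<epsilon>) * correlation I \<phi> k (pathstart \<gamma>) (pathfinish \<gamma>)) - arccos (1 - \<epsilon>)
    \<le> sqrt L * path_len A g \<gamma>"
proof -
  define h where "h s = correlation I \<phi> k (pathstart \<gamma>) (\<gamma> s)" for s
  define F where "F s = arccos ((1 - \<epsilon>) * h s)" for s
  have h1: "\<bar>h s\<bar> \<le> 1" for s unfolding h_def by (rule correlation_le_1)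
  have eh: "\<bar>(1 - \<epsilon>) * h s\<bar> < 1" for s
  proof -
    have "\<bar>(1 - \<epsilon>) * h s\<bar> \<le> (1 - \<epsilon>) * 1"
      unfolding abs_mult using h1[of s] \<epsilon> by (intro mult_mono) auto
    then show ?thesis using \<epsilon> by simp
  qed
  have "path \<gamma>" using \<gamma> by (simp add: piecewise_C1_path_iff)
  then have "continuous_on {0..1} (\<lambda>s. \<phi> j (\<gamma> s))" if "j \<in> I" for j
    using continuous_on_compose2[OF smooth_fun_continuous[OF smooth[OF that]], of "{0..1}" \<gamma>]
    by (simp add: path_def)
  then have "continuous_on {0..1} h"
    unfolding h_def correlation_def using k by (intro continuous_intros) auto
  then have F_cont: "continuous_on {0..1} F"
    unfolding F_def using eh by (intro continuous_on_arccos continuous_intros) (auto simp: abs_less_iff less_imp_le)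
  obtain S where S: "finite S" and
    good: "\<forall>t\<in>{0<..<1} - S. \<exists>c V d. c \<in> A \<and> open V \<and> t \<in> V \<and> \<gamma> ` V \<subseteq> cdom c \<and>
     (cmap c \<circ> \<gamma> has_vector_derivative d) (at t)"
    using piecewise_C1_derivative[OF \<gamma>] by blast
  have "\<exists>F'. (F has_vector_derivative F') (at t) \<and> F' \<le> sqrt L * speed A g \<gamma> t" if t: "t \<in> {0<..<1} - S" for t
  proof -
    obtain c V d where "c \<in> A" "open V" "t \<in> V" "\<gamma> ` V \<subseteq> cdom c" "(cmap c \<circ> \<gamma> has_vector_derivative d) (at t)"
      using good t by blast
    from correlation_derivative[OF this, of "pathstart \<gamma>", folded h_def] obtain h' where
      h': "(h has_real_derivative h') (at t)" "\<bar>h'\<bar> \<le> sqrt L * speed A g \<gamma> t * sqrt (1 - (h t)\<^sup>2)"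
      by (auto simp: h_def[abs_def])
    define q where "q = sqrt (1 - ((1 - \<epsilon>) * h t)\<^sup>2)"
    have q: "q > 0" unfolding q_def using eh[of t] by (simp add: abs_square_less_1)
    have "((\<lambda>s. (1 - \<epsilon>) * h s) has_real_derivative (1 - \<epsilon>) * h') (at t)"
      by (rule DERIV_cmult[OF h'(1)])
    moreover have "DERIV arccos ((1 - \<epsilon>) * h t) :> inverse (- q)"
      unfolding q_def using eh[of t] by (intro DERIV_arccos) (auto simp: abs_less_iff)
    ultimately have "(F has_real_derivative inverse (- q) * ((1 - \<epsilon>) * h')) (at t)"
      unfolding F_def by (rule DERIV_chain2[rotated])
    moreover have "inverse (- q) * ((1 - \<epsilon>) * h') \<le> sqrt L * speed A g \<gamma> t"
    proof -
      have le: "(1 - \<epsilon>) * sqrt (1 - (h t)\<^sup>2) \<le> q"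
      proof -
        have "(1 - \<epsilon>) * sqrt (1 - (h t)\<^sup>2) = sqrt ((1 - \<epsilon>)\<^sup>2 * (1 - (h t)\<^sup>2))"
          using \<epsilon> by (simp add: real_sqrt_mult)
        also have "\<dots> \<le> q"
          unfolding q_def
        proof (rule real_sqrt_le_mono)
          have "(1 - \<epsilon>)\<^sup>2 \<le> 1" using \<epsilon> by (intro power_le_one) auto
          moreover have "(1 - \<epsilon>)\<^sup>2 * (1 - (h t)\<^sup>2) = (1 - \<epsilon>)\<^sup>2 - ((1 - \<epsilon>) * h t)\<^sup>2"
            by (simp only: power_mult_distrib right_diff_distrib mult_1_right)
          ultimately show "(1 - \<epsilon>)\<^sup>2 * (1 - (h t)\<^sup>2) \<le> 1 - ((1 - \<epsilon>) * h t)\<^sup>2" by linarith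
        qed
        finally show ?thesis .
      qed
      have "- ((1 - \<epsilon>) * h') \<le> (1 - \<epsilon>) * \<bar>h'\<bar>"
        using \<epsilon> mult_left_mono[of "- h'" "\<bar>h'\<bar>" "1 - \<epsilon>"] by simp
      also have "\<dots> \<le> (1 - \<epsilon>) * (sqrt L * speed A g \<gamma> t * sqrt (1 - (h t)\<^sup>2))"
        using h'(2) \<epsilon> by (intro mult_left_mono) auto
      also have "\<dots> = sqrt L * speed A g \<gamma> t * ((1 - \<epsilon>) * sqrt (1 - (h t)\<^sup>2))" by (simp add: mult_ac)
      also have "\<dots> \<le> sqrt L * speed A g \<gamma> t * q"
        using le speed_nonneg[of \<gamma> t] L by (intro mult_left_mono) auto
      finally have "- ((1 - \<epsilon>) * h') \<le> sqrt L * speed A g \<gamma> t * q" .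
      then have "(- ((1 - \<epsilon>) * h')) / q \<le> sqrt L * speed A g \<gamma> t"
        by (rule iffD2[OF pos_divide_le_eq[OF q]])
      moreover have "inverse (- q) * ((1 - \<epsilon>) * h') = (- ((1 - \<epsilon>) * h')) / q"
        by (simp add: divide_inverse)
      ultimately show ?thesis by (simp only:)
    qed
    ultimately show ?thesis
      unfolding has_real_derivative_iff_has_vector_derivative by blast
  qed
  then obtain F' where F': "\<And>t. t \<in> {0<..<1} - S \<Longrightarrow> (F has_vector_derivative F' t) (at t) \<and> F' t \<le> sqrt L * speed A g \<gamma> t"
    by metis
  \<comment> \<open>At the finitely many exceptional points any value will do; the upper bound
    itself is taken there.\<close>
  let ?F' = "\<lambda>t. if t \<in> {0<..<1} - S then F' t else sqrt L * speed A g \<gamma> t"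
  have "(?F' has_integral (F 1 - F 0)) {0..1}"
    by (rule fundamental_theorem_of_calculus_interior_strong[OF S _ _ F_cont]) (use F' in auto)
  moreover have "((\<lambda>t. sqrt L * speed A g \<gamma> t) has_integral sqrt L * path_len A g \<gamma>) {0..1}"
    unfolding path_len_def using speed_integrable[OF \<gamma>]
    by (intro has_integral_mult_right integrable_integral)
  ultimately have "F 1 - F 0 \<le> sqrt L * path_len A g \<gamma>"
    by (rule has_integral_le) (use F' in auto)
  then show ?thesis
    by (simp add: F_def h_def correlation_refl pathstart_def pathfinish_def)
qed

text \<open>The limit \<open>\<epsilon> \<rightarrow> 0\<close> of the preceding
  estimate.\<close>

lemma arccos_correlation_le_path_len:
  assumes \<gamma>: "piecewise_C1_path A \<gamma>"
  shows "arccos (correlation I \<phi> k (pathstart \<gamma>) (pathfinish \<gamma>)) \<le> sqrt L * path_len A g \<gamma>"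
proof -
  let ?h = "correlation I \<phi> k (pathstart \<gamma>) (pathfinish \<gamma>)"
  define e :: "nat \<Rightarrow> real" where "e n = 1 - inverse (real (Suc (Suc n)))" for n
  have e01: "0 < inverse (real (Suc (Suc n)))" "inverse (real (Suc (Suc n))) < 1" for n
    by (auto simp: field_simps)
  have le: "arccos (e n * ?h) - arccos (e n) \<le> sqrt L * path_len A g \<gamma>" for n
    using arccos_correlation_increment[OF \<gamma> e01] unfolding e_def .
  have "(\<lambda>n. inverse (real (Suc (Suc n)))) \<longlonglongrightarrow> 0"
    using LIMSEQ_inverse_real_of_nat LIMSEQ_Suc by blast
  from tendsto_diff[OF tendsto_const[of 1] this] have e: "e \<longlonglongrightarrow> 1"
    by (simp add: e_def[abs_def])
  have h1: "\<bar>?h\<bar> \<le> 1" by (rule correlation_le_1)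
  have eh: "\<bar>e n * ?h\<bar> \<le> 1" "\<bar>e n\<bar> \<le> 1" for n
  proof -
    show "\<bar>e n\<bar> \<le> 1" using e01[of n] by (simp add: e_def)
    then show "\<bar>e n * ?h\<bar> \<le> 1" unfolding abs_mult using h1 by (simp add: mult_le_one)
  qed
  have lim: "(\<lambda>n. arccos (x n)) \<longlonglongrightarrow> arccos y" if "x \<longlonglongrightarrow> y" "\<And>n. \<bar>x n\<bar> \<le> 1" "\<bar>y\<bar> \<le> 1" for x y
    using that by (intro continuous_on_tendsto_compose[OF continuous_on_arccos'])
      (auto simp: abs_le_iff minus_le_iff intro!: always_eventually)
  have "(\<lambda>n. e n * ?h) \<longlonglongrightarrow> ?h" using tendsto_mult[OF e tendsto_const[of ?h]] by simp
  from tendsto_diff[OF lim[OF this eh(1) h1] lim[OF e eh(2)]]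
  have "(\<lambda>n. arccos (e n * ?h) - arccos (e n)) \<longlonglongrightarrow> arccos ?h - arccos 1" by simp
  then have "arccos ?h - arccos 1 \<le> sqrt L * path_len A g \<gamma>"
    by (rule LIMSEQ_le_const2) (use le in blast)
  then show ?thesis by simp
qed

text \<open>The distance dominates the angle of the image points up to the factor \<open>sqrt
  L\<close>, since every path does; the cosine is decreasing on the interval from
  \<open>0\<close> to \<open>pi\<close>.\<close>

theorem cos_rdist_le_correlation:
  assumes conn: "connected (UNIV :: 'm set)" and le: "sqrt L * rdist A g x y \<le> pi"
  shows "cos (sqrt L * rdist A g x y) \<le> correlation I \<phi> k x y"
proof -
  let ?P = "{path_len A g \<gamma> | \<gamma>. piecewise_C1_path A \<gamma> \<and> pathstart \<gamma> = x \<and> pathfinish \<gamma> = y}"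
  have ne: "?P \<noteq> {}" using joined_connected[OF conn, of x y] by (auto simp: joined_def)
  have h1: "-1 \<le> correlation I \<phi> k x y" "correlation I \<phi> k x y \<le> 1" using correlation_le_1[of x y] by (simp_all add: abs_le_iff)
  have a0: "arccos (correlation I \<phi> k x y) \<ge> 0" using h1 by (rule arccos_lbound)
  have "arccos (correlation I \<phi> k x y) \<le> sqrt L * rdist A g x y"
  \<comment> \<open>The factor \<open>sqrt L\<close> is divided out to pass to the infimum, so
    the case \<open>L = 0\<close> is settled with a single path.\<close>
  proof (cases "L = 0")
    case True
    obtain \<gamma> where "piecewise_C1_path A \<gamma>" "pathstart \<gamma> = x" "pathfinish \<gamma> = y"
      using ne by blast
    then show ?thesis using arccos_correlation_le_path_len[of \<gamma>] True by simp
  next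
    case False
    then have sL: "sqrt L > 0" using L by simp
    have "arccos (correlation I \<phi> k x y) / sqrt L \<le> rdist A g x y"
      unfolding rdist_def
    proof (rule cInf_greatest[OF ne])
      fix l assume "l \<in> ?P"
      then show "arccos (correlation I \<phi> k x y) / sqrt L \<le> l"
        using arccos_correlation_le_path_len sL by (auto simp: pos_divide_le_eq mult.commute)
    qed
    then show ?thesis using sL by (simp add: pos_divide_le_eq mult.commute)
  qed
  then have "cos (sqrt L * rdist A g x y) \<le> cos (arccos (correlation I \<phi> k x y))"
    using a0 le by (intro cos_monotone_0_pi_le) auto
  then show ?thesis using h1 by simp
qed

end

end

section \<open>A Poincare inequality on convex sets\<close>

text \<open>The increment \<open>\<Delta>\<close> satisfies \<open>\<Delta> \<bullet> D t \<le>
  (norm \<Delta>)\<^sup>2 + (norm (D t))\<^sup>2 / 4\<close>. Integrated over an interval of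
  length \<open>1 / 2\<close>, the left-hand side becomes \<open>(norm \<Delta>)\<^sup>2\<close>
  and the first term on the right half of it.\<close>

lemma half_segment_estimate:
  fixes \<psi> :: "real \<Rightarrow> complex"
  assumes D: "\<And>t. t \<in> {0..1/2} \<Longrightarrow> (\<psi> has_vector_derivative D t) (at t within {0..1/2})"
    and le: "\<And>t. t \<in> {0..1/2} \<Longrightarrow> (norm (D t))\<^sup>2 \<le> q t"
    and q: "continuous_on {0..1/2} q"
  shows "(norm (\<psi> (1/2) - \<psi> 0))\<^sup>2 \<le> integral {0..1/2} q / 2"
proof -
  define \<Delta> where "\<Delta> = \<psi> (1/2) - \<psi> 0"
  have "((\<lambda>t. \<Delta> \<bullet> D t) has_integral (\<Delta> \<bullet> \<psi> (1/2) - \<Delta> \<bullet> \<psi> 0)) {0..1/2}"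
    using D by (intro fundamental_theorem_of_calculus
        bounded_linear.has_vector_derivative[OF bounded_linear_inner_right]) auto
  moreover have "((\<lambda>t. (norm \<Delta>)\<^sup>2 + q t / 4) has_integral ((norm \<Delta>)\<^sup>2 * (1/2) + integral {0..1/2} q / 4)) {0..1/2}"
    using has_integral_const_real[of "(norm \<Delta>)\<^sup>2" 0 "1/2"]
    by (intro has_integral_add has_integral_divide integrable_integral integrable_continuous_interval q)
      (simp add: mult.commute)
  moreover have "\<Delta> \<bullet> D t \<le> (norm \<Delta>)\<^sup>2 + q t / 4" if "t \<in> {0..1/2}" for t
  proof -
    have "\<Delta> \<bullet> D t \<le> norm \<Delta> * norm (D t)" by (rule norm_cauchy_schwarz)
    also have "\<dots> \<le> (norm \<Delta>)\<^sup>2 + (norm (D t))\<^sup>2 / 4"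
      using zero_le_power2[of "norm \<Delta> - norm (D t) / 2"]
      by (simp add: power2_diff power_divide)
    also have "\<dots> \<le> (norm \<Delta>)\<^sup>2 + q t / 4" using le[OF that] by simp
    finally show ?thesis .
  qed
  ultimately have "\<Delta> \<bullet> \<psi> (1/2) - \<Delta> \<bullet> \<psi> 0 \<le> (norm \<Delta>)\<^sup>2 * (1/2) + integral {0..1/2} q / 4"
    by (rule has_integral_le)
  moreover have "\<Delta> \<bullet> \<psi> (1/2) - \<Delta> \<bullet> \<psi> 0 = (norm \<Delta>)\<^sup>2"
    by (simp add: \<Delta>_def power2_norm_eq_inner inner_diff_right)
  ultimately show ?thesis by (simp add: \<Delta>_def)
qed

lemma nn_integral_lborel_scale:
  fixes G :: "'a::euclidean_space \<Rightarrow> ennreal"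
  assumes G: "G \<in> borel_measurable borel" and c: "c \<ge> 1/2"
  shows "(\<integral>\<^sup>+x. G (b + c *\<^sub>R x) \<partial>lborel) \<le> ennreal (2 ^ DIM('a)) * (\<integral>\<^sup>+x. G x \<partial>lborel)"
proof -
  note G [measurable]
  have "(\<integral>\<^sup>+x. G x \<partial>lborel) = (\<integral>\<^sup>+x. G x \<partial>density (distr lborel borel (\<lambda>x. b + c *\<^sub>R x)) (\<lambda>_. ennreal (\<bar>c\<bar> ^ DIM('a))))"
    using c by (subst lborel_affine[of c b]) (auto simp: ennreal_power)
  also have "\<dots> = (\<integral>\<^sup>+x. ennreal (\<bar>c\<bar> ^ DIM('a)) * G x \<partial>distr lborel borel (\<lambda>x. b + c *\<^sub>R x))"
    using G by (subst nn_integral_density) auto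
  also have "\<dots> = (\<integral>\<^sup>+x. ennreal (\<bar>c\<bar> ^ DIM('a)) * G (b + c *\<^sub>R x) \<partial>lborel)"
    using G by (subst nn_integral_distr) auto
  also have "\<dots> = ennreal (\<bar>c\<bar> ^ DIM('a)) * (\<integral>\<^sup>+x. G (b + c *\<^sub>R x) \<partial>lborel)"
    using G by (intro nn_integral_cmult) measurable
  finally have eq: "(\<integral>\<^sup>+x. G x \<partial>lborel) = ennreal (\<bar>c\<bar> ^ DIM('a)) * (\<integral>\<^sup>+x. G (b + c *\<^sub>R x) \<partial>lborel)" .
  have "1 \<le> (2 * \<bar>c\<bar>) ^ DIM('a)" using c by (intro one_le_power) auto
  then have "1 * (\<integral>\<^sup>+x. G (b + c *\<^sub>R x) \<partial>lborel) \<le> ennreal (2 ^ DIM('a) * \<bar>c\<bar> ^ DIM('a)) * (\<integral>\<^sup>+x. G (b + c *\<^sub>R x) \<partial>lborel)"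
    by (intro mult_right_mono) (auto simp: power_mult_distrib)
  then show ?thesis by (simp add: eq ennreal_mult mult.assoc)
qed

lemma set_nn_integral_mono_on:
  "(\<And>x. x \<in> S \<Longrightarrow> F x \<le> G x) \<Longrightarrow> (\<integral>\<^sup>+x\<in>S. F x \<partial>M) \<le> (\<integral>\<^sup>+x\<in>S. G x \<partial>M)"
  by (rule nn_integral_mono) (simp add: indicator_def)

text \<open>The increment of \<open>f\<close> from \<open>x\<close> to the midpoint of
  \<open>x\<close> and \<open>y\<close> is controlled by \<open>Q\<close> on the half of the
  segment close to \<open>x\<close>. There the points are \<open>(1 - t) x + t y\<close> with
  \<open>1 - t \<ge> 1 / 2\<close>, so for fixed \<open>y\<close> and \<open>t\<close> the map
  from \<open>x\<close> to the point on the segment does not contract by more than a factor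
  \<open>2\<close>, and the integral over \<open>x\<close> can be replaced by one over the
  point.\<close>

lemma half_segment_double_integral:
  fixes f :: "real ^ 'n::finite \<Rightarrow> complex" and E U :: "(real ^ 'n) set"
  assumes U: "open U" "E \<subseteq> U" and E: "E \<in> sets borel" "convex E"
    and h: "\<And>x y. x \<in> E \<Longrightarrow> y \<in> E \<Longrightarrow> norm (y - x) \<le> h"
    and D: "\<And>z. z \<in> U \<Longrightarrow> (f has_derivative f' z) (at z)"
    and Q: "continuous_on U Q" "\<And>z. z \<in> U \<Longrightarrow> Q z \<ge> 0"
    and le: "\<And>z v. z \<in> U \<Longrightarrow> (norm (f' z v))\<^sup>2 \<le> Q z * (norm v)\<^sup>2"
  shows "(\<integral>\<^sup>+y\<in>E. (\<integral>\<^sup>+x\<in>E. ennreal ((norm (f ((1/2) *\<^sub>R (x + y)) - f x))\<^sup>2) \<partial>lborel) \<partial>lborel)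
    \<le> ennreal (h\<^sup>2 * 2 ^ CARD('n) / 4) * emeasure lborel E * (\<integral>\<^sup>+z\<in>E. ennreal (Q z) \<partial>lborel)"
proof -
  define QE where "QE z = ennreal (indicator E z * Q z)" for z
  have QE [measurable]: "QE \<in> borel_measurable borel"
    unfolding QE_def using borel_measurable_indicator_times[OF Q(1) U(1) E(1) U(2)] by simp
  have E' [measurable]: "E \<in> sets borel" by (rule E(1))
  let ?T = "{0..1/2::real}"
  have seg: "x + t *\<^sub>R (y - x) \<in> E" if "x \<in> E" "y \<in> E" "t \<in> ?T" for x y t
  proof -
    have "(1 - t) *\<^sub>R x + t *\<^sub>R y \<in> E" using that E(2) by (intro convexD_alt) auto
    then show ?thesis by (simp add: algebra_simps)
  qed
  have point: "ennreal ((norm (f ((1/2) *\<^sub>R (x + y)) - f x))\<^sup>2)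
      \<le> ennreal (h\<^sup>2 / 2) * (\<integral>\<^sup>+t\<in>?T. QE (t *\<^sub>R y + (1 - t) *\<^sub>R x) \<partial>lborel)"
    if xy: "x \<in> E" "y \<in> E" for x y
  proof -
    let ?z = "\<lambda>t. x + t *\<^sub>R (y - x)"
    let ?q = "\<lambda>t. Q (?z t) * (norm (y - x))\<^sup>2"
    have z: "?z t \<in> U" if "t \<in> ?T" for t using seg[OF xy that] U(2) by blast
    have Qz: "continuous_on ?T (\<lambda>t. Q (?z t))"
      by (rule continuous_on_compose2[OF Q(1)]) (use z in \<open>auto intro!: continuous_intros\<close>)
    have "(norm ((\<lambda>t. f (?z t)) (1/2) - (\<lambda>t. f (?z t)) 0))\<^sup>2 \<le> integral ?T ?q / 2"
    proof (rule half_segment_estimate[where D = "\<lambda>t. f' (?z t) (y - x)"])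
      fix t assume t: "t \<in> ?T"
      have "(?z has_derivative (\<lambda>s. s *\<^sub>R (y - x))) (at t)"
        by (auto intro!: derivative_eq_intros)
      from has_derivative_compose[OF this D[OF z[OF t]]]
      have "((\<lambda>s. f (?z s)) has_vector_derivative f' (?z t) (y - x)) (at t)"
        using has_derivative_linear[OF D[OF z[OF t]]]
        by (simp add: has_vector_derivative_def linear_scale)
      then show "((\<lambda>s. f (?z s)) has_vector_derivative f' (?z t) (y - x)) (at t within ?T)"
        by (rule has_vector_derivative_at_within)
      show "(norm (f' (?z t) (y - x)))\<^sup>2 \<le> ?q t" by (rule le[OF z[OF t]])
    qed (intro continuous_intros Qz)
    moreover have "(1/2) *\<^sub>R (x + y) = ?z (1/2)"
      by (simp add: vec_eq_iff field_simps)
    ultimately have "(norm (f ((1/2) *\<^sub>R (x + y)) - f x))\<^sup>2 \<le> integral ?T ?q / 2" by simp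
    also have "integral ?T ?q = integral ?T (\<lambda>t. Q (?z t)) * (norm (y - x))\<^sup>2" by simp
    also have "\<dots> \<le> integral ?T (\<lambda>t. Q (?z t)) * h\<^sup>2"
      using h[OF xy] Q(2) z Qz
      by (intro mult_left_mono power_mono integral_nonneg integrable_continuous_interval) auto
    finally have "(norm (f ((1/2) *\<^sub>R (x + y)) - f x))\<^sup>2 \<le> (h\<^sup>2 / 2) * integral ?T (\<lambda>t. Q (?z t))"
      by (simp add: mult.commute)
    then have "ennreal ((norm (f ((1/2) *\<^sub>R (x + y)) - f x))\<^sup>2) \<le> ennreal (h\<^sup>2 / 2) * ennreal (integral ?T (\<lambda>t. Q (?z t)))"
      by (subst ennreal_mult''[symmetric]) (auto intro!: ennreal_leI integral_nonneg integrable_continuous_interval Qz Q(2) z)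
    also have "ennreal (integral ?T (\<lambda>t. Q (?z t))) = (\<integral>\<^sup>+t\<in>?T. ennreal (Q (?z t)) \<partial>lborel)"
    proof (rule nn_integral_eq_integral_on[symmetric])
      show "(\<lambda>t. Q (?z t)) absolutely_integrable_on ?T"
        by (rule absolutely_integrable_continuous_real[OF Qz])
      have "(\<lambda>t. indicator ?T t *\<^sub>R Q (?z t)) \<in> borel_measurable borel"
        by (intro borel_measurable_continuous_on_indicator Qz) simp
      then show "(\<lambda>t. indicator ?T t * Q (?z t)) \<in> borel_measurable borel" by simp
    qed (use Q(2) z in auto)
    also have "\<dots> = (\<integral>\<^sup>+t\<in>?T. QE (t *\<^sub>R y + (1 - t) *\<^sub>R x) \<partial>lborel)"
    proof (rule nn_integral_cong)
      fix t
      have "t *\<^sub>R y + (1 - t) *\<^sub>R x = ?z t" by (simp add: algebra_simps)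
      then show "ennreal (Q (?z t)) * indicator ?T t = QE (t *\<^sub>R y + (1 - t) *\<^sub>R x) * indicator ?T t"
        using seg[OF xy, of t] by (auto simp: QE_def indicator_def)
    qed
    finally show ?thesis .
  qed
  have inner: "(\<integral>\<^sup>+y\<in>E. (\<integral>\<^sup>+x\<in>E. (\<integral>\<^sup>+t\<in>?T. QE (t *\<^sub>R y + (1 - t) *\<^sub>R x) \<partial>lborel) \<partial>lborel) \<partial>lborel) \<le>
      (\<integral>\<^sup>+y\<in>E. ennreal (2 ^ CARD('n) / 2) * (\<integral>\<^sup>+z. QE z \<partial>lborel) \<partial>lborel)"
  proof (rule nn_integral_mono)
    fix y
    have "(\<integral>\<^sup>+x\<in>E. (\<integral>\<^sup>+t\<in>?T. QE (t *\<^sub>R y + (1 - t) *\<^sub>R x) \<partial>lborel) \<partial>lborel) \<le>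
        (\<integral>\<^sup>+x. (\<integral>\<^sup>+t\<in>?T. QE (t *\<^sub>R y + (1 - t) *\<^sub>R x) \<partial>lborel) \<partial>lborel)"
      by (intro nn_integral_mono) (auto simp: indicator_def)
    also have "\<dots> = (\<integral>\<^sup>+t. (\<integral>\<^sup>+x. QE (t *\<^sub>R y + (1 - t) *\<^sub>R x) * indicator ?T t \<partial>lborel) \<partial>lborel)"
      by (rule lborel_pair.Fubini') measurable
    also have "\<dots> = (\<integral>\<^sup>+t\<in>?T. (\<integral>\<^sup>+x. QE (t *\<^sub>R y + (1 - t) *\<^sub>R x) \<partial>lborel) \<partial>lborel)"
      by (simp add: nn_integral_multc)
    also have "\<dots> \<le> (\<integral>\<^sup>+t\<in>?T. ennreal (2 ^ CARD('n)) * (\<integral>\<^sup>+z. QE z \<partial>lborel) \<partial>lborel)"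
    proof (intro nn_integral_mono)
      fix t :: real
      show "(\<integral>\<^sup>+x. QE (t *\<^sub>R y + (1 - t) *\<^sub>R x) \<partial>lborel) * indicator ?T t \<le>
          ennreal (2 ^ CARD('n)) * (\<integral>\<^sup>+z. QE z \<partial>lborel) * indicator ?T t"
        using nn_integral_lborel_scale[OF QE, of "1 - t" "t *\<^sub>R y"] by (auto simp: indicator_def)
    qed
    also have "\<dots> = ennreal (2 ^ CARD('n)) * (\<integral>\<^sup>+z. QE z \<partial>lborel) * ennreal (1/2)"
      by (subst nn_integral_cmult_indicator) auto
    also have "\<dots> = ennreal (2 ^ CARD('n) / 2) * (\<integral>\<^sup>+z. QE z \<partial>lborel)"
    proof -
      have "ennreal (2 ^ CARD('n)) * ennreal (1/2) = ennreal (2 ^ CARD('n) / 2)"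
        by (subst ennreal_mult[symmetric]) auto
      then show ?thesis by (simp add: mult_ac)
    qed
    finally show "(\<integral>\<^sup>+x\<in>E. (\<integral>\<^sup>+t\<in>?T. QE (t *\<^sub>R y + (1 - t) *\<^sub>R x) \<partial>lborel) \<partial>lborel) * indicator E y \<le>
        ennreal (2 ^ CARD('n) / 2) * (\<integral>\<^sup>+z. QE z \<partial>lborel) * indicator E y"
      by (rule mult_right_mono) simp
  qed
  have "(\<integral>\<^sup>+y\<in>E. (\<integral>\<^sup>+x\<in>E. ennreal ((norm (f ((1/2) *\<^sub>R (x + y)) - f x))\<^sup>2) \<partial>lborel) \<partial>lborel) \<le>
      (\<integral>\<^sup>+y\<in>E. (\<integral>\<^sup>+x\<in>E. ennreal (h\<^sup>2 / 2) * (\<integral>\<^sup>+t\<in>?T. QE (t *\<^sub>R y + (1 - t) *\<^sub>R x) \<partial>lborel) \<partial>lborel) \<partial>lborel)"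
    by (intro set_nn_integral_mono_on point)
  also have "\<dots> = ennreal (h\<^sup>2 / 2) * (\<integral>\<^sup>+y\<in>E. (\<integral>\<^sup>+x\<in>E. (\<integral>\<^sup>+t\<in>?T. QE (t *\<^sub>R y + (1 - t) *\<^sub>R x) \<partial>lborel) \<partial>lborel) \<partial>lborel)"
    by (simp add: nn_integral_cmult mult.assoc)
  also have "\<dots> \<le> ennreal (h\<^sup>2 / 2) * (\<integral>\<^sup>+y\<in>E. ennreal (2 ^ CARD('n) / 2) * (\<integral>\<^sup>+z. QE z \<partial>lborel) \<partial>lborel)"
    by (intro mult_left_mono inner) simp
  also have "(\<integral>\<^sup>+y\<in>E. ennreal (2 ^ CARD('n) / 2) * (\<integral>\<^sup>+z. QE z \<partial>lborel) \<partial>lborel) =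
      ennreal (2 ^ CARD('n) / 2) * (\<integral>\<^sup>+z. QE z \<partial>lborel) * emeasure lborel E"
    by (subst nn_integral_cmult_indicator) auto
  also have "ennreal (h\<^sup>2 / 2) * (ennreal (2 ^ CARD('n) / 2) * (\<integral>\<^sup>+z. QE z \<partial>lborel) * emeasure lborel E) =
      ennreal (h\<^sup>2 * 2 ^ CARD('n) / 4) * emeasure lborel E * (\<integral>\<^sup>+z. QE z \<partial>lborel)"
  proof -
    have "ennreal (h\<^sup>2 / 2) * ennreal (2 ^ CARD('n) / 2) = ennreal (h\<^sup>2 * 2 ^ CARD('n) / 4)"
      by (subst ennreal_mult[symmetric]) auto
    then show ?thesis by (simp only: mult_ac)
  qed
  also have "(\<integral>\<^sup>+z. QE z \<partial>lborel) = (\<integral>\<^sup>+z\<in>E. ennreal (Q z) \<partial>lborel)"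
    unfolding QE_def by (intro nn_integral_cong) (auto simp: indicator_def)
  finally show ?thesis .
qed

text \<open>The difference of \<open>f x\<close> and \<open>f y\<close> is split at the
  midpoint, and both parts are of the kind just estimated, with the roles of \<open>x\<close>
  and \<open>y\<close> exchanged in one of them. The weight lies between \<open>a\<close> and
  \<open>b\<close>, which costs a factor \<open>b / a\<close> for each of the two
  integrations.\<close>

lemma weighted_convex_Poincare:
  fixes f :: "real ^ 'n::finite \<Rightarrow> complex" and E U :: "(real ^ 'n) set"
  assumes U: "open U" "E \<subseteq> U" and E: "E \<in> sets borel" "convex E"
    and h: "\<And>x y. x \<in> E \<Longrightarrow> y \<in> E \<Longrightarrow> norm (y - x) \<le> h"
    and D: "\<And>z. z \<in> U \<Longrightarrow> (f has_derivative f' z) (at z)"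
    and Q: "continuous_on U Q" "\<And>z. z \<in> U \<Longrightarrow> Q z \<ge> 0"
    and le: "\<And>z v. z \<in> U \<Longrightarrow> (norm (f' z v))\<^sup>2 \<le> Q z * (norm v)\<^sup>2"
    and \<rho>: "a > 0" "\<And>z. z \<in> E \<Longrightarrow> a \<le> \<rho> z" "\<And>z. z \<in> E \<Longrightarrow> \<rho> z \<le> b" "continuous_on U \<rho>"
  shows "(\<integral>\<^sup>+y\<in>E. (\<integral>\<^sup>+x\<in>E. ennreal ((norm (f x - f y))\<^sup>2) * ennreal (\<rho> x) \<partial>lborel) * ennreal (\<rho> y) \<partial>lborel)
    \<le> ennreal ((b / a)\<^sup>2 * 2 ^ CARD('n) * h\<^sup>2) * (\<integral>\<^sup>+z\<in>E. ennreal (\<rho> z) \<partial>lborel) *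
      (\<integral>\<^sup>+z\<in>E. ennreal (Q z) * ennreal (\<rho> z) \<partial>lborel)"
proof (cases "E = {}")
  case False
  then obtain z0 where "z0 \<in> E" by blast
  then have ab: "a \<le> b" using \<rho>(2,3) order_trans by blast
  then have b0: "b > 0" using \<rho>(1) by simp
  have E' [measurable]: "E \<in> sets borel" by (rule E(1))
  \<comment> \<open>Outside \<open>E\<close> the function is replaced by \<open>0\<close> to
    make it measurable on the whole space.\<close>
  define fE where "fE z = indicator E z *\<^sub>R f z" for z
  have "continuous_on U f"
    using D by (auto intro!: continuous_at_imp_continuous_on has_derivative_continuous)
  then have "(\<lambda>z. indicator U z *\<^sub>R f z) \<in> borel_measurable borel"
    using U(1) by (intro borel_measurable_continuous_on_indicator) auto
  then have "(\<lambda>z. indicator E z *\<^sub>R (indicator U z *\<^sub>R f z)) \<in> borel_measurable borel"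
    by measurable
  moreover have "indicator E z *\<^sub>R (indicator U z *\<^sub>R f z) = fE z" for z
    using U(2) by (auto simp: fE_def indicator_def)
  ultimately have fE [measurable]: "fE \<in> borel_measurable borel" by simp
  have mid: "(1/2) *\<^sub>R (x + y) \<in> E" if "x \<in> E" "y \<in> E" for x y
  proof -
    have "(1 - 1/2) *\<^sub>R x + (1/2) *\<^sub>R y \<in> E" using that E(2) by (intro convexD_alt) auto
    moreover have "(1 - 1/2) *\<^sub>R x + (1/2) *\<^sub>R y = (1/2) *\<^sub>R (x + y)" by (simp add: vec_eq_iff field_simps)
    ultimately show ?thesis by simp
  qed
  \<comment> \<open>The squared increment from \<open>x\<close> to the midpoint; the increment
    from \<open>y\<close> is \<open>H y x\<close>.\<close>
  define H where "H x y = ennreal ((norm (fE ((1/2) *\<^sub>R (x + y)) - fE x))\<^sup>2) * indicator E x * indicator E y" for x y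
  have [measurable]: "(\<lambda>(x, y). H x y) \<in> borel_measurable (lborel \<Otimes>\<^sub>M lborel)"
    unfolding H_def by measurable
  define J where "J = (\<integral>\<^sup>+y. (\<integral>\<^sup>+x. H x y \<partial>lborel) \<partial>lborel)"
  let ?C = "ennreal (h\<^sup>2 * 2 ^ CARD('n) / 4) * emeasure lborel E * (\<integral>\<^sup>+z\<in>E. ennreal (Q z) \<partial>lborel)"
  have "J = (\<integral>\<^sup>+y\<in>E. (\<integral>\<^sup>+x\<in>E. ennreal ((norm (f ((1/2) *\<^sub>R (x + y)) - f x))\<^sup>2) \<partial>lborel) \<partial>lborel)"
    unfolding J_def
  proof (rule nn_integral_cong)
    fix y
    have "(\<integral>\<^sup>+x. H x y \<partial>lborel) = (\<integral>\<^sup>+x. ennreal ((norm (f ((1/2) *\<^sub>R (x + y)) - f x))\<^sup>2) * indicator E x * indicator E y \<partial>lborel)"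
      by (intro nn_integral_cong) (auto simp: H_def fE_def indicator_def dest: mid)
    then show "(\<integral>\<^sup>+x. H x y \<partial>lborel) =
        (\<integral>\<^sup>+x\<in>E. ennreal ((norm (f ((1/2) *\<^sub>R (x + y)) - f x))\<^sup>2) \<partial>lborel) * indicator E y"
      by (cases "y \<in> E") auto
  qed
  then have J: "J \<le> ?C"
    using half_segment_double_integral[OF U E h D Q le] by simp
  have "(\<integral>\<^sup>+y\<in>E. (\<integral>\<^sup>+x\<in>E. ennreal ((norm (f x - f y))\<^sup>2) * ennreal (\<rho> x) \<partial>lborel) * ennreal (\<rho> y) \<partial>lborel)
      \<le> (\<integral>\<^sup>+y. (\<integral>\<^sup>+x. ennreal (2 * b\<^sup>2) * (H x y + H y x) \<partial>lborel) \<partial>lborel)"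
  proof (rule nn_integral_mono)
    fix y
    show "(\<integral>\<^sup>+x\<in>E. ennreal ((norm (f x - f y))\<^sup>2) * ennreal (\<rho> x) \<partial>lborel) * ennreal (\<rho> y) * indicator E y
        \<le> (\<integral>\<^sup>+x. ennreal (2 * b\<^sup>2) * (H x y + H y x) \<partial>lborel)"
    proof (cases "y \<in> E")
      case y: True
      have "(\<integral>\<^sup>+x\<in>E. ennreal ((norm (f x - f y))\<^sup>2) * ennreal (\<rho> x) \<partial>lborel) * ennreal (\<rho> y)
          \<le> (\<integral>\<^sup>+x\<in>E. ennreal ((norm (fE x - fE y))\<^sup>2) * ennreal b \<partial>lborel) * ennreal b"
        using \<rho>(3) y by (intro mult_mono set_nn_integral_mono_on mult_left_mono ennreal_leI) (auto simp: fE_def)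
      also have "\<dots> = (\<integral>\<^sup>+x. ennreal ((norm (fE x - fE y))\<^sup>2) * ennreal b * indicator E x * ennreal b \<partial>lborel)"
        by (rule nn_integral_multc[symmetric]) measurable
      also have "\<dots> \<le> (\<integral>\<^sup>+x. ennreal (2 * b\<^sup>2) * (H x y + H y x) \<partial>lborel)"
      proof (rule nn_integral_mono)
        fix x
        show "ennreal ((norm (fE x - fE y))\<^sup>2) * ennreal b * indicator E x * ennreal b \<le> ennreal (2 * b\<^sup>2) * (H x y + H y x)"
        proof (cases "x \<in> E")
          case x: True
          let ?m = "fE ((1/2) *\<^sub>R (x + y))"
          have m: "fE ((1/2) *\<^sub>R (y + x)) = ?m" by (simp add: add.commute)
          have "norm (fE x - fE y) \<le> norm (?m - fE x) + norm (?m - fE y)"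
            using norm_triangle_ineq4[of "?m - fE y" "?m - fE x"] by simp
          then have "(norm (fE x - fE y))\<^sup>2 \<le> (norm (?m - fE x) + norm (?m - fE y))\<^sup>2"
            by (intro power_mono) auto
          also have "\<dots> \<le> 2 * ((norm (?m - fE x))\<^sup>2 + (norm (?m - fE y))\<^sup>2)"
            using zero_le_power2[of "norm (?m - fE x) - norm (?m - fE y)"] by (simp add: power2_diff power2_sum)
          finally have "(norm (fE x - fE y))\<^sup>2 * b * b \<le> 2 * ((norm (?m - fE x))\<^sup>2 + (norm (?m - fE y))\<^sup>2) * b * b"
            using b0 by (intro mult_right_mono) auto
          then have "ennreal ((norm (fE x - fE y))\<^sup>2 * b * b) \<le> ennreal (2 * b\<^sup>2 * ((norm (?m - fE x))\<^sup>2 + (norm (?m - fE y))\<^sup>2))"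
            by (intro ennreal_leI) (simp add: power2_eq_square mult_ac)
          then show ?thesis
            using x y b0 by (simp add: H_def m ennreal_mult ennreal_plus)
        qed simp
      qed
      finally show ?thesis using y by simp
    qed simp
  qed
  also have "\<dots> = (\<integral>\<^sup>+y. ennreal (2 * b\<^sup>2) * ((\<integral>\<^sup>+x. H x y \<partial>lborel) + (\<integral>\<^sup>+x. H y x \<partial>lborel)) \<partial>lborel)"
    by (intro nn_integral_cong) (simp add: nn_integral_cmult nn_integral_add)
  also have "\<dots> = ennreal (2 * b\<^sup>2) * (J + (\<integral>\<^sup>+y. (\<integral>\<^sup>+x. H y x \<partial>lborel) \<partial>lborel))"
    unfolding J_def by (simp add: nn_integral_cmult nn_integral_add)
  also have "(\<integral>\<^sup>+y. (\<integral>\<^sup>+x. H y x \<partial>lborel) \<partial>lborel) = J"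
    unfolding J_def by (rule lborel_pair.Fubini'[symmetric]) measurable
  also have "ennreal (2 * b\<^sup>2) * (J + J) \<le> ennreal (2 * b\<^sup>2) * (?C + ?C)"
    by (intro mult_left_mono add_mono J) auto
  also have "\<dots> = ennreal (b\<^sup>2 * (h\<^sup>2 * 2 ^ CARD('n))) * (emeasure lborel E * (\<integral>\<^sup>+z\<in>E. ennreal (Q z) \<partial>lborel))"
  proof -
    have "?C + ?C = ennreal (h\<^sup>2 * 2 ^ CARD('n) / 2) * (emeasure lborel E * (\<integral>\<^sup>+z\<in>E. ennreal (Q z) \<partial>lborel))"
      by (simp add: mult.assoc flip: distrib_right ennreal_plus)
    then show ?thesis by (simp add: mult.assoc[symmetric] flip: ennreal_mult)
  qed
  also have "\<dots> \<le> ennreal (b\<^sup>2 * (h\<^sup>2 * 2 ^ CARD('n))) *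
      ((ennreal (1 / a) * (\<integral>\<^sup>+z\<in>E. ennreal (\<rho> z) \<partial>lborel)) *
       (ennreal (1 / a) * (\<integral>\<^sup>+z\<in>E. ennreal (Q z) * ennreal (\<rho> z) \<partial>lborel)))"
  proof (intro mult_left_mono mult_mono)
    have one: "1 \<le> ennreal (1 / a) * ennreal (\<rho> z)" if "z \<in> E" for z
      using \<rho>(1) \<rho>(2)[OF that] by (simp add: ennreal_mult[symmetric] field_simps flip: ennreal_1)
    have \<rho>m: "(\<lambda>z. ennreal (\<rho> z) * indicator E z) \<in> borel_measurable borel"
    proof -
      have "(\<lambda>z. ennreal (indicator E z * \<rho> z)) \<in> borel_measurable borel"
        using borel_measurable_indicator_times[OF \<rho>(4) U(1) E(1) U(2)] by simp
      moreover have "(\<lambda>z. ennreal (indicator E z * \<rho> z)) = (\<lambda>z. ennreal (\<rho> z) * indicator E z)"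
        by (auto simp: indicator_def)
      ultimately show ?thesis by simp
    qed
    have Qm: "(\<lambda>z. ennreal (Q z) * indicator E z) \<in> borel_measurable borel"
    proof -
      have "(\<lambda>z. ennreal (indicator E z * Q z)) \<in> borel_measurable borel"
        using borel_measurable_indicator_times[OF Q(1) U(1) E(1) U(2)] by simp
      moreover have "(\<lambda>z. ennreal (indicator E z * Q z)) = (\<lambda>z. ennreal (Q z) * indicator E z)"
        by (auto simp: indicator_def)
      ultimately show ?thesis by simp
    qed
    have "emeasure lborel E = (\<integral>\<^sup>+z\<in>E. 1 \<partial>lborel)" by simp
    also have "\<dots> \<le> (\<integral>\<^sup>+z\<in>E. ennreal (1 / a) * ennreal (\<rho> z) \<partial>lborel)"
      by (intro set_nn_integral_mono_on one)
    also have "\<dots> = ennreal (1 / a) * (\<integral>\<^sup>+z\<in>E. ennreal (\<rho> z) \<partial>lborel)"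
      using \<rho>m by (simp add: mult.assoc nn_integral_cmult)
    finally show "emeasure lborel E \<le> ennreal (1 / a) * (\<integral>\<^sup>+z\<in>E. ennreal (\<rho> z) \<partial>lborel)" .
    have "(\<integral>\<^sup>+z\<in>E. ennreal (Q z) \<partial>lborel) \<le> (\<integral>\<^sup>+z\<in>E. ennreal (1 / a) * (ennreal (Q z) * ennreal (\<rho> z)) \<partial>lborel)"
    proof (rule set_nn_integral_mono_on)
      fix z assume "z \<in> E"
      have "ennreal (Q z) * 1 \<le> ennreal (Q z) * (ennreal (1 / a) * ennreal (\<rho> z))"
        by (intro mult_left_mono one \<open>z \<in> E\<close>) simp
      then show "ennreal (Q z) \<le> ennreal (1 / a) * (ennreal (Q z) * ennreal (\<rho> z))" by (simp add: mult_ac)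
    qed
    also have "\<dots> = ennreal (1 / a) * (\<integral>\<^sup>+z\<in>E. ennreal (Q z) * ennreal (\<rho> z) \<partial>lborel)"
    proof -
      have "(\<lambda>z. ennreal (Q z) * ennreal (\<rho> z) * indicator E z) =
          (\<lambda>z. (ennreal (Q z) * indicator E z) * (ennreal (\<rho> z) * indicator E z))"
        by (auto simp: indicator_def)
      then have "(\<lambda>z. ennreal (Q z) * ennreal (\<rho> z) * indicator E z) \<in> borel_measurable borel"
        using borel_measurable_times_ennreal[OF Qm \<rho>m] by simp
      then show ?thesis by (simp add: mult.assoc nn_integral_cmult)
    qed
    finally show "(\<integral>\<^sup>+z\<in>E. ennreal (Q z) \<partial>lborel) \<le> ennreal (1 / a) * (\<integral>\<^sup>+z\<in>E. ennreal (Q z) * ennreal (\<rho> z) \<partial>lborel)" .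
  qed auto
  also have "\<dots> = (ennreal (b\<^sup>2 * (h\<^sup>2 * 2 ^ CARD('n))) * ennreal (1 / a) * ennreal (1 / a)) *
      (\<integral>\<^sup>+z\<in>E. ennreal (\<rho> z) \<partial>lborel) * (\<integral>\<^sup>+z\<in>E. ennreal (Q z) * ennreal (\<rho> z) \<partial>lborel)"
    by (simp only: mult_ac)
  also have "ennreal (b\<^sup>2 * (h\<^sup>2 * 2 ^ CARD('n))) * ennreal (1 / a) * ennreal (1 / a) =
      ennreal ((b / a)\<^sup>2 * 2 ^ CARD('n) * h\<^sup>2)"
  proof -
    have a1: "0 \<le> 1 / a" using \<rho>(1) by simp
    have "b\<^sup>2 * (h\<^sup>2 * 2 ^ CARD('n)) * (1 / a) * (1 / a) = (b / a)\<^sup>2 * 2 ^ CARD('n) * h\<^sup>2"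
      by (simp add: power2_eq_square)
    then show ?thesis by (simp only: ennreal_mult''[OF a1, symmetric])
  qed
  finally show ?thesis .
qed simp

section \<open>Integration in a chart\<close>

context compact_riem
begin

text \<open>The volume on the chart domain is the image of the chart measure under the inverse
  of the chart, because the two agree on Borel sets.\<close>

lemma nn_integral_vol_chart:
  assumes c: "c \<in> A" and w: "w \<in> borel_measurable borel" and E: "E \<in> sets borel" "E \<subseteq> cimg c"
  shows "(\<integral>\<^sup>+p\<in>cinv c ` E. w p \<partial>vol) = (\<integral>\<^sup>+x\<in>E. w (cinv c x) * ennreal (density_in g c x) \<partial>lborel)"
proof -
  \<comment> \<open>The inverse of the chart, made Borel measurable by a constant value outside
    the image.\<close>
  define \<kappa> where "\<kappa> x = (if x \<in> cimg c then cinv c x else undefined)" for x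
  have pre: "\<kappa> -` B = (cinv c -` B \<inter> cimg c) \<union> (if undefined \<in> B then - cimg c else {})" for B
    by (cases "undefined \<in> B") (auto simp: \<kappa>_def split: if_splits)
  have \<kappa> [measurable]: "\<kappa> \<in> borel_measurable borel"
  proof (rule measurableI)
    fix B :: "'a set" assume "B \<in> sets borel"
    then show "\<kappa> -` B \<inter> space borel \<in> sets borel"
      using borel_vimage_Int[OF continuous_cinv[OF c] borel_open[OF open_cimg[OF c]]] open_cimg[OF c]
      by (auto simp: pre)
  qed simp
  have dm [measurable]: "(\<lambda>x. indicator (cimg c) x * density_in g c x) \<in> borel_measurable borel"
    using open_cimg[OF c] by (intro borel_measurable_indicator_times[OF continuous_density[OF c]]) auto
  have cd [measurable]: "cdom c \<in> sets borel" using open_cdom[OF c] by simp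
  have \<kappa>': "\<kappa> \<in> measurable (chart_measure c) borel"
    unfolding chart_measure_def by measurable
  have eq: "distr (chart_measure c) borel \<kappa> = density vol (indicator (cdom c))"
  proof (rule measure_eqI)
    fix B assume "B \<in> sets (distr (chart_measure c) borel \<kappa>)"
    then have B [measurable]: "B \<in> sets borel" by simp
    have "cmap c ` (B \<inter> cdom c) = cinv c -` (B \<inter> cdom c) \<inter> cimg c"
      by (rule cmap_image[OF c]) simp
    also have "\<dots> = cinv c -` B \<inter> cimg c" using cinv_in[OF c] by blast
    finally have img: "cmap c ` (B \<inter> cdom c) = cinv c -` B \<inter> cimg c" .
    have "emeasure (distr (chart_measure c) borel \<kappa>) B = emeasure (chart_measure c) (\<kappa> -` B)"
      using \<kappa>' B by (subst emeasure_distr) (auto simp: chart_measure_def)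
    also have "\<dots> = (\<integral>\<^sup>+x. ennreal (indicator (cimg c) x * density_in g c x) * indicator (\<kappa> -` B) x \<partial>lborel)"
      unfolding chart_measure_def using measurable_sets[OF \<kappa> B] by (subst emeasure_density) auto
    also have "\<dots> = (\<integral>\<^sup>+x\<in>cmap c ` (B \<inter> cdom c). ennreal (density_in g c x) \<partial>lborel)"
      unfolding img by (intro nn_integral_cong) (simp add: indicator_def \<kappa>_def)
    also have "\<dots> = emeasure vol (B \<inter> cdom c)"
      using emeasure_vol_chart[OF c, of "B \<inter> cdom c"] by (simp add: chart_volume_def)
    also have "\<dots> = (\<integral>\<^sup>+p. indicator (B \<inter> cdom c) p \<partial>vol)"
      by (rule nn_integral_indicator[symmetric]) simp
    also have "\<dots> = (\<integral>\<^sup>+p. indicator (cdom c) p * indicator B p \<partial>vol)"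
      by (intro nn_integral_cong) (auto simp: indicator_def)
    also have "\<dots> = emeasure (density vol (indicator (cdom c))) B"
      by (rule emeasure_density[symmetric]) auto
    finally show "emeasure (distr (chart_measure c) borel \<kappa>) B = emeasure (density vol (indicator (cdom c))) B" .
  qed simp
  have C [measurable]: "cinv c ` E \<in> sets borel" by (rule borel_cinv_image[OF c E])
  have Csub: "cinv c ` E \<subseteq> cdom c" using E(2) cinv_in[OF c] by blast
  have wm [measurable]: "w \<in> borel_measurable borel" by (rule w)
  have "(\<integral>\<^sup>+p\<in>cinv c ` E. w p \<partial>vol) = (\<integral>\<^sup>+p. indicator (cdom c) p * (w p * indicator (cinv c ` E) p) \<partial>vol)"
    using Csub by (intro nn_integral_cong) (auto simp: indicator_def)
  also have "\<dots> = (\<integral>\<^sup>+p. w p * indicator (cinv c ` E) p \<partial>density vol (indicator (cdom c)))"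
    by (subst nn_integral_density) auto
  also have "\<dots> = (\<integral>\<^sup>+x. w (\<kappa> x) * indicator (cinv c ` E) (\<kappa> x) \<partial>chart_measure c)"
    unfolding eq[symmetric] using \<kappa>' by (subst nn_integral_distr) auto
  also have "\<dots> = (\<integral>\<^sup>+x. ennreal (indicator (cimg c) x * density_in g c x) *
      (w (\<kappa> x) * indicator (cinv c ` E) (\<kappa> x)) \<partial>lborel)"
    unfolding chart_measure_def by (subst nn_integral_density) auto
  also have "\<dots> = (\<integral>\<^sup>+x\<in>E. w (cinv c x) * ennreal (density_in g c x) \<partial>lborel)"
  proof (rule nn_integral_cong)
    fix x
    have "cinv c x \<in> cinv c ` E \<longleftrightarrow> x \<in> E" if "x \<in> cimg c"
    proof
      assume "cinv c x \<in> cinv c ` E"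
      then obtain y where y: "y \<in> E" "cinv c x = cinv c y" by blast
      then have "cmap c (cinv c x) = cmap c (cinv c y)" by simp
      then show "x \<in> E" using y(1) E(2) that cmap_cinv[OF c] by (auto simp only: subset_iff)
    qed simp
    then show "ennreal (indicator (cimg c) x * density_in g c x) * (w (\<kappa> x) * indicator (cinv c ` E) (\<kappa> x)) =
        w (cinv c x) * ennreal (density_in g c x) * indicator E x"
      using E(2) by (auto simp: \<kappa>_def indicator_def mult_ac)
  qed
  finally show ?thesis .
qed

end

section \<open>Small cells in a compact manifold\<close>

text \<open>The ball is cut by a cubic grid of mesh \<open>h / CARD('n)\<close>: then the
  coordinates of two points of a cell differ by at most the mesh, and the norm is at most the
  sum of the absolute values of the coordinates.\<close>

lemma convex_grid:
  fixes X :: "real ^ 'n::finite"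
  assumes h: "h > 0"
  shows "\<exists>\<E>. finite \<E> \<and> disjoint \<E> \<and> \<Union>\<E> = ball X r \<and>
    (\<forall>E\<in>\<E>. E \<in> sets borel \<and> convex E \<and> (\<forall>x\<in>E. \<forall>y\<in>E. norm (y - x) \<le> h))"
proof -
  define s where "s = h / real CARD('n)"
  have s: "s > 0" using h by (simp add: s_def)
  define idx where "idx x = (\<lambda>i. \<lfloor>x $ i / s\<rfloor>)" for x :: "real ^ 'n"
  define cell where "cell k = {x \<in> ball X r. idx x = k}" for k
  let ?\<E> = "cell ` idx ` ball X r"
  have "finite (idx ` ball X r)"
  proof -
    define R where "R = (norm X + r) / s"
    have "idx ` ball X r \<subseteq> (UNIV :: 'n set) \<rightarrow>\<^sub>E {\<lfloor>- R\<rfloor>..\<lfloor>R\<rfloor>}"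
    proof (clarsimp simp: PiE_def idx_def)
      fix x i assume "dist X x < r"
      then have "norm x \<le> norm X + r"
        using norm_triangle_sub[of x X] by (simp add: dist_norm norm_minus_commute)
      then have "\<bar>x $ i\<bar> \<le> norm X + r" using component_le_norm_cart[of x i] by linarith
      then have "\<bar>x $ i / s\<bar> \<le> R" using s by (simp add: R_def divide_right_mono)
      then show "\<lfloor>- R\<rfloor> \<le> \<lfloor>x $ i / s\<rfloor> \<and> \<lfloor>x $ i / s\<rfloor> \<le> \<lfloor>R\<rfloor>"
        by (intro conjI floor_mono) linarith+
    qed
    then show ?thesis by (rule finite_subset) (auto intro: finite_PiE)
  qed
  then have "finite ?\<E>" by (rule finite_imageI)
  moreover have "disjoint ?\<E>"
    by (auto simp: disjoint_def cell_def)
  moreover have "\<Union>?\<E> = ball X r" by (auto simp: cell_def)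
  moreover have "E \<in> sets borel \<and> convex E \<and> (\<forall>x\<in>E. \<forall>y\<in>E. norm (y - x) \<le> h)" if E: "E \<in> ?\<E>" for E
  proof -
    obtain k where k: "E = cell k" using E by blast
    have slab: "\<lfloor>t / s\<rfloor> = z \<longleftrightarrow> t \<ge> of_int z * s \<and> t < of_int (z + 1) * s" for t z
      using s by (auto simp: floor_eq_iff pos_le_divide_eq pos_divide_less_eq)
    have eq: "E = ball X r \<inter> (\<Inter>i\<in>UNIV. {x. axis i 1 \<bullet> x \<ge> of_int (k i) * s} \<inter> {x. axis i 1 \<bullet> x < of_int (k i + 1) * s})"
      unfolding k cell_def idx_def by (auto simp: fun_eq_iff slab inner_axis')
    have "E \<in> sets borel"
      unfolding eq by (intro sets.Int sets.finite_INT borel_open borel_closed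
          open_ball closed_halfspace_ge open_halfspace_lt) auto
    moreover have "convex E"
      unfolding eq by (intro convex_Int convex_INT convex_ball convex_halfspace_ge convex_halfspace_lt)
    moreover have "norm (y - x) \<le> h" if "x \<in> E" "y \<in> E" for x y
    proof -
      have "\<bar>(y - x) $ i\<bar> \<le> s" for i
      proof -
        have "\<lfloor>x $ i / s\<rfloor> = k i" "\<lfloor>y $ i / s\<rfloor> = k i"
          using that unfolding k cell_def idx_def by (auto simp: fun_eq_iff)
        then have "of_int (k i) * s \<le> x $ i" "x $ i < of_int (k i + 1) * s"
          "of_int (k i) * s \<le> y $ i" "y $ i < of_int (k i + 1) * s"
          by (simp_all add: slab)
        then show ?thesis by (simp add: abs_le_iff algebra_simps)
      qed
      then have "(\<Sum>i\<in>UNIV. \<bar>(y - x) $ i\<bar>) \<le> (\<Sum>i\<in>(UNIV :: 'n set). s)" by (intro sum_mono)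
      also have "\<dots> = h" by (simp add: s_def)
      finally show ?thesis using norm_le_l1_cart[of "y - x"] by linarith
    qed
    ultimately show ?thesis by blast
  qed
  ultimately show ?thesis by blast
qed

lemma quadratic_form_le:
  fixes H :: "real ^ 'n ^ 'n::finite"
  shows "v \<bullet> (H *v v) \<le> (\<Sum>i\<in>UNIV. \<Sum>j\<in>UNIV. \<bar>H $ i $ j\<bar>) * (norm v)\<^sup>2"
proof -
  have "v \<bullet> (H *v v) = (\<Sum>i\<in>UNIV. \<Sum>j\<in>UNIV. H $ i $ j * (v $ i * v $ j))"
    by (simp add: inner_vec_def matrix_vector_mult_def sum_distrib_left mult_ac)
  also have "\<dots> \<le> (\<Sum>i\<in>UNIV. \<Sum>j\<in>UNIV. \<bar>H $ i $ j\<bar> * (norm v)\<^sup>2)"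
  proof (intro sum_mono)
    fix i j
    have "H $ i $ j * (v $ i * v $ j) \<le> \<bar>H $ i $ j\<bar> * (\<bar>v $ i\<bar> * \<bar>v $ j\<bar>)"
      by (metis abs_ge_self abs_mult)
    also have "\<dots> \<le> \<bar>H $ i $ j\<bar> * (norm v * norm v)"
      by (intro mult_left_mono mult_mono component_le_norm_cart) auto
    finally show "H $ i $ j * (v $ i * v $ j) \<le> \<bar>H $ i $ j\<bar> * (norm v)\<^sup>2" by (simp add: power2_eq_square)
  qed
  also have "\<dots> = (\<Sum>i\<in>UNIV. \<Sum>j\<in>UNIV. \<bar>H $ i $ j\<bar>) * (norm v)\<^sup>2"
    by (simp add: sum_distrib_right)
  finally show ?thesis .
qed

context compact_riem
begin

text \<open>Around every point there is a chart in which density and metric are uniformly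
  comparable to the Euclidean ones, by compactness of a closed ball.\<close>

lemma chart_bounds:
  "\<exists>c\<in>A. \<exists>r>0. \<exists>a>0. \<exists>b. \<exists>\<beta>\<ge>0. p \<in> cdom c \<and> cball (cmap c p) r \<subseteq> cimg c \<and>
    (\<forall>x\<in>cball (cmap c p) r. a \<le> density_in g c x \<and> density_in g c x \<le> b \<and>
      (\<forall>v. v \<bullet> (g c (cinv c x) *v v) \<le> \<beta> * (norm v)\<^sup>2))"
proof -
  obtain c r where c: "c \<in> A" "r > 0" "p \<in> cdom c" "cball (cmap c p) r \<subseteq> cimg c"
    using compact_ball_in_chart by blast
  let ?K = "cball (cmap c p) r"
  have K: "compact ?K" "?K \<noteq> {}" using c(2) by auto
  have dc: "continuous_on ?K (density_in g c)"
    by (rule continuous_on_subset[OF continuous_density[OF c(1)] c(4)])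
  obtain x0 where x0: "x0 \<in> ?K" "\<forall>x\<in>?K. density_in g c x0 \<le> density_in g c x"
    using continuous_attains_inf[OF K dc] by blast
  obtain x1 where x1: "\<forall>x\<in>?K. density_in g c x \<le> density_in g c x1"
    using continuous_attains_sup[OF K dc] by blast
  let ?s = "\<lambda>x. \<Sum>i\<in>UNIV. \<Sum>j\<in>UNIV. \<bar>g c (cinv c x) $ i $ j\<bar>"
  have "continuous_on ?K ?s"
    by (intro continuous_on_sum continuous_on_rabs continuous_on_component
        continuous_on_subset[OF continuous_metric[OF c(1)] c(4)])
  then obtain x2 where x2: "x2 \<in> ?K" "\<forall>x\<in>?K. ?s x \<le> ?s x2"
    using continuous_attains_sup[OF K] by blast
  have "v \<bullet> (g c (cinv c x) *v v) \<le> ?s x2 * (norm v)\<^sup>2" if "x \<in> ?K" for x v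
  proof -
    have "v \<bullet> (g c (cinv c x) *v v) \<le> ?s x * (norm v)\<^sup>2" by (rule quadratic_form_le)
    also have "\<dots> \<le> ?s x2 * (norm v)\<^sup>2" using x2(2) that by (intro mult_right_mono) auto
    finally show ?thesis .
  qed
  moreover have "?s x2 \<ge> 0" by (intro sum_nonneg) simp
  moreover have "density_in g c x0 > 0" using density_pos[OF c(1)] c(4) x0(1) by blast
  ultimately show ?thesis using c x0 x1 by blast
qed

lemma continuous_borel: "continuous_on UNIV f \<Longrightarrow> f \<in> borel_measurable borel"
  by (rule borel_measurable_continuous_onI)

text \<open>The weighted Poincare inequality in the chart, with the volume density as the
  weight. The squared norm of the differential in the chart is at most \<open>\<beta>\<close>
  times that of the gradient, hence the choice of \<open>Q\<close>.\<close>

lemma convex_cell_estimate: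
  assumes c: "c \<in> A" "ball X r \<subseteq> cimg c"
    and bounds: "a > 0" "\<beta> \<ge> 0" "\<And>x. x \<in> ball X r \<Longrightarrow> a \<le> density_in g c x \<and> density_in g c x \<le> b \<and>
      (\<forall>v. v \<bullet> (g c (cinv c x) *v v) \<le> \<beta> * (norm v)\<^sup>2)"
    and E: "E \<in> sets borel" "convex E" "E \<subseteq> ball X r" "\<And>x y. x \<in> E \<Longrightarrow> y \<in> E \<Longrightarrow> norm (y - x) \<le> h"
    and u: "smooth_fun A u"
  defines "C \<equiv> cinv c ` E"
  shows "(\<integral>\<^sup>+q\<in>C. (\<integral>\<^sup>+p\<in>C. ennreal ((norm (u p - u q))\<^sup>2) \<partial>vol) \<partial>vol)
    \<le> ennreal ((b / a)\<^sup>2 * 2 ^ CARD('b) * h\<^sup>2 * \<beta>) * emeasure vol C * (\<integral>\<^sup>+p\<in>C. ennreal (grad_sq u p) \<partial>vol)"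
proof -
  have Ec: "E \<subseteq> cimg c" using E(3) c(2) by blast
  have C [measurable]: "C \<in> sets borel" unfolding C_def by (rule borel_cinv_image[OF c(1) E(1) Ec])
  have um [measurable]: "u \<in> borel_measurable borel"
    by (rule continuous_borel[OF smooth_fun_continuous[OF u]])
  have gm [measurable]: "grad_sq u \<in> borel_measurable borel"
    by (rule continuous_borel[OF continuous_grad_sq[OF u]])
  define f where "f = u \<circ> cinv c"
  define Q where "Q z = \<beta> * grad_sq u (cinv c z)" for z
  define W where "W q = (\<integral>\<^sup>+p\<in>C. ennreal ((norm (u p - u q))\<^sup>2) \<partial>vol)" for q
  have W: "W q = (\<integral>\<^sup>+x\<in>E. ennreal ((norm (u (cinv c x) - u q))\<^sup>2) * ennreal (density_in g c x) \<partial>lborel)" for q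
    unfolding W_def C_def by (rule nn_integral_vol_chart[OF c(1) _ E(1) Ec]) measurable
  have Wm: "W \<in> borel_measurable borel"
    unfolding W_def by measurable
  have "(\<integral>\<^sup>+q\<in>C. W q \<partial>vol) = (\<integral>\<^sup>+y\<in>E. W (cinv c y) * ennreal (density_in g c y) \<partial>lborel)"
    unfolding C_def by (rule nn_integral_vol_chart[OF c(1) Wm E(1) Ec])
  also have "\<dots> = (\<integral>\<^sup>+y\<in>E. (\<integral>\<^sup>+x\<in>E. ennreal ((norm (f x - f y))\<^sup>2) * ennreal (density_in g c x) \<partial>lborel) *
      ennreal (density_in g c y) \<partial>lborel)"
    unfolding W f_def by simp
  also have "\<dots> \<le> ennreal ((b / a)\<^sup>2 * 2 ^ CARD('b) * h\<^sup>2) * (\<integral>\<^sup>+z\<in>E. ennreal (density_in g c z) \<partial>lborel) *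
      (\<integral>\<^sup>+z\<in>E. ennreal (Q z) * ennreal (density_in g c z) \<partial>lborel)"
  proof (rule weighted_convex_Poincare[where U = "ball X r" and f' = "\<lambda>z. differential c u (cinv c z)"])
    fix z assume z: "z \<in> ball X r"
    then have zc: "z \<in> cimg c" using c(2) by blast
    show "(f has_derivative differential c u (cinv c z)) (at z)"
      using differential_works[OF c(1) cinv_in[OF c(1) zc] u] by (simp add: f_def cmap_cinv[OF c(1) zc])
    show "Q z \<ge> 0" using bounds(2) grad_sq_nonneg[OF u] by (simp add: Q_def)
    fix v
    have "(norm (differential c u (cinv c z) v))\<^sup>2 \<le> grad_sq u (cinv c z) * (v \<bullet> (g c (cinv c z) *v v))"
      by (rule differential_Cauchy_Schwarz[OF u c(1) cinv_in[OF c(1) zc]])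
    also have "\<dots> \<le> grad_sq u (cinv c z) * (\<beta> * (norm v)\<^sup>2)"
      using bounds(3)[OF z] by (intro mult_left_mono grad_sq_nonneg[OF u]) auto
    finally show "(norm (differential c u (cinv c z) v))\<^sup>2 \<le> Q z * (norm v)\<^sup>2"
      by (simp add: Q_def mult_ac)
  next
    show "continuous_on (ball X r) Q"
      unfolding Q_def
      by (intro continuous_intros continuous_on_compose2[OF continuous_grad_sq[OF u]]
          continuous_on_subset[OF continuous_cinv[OF c(1)] c(2)]) auto
    show "continuous_on (ball X r) (density_in g c)"
      by (rule continuous_on_subset[OF continuous_density[OF c(1)] c(2)])
  qed (use bounds E in auto)
  also have "(\<integral>\<^sup>+z\<in>E. ennreal (density_in g c z) \<partial>lborel) = emeasure vol C"
    using nn_integral_vol_chart[OF c(1) _ E(1) Ec, of "\<lambda>_. 1"] C by (simp add: C_def)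
  also have "(\<integral>\<^sup>+z\<in>E. ennreal (Q z) * ennreal (density_in g c z) \<partial>lborel) =
      (\<integral>\<^sup>+p\<in>C. ennreal (\<beta> * grad_sq u p) \<partial>vol)"
    unfolding C_def Q_def by (rule nn_integral_vol_chart[OF c(1) _ E(1) Ec, symmetric]) measurable
  also have "\<dots> = ennreal \<beta> * (\<integral>\<^sup>+p\<in>C. ennreal (grad_sq u p) \<partial>vol)"
    using bounds(2) grad_sq_nonneg[OF u]
    by (subst nn_integral_cmult[symmetric]) (auto simp: ennreal_mult mult.assoc)
  also have "ennreal ((b / a)\<^sup>2 * 2 ^ CARD('b) * h\<^sup>2) * emeasure vol C * (ennreal \<beta> * (\<integral>\<^sup>+p\<in>C. ennreal (grad_sq u p) \<partial>vol)) =
      (ennreal ((b / a)\<^sup>2 * 2 ^ CARD('b) * h\<^sup>2) * ennreal \<beta>) * emeasure vol C * (\<integral>\<^sup>+p\<in>C. ennreal (grad_sq u p) \<partial>vol)"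
    by (simp only: mult_ac)
  also have "ennreal ((b / a)\<^sup>2 * 2 ^ CARD('b) * h\<^sup>2) * ennreal \<beta> = ennreal ((b / a)\<^sup>2 * 2 ^ CARD('b) * h\<^sup>2 * \<beta>)"
    by (rule ennreal_mult''[OF bounds(2), symmetric])
  finally show ?thesis unfolding W_def .
qed

text \<open>The double integral is \<open>2 * vol C\<close> times the integral of \<open>|u -
  m|\<^sup>2\<close>, where \<open>m\<close> is the mean of \<open>u\<close> on
  \<open>C\<close>; the inequality is thus the Poincare inequality on \<open>C\<close> with
  constant \<open>\<eta> / 2\<close>, in a form that makes sense for null sets too.\<close>

definition poincare_cell :: "real \<Rightarrow> 'a set \<Rightarrow> bool" where
  "poincare_cell \<eta> C \<longleftrightarrow> C \<in> sets borel \<and> (\<forall>u. smooth_fun A u \<longrightarrow>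
     (\<integral>\<^sup>+q\<in>C. (\<integral>\<^sup>+p\<in>C. ennreal ((norm (u p - u q))\<^sup>2) \<partial>vol) \<partial>vol)
       \<le> ennreal \<eta> * emeasure vol C * (\<integral>\<^sup>+p\<in>C. ennreal (grad_sq u p) \<partial>vol))"

text \<open>The neighbourhood \<open>U\<close> is chosen before \<open>\<eta>\<close>, as the
  constants of the chart depend on the point only; then the mesh \<open>h\<close> makes the
  factor \<open>h\<^sup>2\<close> of the convex estimate compensate them. This order of choices
  allows \<open>\<eta>\<close> to depend on the number of neighbourhoods that cover
  \<open>M\<close>.\<close>

lemma local_poincare_cells:
  "\<exists>U. open U \<and> p \<in> U \<and> (\<forall>\<eta>>0. \<exists>\<F>. finite \<F> \<and> disjoint \<F> \<and> \<Union>\<F> = U \<and> (\<forall>C\<in>\<F>. poincare_cell \<eta> C))"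
proof -
  obtain c r a b \<beta> where c: "c \<in> A" "r > 0" "a > 0" "\<beta> \<ge> 0" "p \<in> cdom c" "cball (cmap c p) r \<subseteq> cimg c" and
    bounds: "\<And>x. x \<in> cball (cmap c p) r \<Longrightarrow> a \<le> density_in g c x \<and> density_in g c x \<le> b \<and>
      (\<forall>v. v \<bullet> (g c (cinv c x) *v v) \<le> \<beta> * (norm v)\<^sup>2)"
    using chart_bounds[of p] by blast
  let ?B = "ball (cmap c p) r"
  have B: "?B \<subseteq> cimg c" using c(6) ball_subset_cball by blast
  show ?thesis
  proof (rule exI[of _ "cinv c ` ?B"], intro conjI allI impI)
    show "open (cinv c ` ?B)" by (rule open_cinv_image[OF c(1) open_ball B])
    show "p \<in> cinv c ` ?B"
      using c(2) cinv_cmap[OF c(1,5)] by (intro image_eqI[of _ _ "cmap c p"]) auto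
    fix \<eta> :: real assume \<eta>: "\<eta> > 0"
    define K where "K = (b / a)\<^sup>2 * 2 ^ CARD('b) * \<beta>"
    have K0: "K \<ge> 0" using c(4) by (simp add: K_def)
    define h where "h = sqrt (\<eta> / (K + 1))"
    have h: "h > 0" using \<eta> K0 by (simp add: h_def)
    have "h\<^sup>2 = \<eta> / (K + 1)" using \<eta> K0 by (simp add: h_def)
    then have "K * h\<^sup>2 \<le> \<eta>" using \<eta> K0 by (simp add: pos_divide_le_eq mult.commute mult_left_mono)
    then have Kh: "(b / a)\<^sup>2 * 2 ^ CARD('b) * h\<^sup>2 * \<beta> \<le> \<eta>" by (simp add: K_def mult_ac)
    obtain \<E> where \<E>: "finite \<E>" "disjoint \<E>" "\<Union>\<E> = ?B"
      "\<And>E. E \<in> \<E> \<Longrightarrow> E \<in> sets borel \<and> convex E \<and> (\<forall>x\<in>E. \<forall>y\<in>E. norm (y - x) \<le> h)"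
      using convex_grid[OF h, of "cmap c p" r] by blast
    have sub: "E \<subseteq> ?B" if "E \<in> \<E>" for E using \<E>(3) that by blast
    have inj: "inj_on (cinv c) (cimg c)" by (rule inj_on_inverseI[of _ "cmap c"]) (rule cmap_cinv[OF c(1)])
    show "\<exists>\<F>. finite \<F> \<and> disjoint \<F> \<and> \<Union>\<F> = cinv c ` ?B \<and> (\<forall>C\<in>\<F>. poincare_cell \<eta> C)"
    proof (rule exI[of _ "(`) (cinv c) ` \<E>"], intro conjI ballI)
      show "finite ((`) (cinv c) ` \<E>)" using \<E>(1) by simp
      show "\<Union>((`) (cinv c) ` \<E>) = cinv c ` ?B" by (subst \<E>(3)[symmetric]) (simp only: image_Union)
      show "disjoint ((`) (cinv c) ` \<E>)"
        unfolding disjoint_def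
      proof (intro ballI impI)
        fix C D assume "C \<in> (`) (cinv c) ` \<E>" "D \<in> (`) (cinv c) ` \<E>" "C \<noteq> D"
        then obtain E F where EF: "E \<in> \<E>" "F \<in> \<E>" "C = cinv c ` E" "D = cinv c ` F" "E \<noteq> F" by auto
        have "C \<inter> D = cinv c ` (E \<inter> F)"
          unfolding EF using inj_on_image_Int[OF inj order_trans[OF sub[OF EF(1)] B] order_trans[OF sub[OF EF(2)] B]]
          by simp
        also have "E \<inter> F = {}" using \<E>(2) EF by (auto simp: disjoint_def)
        finally show "C \<inter> D = {}" by simp
      qed
      fix C assume "C \<in> (`) (cinv c) ` \<E>"
      then obtain E where E: "E \<in> \<E>" "C = cinv c ` E" by blast
      have "C \<in> sets borel"
        unfolding E(2) using \<E>(4)[OF E(1)] sub[OF E(1)] B by (intro borel_cinv_image[OF c(1)]) auto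
      moreover have "(\<integral>\<^sup>+q\<in>C. (\<integral>\<^sup>+p\<in>C. ennreal ((norm (u p - u q))\<^sup>2) \<partial>vol) \<partial>vol)
          \<le> ennreal \<eta> * emeasure vol C * (\<integral>\<^sup>+p\<in>C. ennreal (grad_sq u p) \<partial>vol)" if u: "smooth_fun A u" for u
      proof -
        have "(\<integral>\<^sup>+q\<in>C. (\<integral>\<^sup>+p\<in>C. ennreal ((norm (u p - u q))\<^sup>2) \<partial>vol) \<partial>vol)
          \<le> ennreal ((b / a)\<^sup>2 * 2 ^ CARD('b) * h\<^sup>2 * \<beta>) * emeasure vol C * (\<integral>\<^sup>+p\<in>C. ennreal (grad_sq u p) \<partial>vol)"
          unfolding E(2)
        proof (rule convex_cell_estimate[OF c(1) B c(3,4) _ _ _ sub[OF E(1)] _ u])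
          show "a \<le> density_in g c x \<and> density_in g c x \<le> b \<and> (\<forall>v. v \<bullet> (g c (cinv c x) *v v) \<le> \<beta> * (norm v)\<^sup>2)"
            if "x \<in> ?B" for x using bounds[of x] that by auto
        qed (use \<E>(4)[OF E(1)] in auto)
        also have "\<dots> \<le> ennreal \<eta> * emeasure vol C * (\<integral>\<^sup>+p\<in>C. ennreal (grad_sq u p) \<partial>vol)"
          by (intro mult_right_mono ennreal_leI Kh) auto
        finally show ?thesis .
      qed
      ultimately show "poincare_cell \<eta> C" unfolding poincare_cell_def by blast
    qed
  qed
qed

end

section \<open>Orthonormal systems of smooth functions with bounded energy\<close>

context compact_riem
begin

lemma integrable_continuous:
  fixes h :: "'a \<Rightarrow> 'x::{banach, second_countable_topology}"
  assumes "continuous_on UNIV h"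
  shows "integrable vol h"
proof -
  obtain K where "\<forall>p. norm (h p) \<le> K"
    using compact_imp_bounded[OF compact_continuous_image[OF assms compact_space]]
    by (auto simp: bounded_iff)
  then show ?thesis
    using continuous_borel[OF assms] by (intro vol.integrable_const_bound[of _ K]) auto
qed

lemma integrable_indicator_continuous:
  fixes h :: "'a \<Rightarrow> 'x::{banach, second_countable_topology}"
  assumes "C \<in> sets borel" "continuous_on UNIV h"
  shows "integrable vol (\<lambda>p. indicator C p *\<^sub>R h p)"
  using assms integrable_continuous by (intro integrable_mult_indicator) auto

lemma integral_lincomb:
  fixes f1 f2 f3 :: "'a \<Rightarrow> real"
  assumes "integrable vol f1" "integrable vol f2" "integrable vol f3"
  shows "(LINT x|vol. f1 x - s * f2 x + f3 x) = (LINT x|vol. f1 x) - s * (LINT x|vol. f2 x) + (LINT x|vol. f3 x)"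
  using assms by simp

text \<open>Expanding \<open>|u p - u q|\<^sup>2\<close> under the double integral gives
  \<open>2 * vol C\<close> times the integral of \<open>|u|\<^sup>2\<close> minus twice the
  squared modulus of the integral of \<open>u\<close>.\<close>

lemma poincare_cell_mean:
  assumes C: "poincare_cell \<eta> C" and u: "smooth_fun A u" and \<eta>: "\<eta> > 0"
  shows "measure vol C * (LINT p|vol. indicator C p *\<^sub>R (cmod (u p))\<^sup>2) \<le>
    (cmod (LINT p|vol. indicator C p *\<^sub>R u p))\<^sup>2 +
    \<eta> / 2 * measure vol C * (LINT p|vol. indicator C p *\<^sub>R grad_sq u p)"
proof -
  have Cb [measurable]: "C \<in> sets borel" using C by (simp add: poincare_cell_def)
  have uc: "continuous_on UNIV u" by (rule smooth_fun_continuous[OF u])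
  define m where "m = measure vol C"
  define S1 where "S1 = (LINT p|vol. indicator C p *\<^sub>R u p)"
  define S2 where "S2 = (LINT p|vol. indicator C p *\<^sub>R (cmod (u p))\<^sup>2)"
  define G where "G = (LINT p|vol. indicator C p *\<^sub>R grad_sq u p)"
  note int = integrable_indicator_continuous[OF Cb]
  have i1: "integrable vol (\<lambda>p. indicator C p *\<^sub>R u p)" by (rule int[OF uc])
  have i2: "integrable vol (\<lambda>p. indicator C p *\<^sub>R (cmod (u p))\<^sup>2)" by (intro int continuous_intros uc)
  have i0: "integrable vol (\<lambda>p. indicator C p *\<^sub>R x)" for x :: real by (intro int continuous_intros)
  have m: "(LINT p|vol. indicator C p *\<^sub>R x) = m * x" for x :: real
    by (simp add: m_def)
  have expand: "(norm (u p - z))\<^sup>2 = (cmod (u p))\<^sup>2 - 2 * (u p \<bullet> z) + (cmod z)\<^sup>2" for p z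
    by (simp add: power2_norm_eq_inner inner_diff_left inner_diff_right inner_commute)
  have inner: "(\<integral>\<^sup>+p\<in>C. ennreal ((norm (u p - z))\<^sup>2) \<partial>vol) = ennreal (S2 - 2 * (S1 \<bullet> z) + m * (cmod z)\<^sup>2)" for z
  proof -
    have "(\<integral>\<^sup>+p\<in>C. ennreal ((norm (u p - z))\<^sup>2) \<partial>vol) = (\<integral>\<^sup>+p. ennreal (indicator C p *\<^sub>R (norm (u p - z))\<^sup>2) \<partial>vol)"
      by (intro nn_integral_cong) (auto simp: indicator_def)
    also have "\<dots> = ennreal (LINT p|vol. indicator C p *\<^sub>R (norm (u p - z))\<^sup>2)"
      by (intro nn_integral_eq_integral int continuous_intros uc) auto
    also have "(LINT p|vol. indicator C p *\<^sub>R (norm (u p - z))\<^sup>2) =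
        (LINT p|vol. indicator C p *\<^sub>R (cmod (u p))\<^sup>2 - 2 * ((indicator C p *\<^sub>R u p) \<bullet> z) + indicator C p *\<^sub>R (cmod z)\<^sup>2)"
      by (intro Bochner_Integration.integral_cong) (auto simp: expand algebra_simps)
    also have "\<dots> = S2 - 2 * (S1 \<bullet> z) + m * (cmod z)\<^sup>2"
      unfolding S1_def S2_def m[symmetric]
      using i0 i1 i2 by (simp add: integral_inner_left del: real_scaleR_def inner_scaleR_left)
    finally show ?thesis .
  qed
  have nonneg: "S2 - 2 * (S1 \<bullet> z) + m * (cmod z)\<^sup>2 \<ge> 0" for z
  proof -
    have "0 \<le> (LINT p|vol. indicator C p *\<^sub>R (norm (u p - z))\<^sup>2)" by (intro integral_nonneg_AE) auto
    also have "(LINT p|vol. indicator C p *\<^sub>R (norm (u p - z))\<^sup>2) =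
        (LINT p|vol. indicator C p *\<^sub>R (cmod (u p))\<^sup>2 - 2 * ((indicator C p *\<^sub>R u p) \<bullet> z) + indicator C p *\<^sub>R (cmod z)\<^sup>2)"
      by (intro Bochner_Integration.integral_cong) (auto simp: expand algebra_simps)
    also have "\<dots> = S2 - 2 * (S1 \<bullet> z) + m * (cmod z)\<^sup>2"
      unfolding S1_def S2_def m[symmetric]
      using i0 i1 i2 by (simp add: integral_inner_left del: real_scaleR_def inner_scaleR_left)
    finally show ?thesis .
  qed
  have "(\<integral>\<^sup>+q\<in>C. (\<integral>\<^sup>+p\<in>C. ennreal ((norm (u p - u q))\<^sup>2) \<partial>vol) \<partial>vol) =
      (\<integral>\<^sup>+q. ennreal (indicator C q *\<^sub>R (S2 - 2 * (S1 \<bullet> u q) + m * (cmod (u q))\<^sup>2)) \<partial>vol)"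
    unfolding inner by (intro nn_integral_cong) (auto simp: indicator_def)
  also have "\<dots> = ennreal (LINT q|vol. indicator C q *\<^sub>R (S2 - 2 * (S1 \<bullet> u q) + m * (cmod (u q))\<^sup>2))"
    using nonneg by (intro nn_integral_eq_integral int continuous_intros uc) (auto simp: indicator_def)
  also have "(LINT q|vol. indicator C q *\<^sub>R (S2 - 2 * (S1 \<bullet> u q) + m * (cmod (u q))\<^sup>2)) =
      (LINT q|vol. indicator C q *\<^sub>R S2 - 2 * (S1 \<bullet> (indicator C q *\<^sub>R u q)) + m * (indicator C q *\<^sub>R (cmod (u q))\<^sup>2))"
    by (intro Bochner_Integration.integral_cong) (auto simp: algebra_simps)
  also have "\<dots> = (LINT q|vol. indicator C q *\<^sub>R S2) - 2 * (LINT q|vol. S1 \<bullet> (indicator C q *\<^sub>R u q)) +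
      (LINT q|vol. m * (indicator C q *\<^sub>R (cmod (u q))\<^sup>2))"
    by (intro integral_lincomb i0 integrable_inner_right i1 integrable_mult_right i2)
  also have "\<dots> = m * S2 - 2 * (S1 \<bullet> S1) + m * S2"
    by (simp only: m integral_inner_right[OF i1] integral_mult_right_zero S1_def[symmetric] S2_def[symmetric])
  finally have lhs: "(\<integral>\<^sup>+q\<in>C. (\<integral>\<^sup>+p\<in>C. ennreal ((norm (u p - u q))\<^sup>2) \<partial>vol) \<partial>vol) =
    ennreal (2 * (m * S2) - 2 * (S1 \<bullet> S1))" by (simp add: mult.commute)
  have G0: "G \<ge> 0" unfolding G_def using grad_sq_nonneg[OF u] by (intro integral_nonneg_AE) (auto simp: indicator_def)
  have "(\<integral>\<^sup>+p\<in>C. ennreal (grad_sq u p) \<partial>vol) = (\<integral>\<^sup>+p. ennreal (indicator C p *\<^sub>R grad_sq u p) \<partial>vol)"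
    by (intro nn_integral_cong) (auto simp: indicator_def)
  also have "\<dots> = ennreal G"
    unfolding G_def using grad_sq_nonneg[OF u]
    by (intro nn_integral_eq_integral int continuous_grad_sq[OF u]) (auto simp: indicator_def)
  finally have gr: "(\<integral>\<^sup>+p\<in>C. ennreal (grad_sq u p) \<partial>vol) = ennreal G" .
  have "ennreal (2 * (m * S2) - 2 * (S1 \<bullet> S1)) \<le> ennreal \<eta> * ennreal m * ennreal G"
    using C[unfolded poincare_cell_def, THEN conjunct2, rule_format, OF u]
    by (simp only: lhs gr vol.emeasure_eq_measure m_def)
  also have "\<dots> = ennreal (\<eta> * m * G)"
    using \<eta> G0 by (simp add: ennreal_mult m_def)
  finally have "2 * (m * S2) - 2 * (S1 \<bullet> S1) \<le> \<eta> * m * G"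
    using \<eta> G0 by (subst (asm) ennreal_le_iff) (auto simp: m_def)
  then show ?thesis
    unfolding m_def[symmetric] S1_def[symmetric] S2_def[symmetric] G_def[symmetric]
    by (simp add: power2_norm_eq_inner)
qed

definition ip :: "('a \<Rightarrow> complex) \<Rightarrow> ('a \<Rightarrow> complex) \<Rightarrow> complex" where
  "ip u v = (LINT p|vol. u p * cnj (v p))"

definition orthonormal :: "'i set \<Rightarrow> ('i \<Rightarrow> 'a \<Rightarrow> complex) \<Rightarrow> bool" where
  "orthonormal I \<phi> \<longleftrightarrow> finite I \<and> (\<forall>j\<in>I. continuous_on UNIV (\<phi> j)) \<and>
     (\<forall>i\<in>I. \<forall>j\<in>I. ip (\<phi> i) (\<phi> j) = (if i = j then 1 else 0))"

lemma integrable_ip: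
  "continuous_on UNIV u \<Longrightarrow> continuous_on UNIV v \<Longrightarrow> integrable vol (\<lambda>p. u p * cnj (v p))"
  by (intro integrable_continuous continuous_intros)

lemma ip_self: "ip u u = complex_of_real (LINT p|vol. (cmod (u p))\<^sup>2)"
proof -
  have "ip u u = (LINT p|vol. complex_of_real ((cmod (u p))\<^sup>2))"
    unfolding ip_def by (simp only: complex_norm_square)
  then show ?thesis by (simp only: integral_complex_of_real)
qed

lemma ip_hermitian: "ip v u = cnj (ip u v)"
  unfolding ip_def by (simp only: complex_cnj_mult complex_cnj_cnj mult.commute flip: Bochner_Integration.integral_cnj)

lemma ip_add_left:
  "continuous_on UNIV u \<Longrightarrow> continuous_on UNIV v \<Longrightarrow> continuous_on UNIV w \<Longrightarrow>
    ip (\<lambda>p. u p + v p) w = ip u w + ip v w"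
  unfolding ip_def distrib_right
  by (rule Bochner_Integration.integral_add) (intro integrable_ip; assumption)+

lemma ip_cmult_left: "ip (\<lambda>p. a * u p) w = a * ip u w"
  unfolding ip_def mult.assoc by (rule integral_mult_right_zero)

lemma ip_sum_left:
  assumes "\<And>i. i \<in> I \<Longrightarrow> continuous_on UNIV (u i)" "continuous_on UNIV w"
  shows "ip (\<lambda>p. \<Sum>i\<in>I. a i * u i p) w = (\<Sum>i\<in>I. a i * ip (u i) w)"
proof -
  have "ip (\<lambda>p. \<Sum>i\<in>I. a i * u i p) w = (LINT p|vol. (\<Sum>i\<in>I. a i * (u i p * cnj (w p))))"
    unfolding ip_def by (simp add: sum_distrib_right mult.assoc)
  also have "\<dots> = (\<Sum>i\<in>I. (LINT p|vol. a i * (u i p * cnj (w p))))"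
    using assms by (intro Bochner_Integration.integral_sum integrable_mult_right integrable_ip)
  also have "\<dots> = (\<Sum>i\<in>I. a i * ip (u i) w)" by (simp add: ip_def)
  finally show ?thesis .
qed

lemma ip_sum_right:
  assumes "\<And>i. i \<in> I \<Longrightarrow> continuous_on UNIV (u i)" "continuous_on UNIV w"
  shows "ip w (\<lambda>p. \<Sum>i\<in>I. a i * u i p) = (\<Sum>i\<in>I. cnj (a i) * ip w (u i))"
  unfolding ip_hermitian[of w] by (simp add: ip_sum_left[OF assms])

lemma orthonormal_ip_basis:
  assumes "orthonormal I \<phi>" "j \<in> I"
  shows "ip (\<lambda>p. \<Sum>i\<in>I. a i * \<phi> i p) (\<phi> j) = a j"
proof -
  have "ip (\<lambda>p. \<Sum>i\<in>I. a i * \<phi> i p) (\<phi> j) = (\<Sum>i\<in>I. a i * ip (\<phi> i) (\<phi> j))"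
    using assms by (intro ip_sum_left) (auto simp: orthonormal_def)
  also have "\<dots> = (\<Sum>i\<in>I. if i = j then a i else 0)"
    using assms by (intro sum.cong) (auto simp: orthonormal_def)
  also have "\<dots> = a j" using assms by (simp add: orthonormal_def)
  finally show ?thesis .
qed

lemma orthonormal_ip_sum:
  assumes "orthonormal I \<phi>"
  shows "ip (\<lambda>p. \<Sum>i\<in>I. a i * \<phi> i p) (\<lambda>p. \<Sum>i\<in>I. b i * \<phi> i p) = (\<Sum>i\<in>I. a i * cnj (b i))"
proof -
  have "continuous_on UNIV (\<lambda>p. \<Sum>i\<in>I. a i * \<phi> i p)"
    using assms by (intro continuous_intros) (auto simp: orthonormal_def)
  then have "ip (\<lambda>p. \<Sum>i\<in>I. a i * \<phi> i p) (\<lambda>p. \<Sum>i\<in>I. b i * \<phi> i p) =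
      (\<Sum>i\<in>I. cnj (b i) * ip (\<lambda>p. \<Sum>i\<in>I. a i * \<phi> i p) (\<phi> i))"
    using assms by (intro ip_sum_right) (auto simp: orthonormal_def)
  then show ?thesis by (simp add: orthonormal_ip_basis[OF assms] mult.commute)
qed

text \<open>Bessel's inequality for the indicator function of \<open>C\<close>, whose square
  norm is the volume of \<open>C\<close>: the function \<open>w\<close> is its projection to the
  span of the system.\<close>

lemma Bessel_indicator:
  assumes on: "orthonormal I \<phi>" and C: "C \<in> sets borel"
  shows "(\<Sum>j\<in>I. (cmod (LINT p|vol. indicator C p *\<^sub>R \<phi> j p))\<^sup>2) \<le> measure vol C"
proof -
  define c where "c j = (LINT p|vol. indicator C p *\<^sub>R \<phi> j p)" for j
  define w where "w p = (\<Sum>j\<in>I. cnj (c j) * \<phi> j p)" for p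
  define s where "s = (\<Sum>j\<in>I. (cmod (c j))\<^sup>2)"
  have cont: "continuous_on UNIV (\<phi> j)" if "j \<in> I" for j using on that by (auto simp: orthonormal_def)
  have wc: "continuous_on UNIV w" unfolding w_def using cont by (intro continuous_intros)
  note int = integrable_indicator_continuous[OF C]
  have "complex_of_real (LINT p|vol. (cmod (w p))\<^sup>2) = (\<Sum>j\<in>I. cnj (c j) * cnj (cnj (c j)))"
    unfolding ip_self[symmetric] w_def by (rule orthonormal_ip_sum[OF on])
  also have "\<dots> = complex_of_real s"
    by (simp add: s_def complex_norm_square mult.commute del: of_real_power)
  finally have w2: "(LINT p|vol. (cmod (w p))\<^sup>2) = s" by (simp only: of_real_eq_iff)
  have "(LINT p|vol. indicator C p *\<^sub>R w p) = (LINT p|vol. (\<Sum>j\<in>I. cnj (c j) * (indicator C p *\<^sub>R \<phi> j p)))"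
    by (simp add: w_def scaleR_sum_right)
  also have "\<dots> = (\<Sum>j\<in>I. (LINT p|vol. cnj (c j) * (indicator C p *\<^sub>R \<phi> j p)))"
    using cont by (intro Bochner_Integration.integral_sum integrable_mult_right int)
  also have "\<dots> = (\<Sum>j\<in>I. cnj (c j) * c j)" by (simp only: integral_mult_right_zero c_def[symmetric])
  also have "\<dots> = complex_of_real s"
    by (simp add: s_def complex_norm_square mult.commute del: of_real_power)
  finally have iw: "(LINT p|vol. indicator C p *\<^sub>R w p) = complex_of_real s" .
  have iR: "(LINT p|vol. indicator C p *\<^sub>R Re (w p)) = s"
  proof -
    have "(LINT p|vol. indicator C p *\<^sub>R Re (w p)) = (LINT p|vol. Re (indicator C p *\<^sub>R w p))" by simp
    also have "\<dots> = Re (LINT p|vol. indicator C p *\<^sub>R w p)" by (rule integral_Re[OF int[OF wc]])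
    finally show ?thesis using iw by simp
  qed
  have "0 \<le> (LINT p|vol. (cmod (indicator C p - w p))\<^sup>2)" by (intro integral_nonneg_AE) auto
  also have "(LINT p|vol. (cmod (indicator C p - w p))\<^sup>2) =
      (LINT p|vol. indicator C p *\<^sub>R 1 - 2 * (indicator C p *\<^sub>R Re (w p)) + (cmod (w p))\<^sup>2)"
  proof -
    have "(cmod (1 - z))\<^sup>2 = 1 - 2 * Re z + (cmod z)\<^sup>2" for z
      unfolding cmod_power2 by (simp add: power2_eq_square algebra_simps)
    then show ?thesis by (intro Bochner_Integration.integral_cong) (auto simp: indicator_def)
  qed
  also have "\<dots> = measure vol C - 2 * s + s"
  proof -
    have "integrable vol (\<lambda>p. indicator C p *\<^sub>R (1::real))" "integrable vol (\<lambda>p. indicator C p *\<^sub>R Re (w p))"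
      by (intro int continuous_intros wc)+
    moreover have "integrable vol (\<lambda>p. (cmod (w p))\<^sup>2)"
      by (intro integrable_continuous continuous_intros wc)
    moreover have "(LINT p|vol. indicator C p *\<^sub>R (1::real)) = measure vol C" by simp
    ultimately show ?thesis by (simp only: integral_lincomb iR w2)
  qed
  finally show ?thesis by (simp add: s_def c_def)
qed

text \<open>Summed over all cells \<open>C\<close> and all members \<open>\<phi> j\<close>, the
  integrals of \<open>|\<phi> j|\<^sup>2\<close> over \<open>C\<close> are at least
  \<open>n\<close>. By the Poincare inequality and Bessel's inequality, each cell contributes at
  most \<open>1\<close> plus \<open>\<eta> / 2\<close> times the energy of the system on it. The
  covering sets overlap, so the energies on all cells add up to at most \<open>m * n *
  \<Lambda>\<close>, where \<open>m\<close> exceeds the number of covering sets; with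
  \<open>\<eta> = 1 / (m * \<Lambda>)\<close> the energy terms are at most \<open>n / 2\<close>,
  and \<open>n / 2\<close> is at most the number of cells.\<close>

lemma orthonormal_system_bound:
  assumes \<Lambda>: "\<Lambda> > 0"
  shows "\<exists>N. \<forall>(n::nat) \<phi>. orthonormal {..<n} \<phi> \<and> (\<forall>j<n. smooth_fun A (\<phi> j)) \<and>
    (\<forall>j<n. (LINT p|vol. grad_sq (\<phi> j) p) \<le> \<Lambda>) \<longrightarrow> n \<le> N"
proof -
  obtain U where U: "\<And>p. open (U p) \<and> p \<in> U p \<and>
      (\<forall>\<eta>>0. \<exists>\<F>. finite \<F> \<and> disjoint \<F> \<and> \<Union>\<F> = U p \<and> (\<forall>C\<in>\<F>. poincare_cell \<eta> C))"
    using local_poincare_cells by metis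
  have "UNIV \<subseteq> (\<Union>p\<in>UNIV. U p)" using U by blast
  then obtain F where "finite F" "UNIV \<subseteq> (\<Union>p\<in>F. U p)"
    by (rule compactE_image[OF compact_space, of UNIV U, rotated]) (use U in auto)
  then have F: "finite F" "(\<Union>p\<in>F. U p) = UNIV" by auto
  define m where "m = real (card F) + 1"
  have m: "m > 0" by (simp add: m_def)
  define \<eta> where "\<eta> = 1 / (m * \<Lambda>)"
  have \<eta>: "\<eta> > 0" using m \<Lambda> by (simp add: \<eta>_def)
  obtain \<F> where \<F>: "\<And>p. finite (\<F> p) \<and> disjoint (\<F> p) \<and> \<Union>(\<F> p) = U p \<and> (\<forall>C\<in>\<F> p. poincare_cell \<eta> C)"
  proof -
    have "\<forall>p. \<exists>\<F>. finite \<F> \<and> disjoint \<F> \<and> \<Union>\<F> = U p \<and> (\<forall>C\<in>\<F>. poincare_cell \<eta> C)"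
      using U \<eta> by blast
    from choice[OF this] show ?thesis using that by blast
  qed
  have n_le: "n \<le> 2 * (\<Sum>p\<in>F. card (\<F> p))"
    if on: "orthonormal {..<n} \<phi>" and sm: "\<forall>j<n. smooth_fun A (\<phi> j)"
      and en: "\<forall>j<n. (LINT p|vol. grad_sq (\<phi> j) p) \<le> \<Lambda>" for n :: nat and \<phi>
  proof -
    define S2 where "S2 j C = (LINT p|vol. indicator C p *\<^sub>R (cmod (\<phi> j p))\<^sup>2)" for j C
    define G where "G j C = (LINT p|vol. indicator C p *\<^sub>R grad_sq (\<phi> j) p)" for j C
    have cont: "continuous_on UNIV (\<phi> j)" if "j < n" for j using on that by (auto simp: orthonormal_def)
    have contG: "continuous_on UNIV (grad_sq (\<phi> j))" if "j < n" for j
      using sm that continuous_grad_sq by blast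
    have Cb: "C \<in> sets borel" if "C \<in> \<F> p" for C p
      using \<F>[of p] that by (auto simp: poincare_cell_def)
    have iS: "integrable vol (\<lambda>p. indicator C p *\<^sub>R (cmod (\<phi> j p))\<^sup>2)" if "j < n" "C \<in> \<F> q" for j C q
      using cont[OF that(1)] by (intro integrable_indicator_continuous[OF Cb[OF that(2)]] continuous_intros)
    have iG: "integrable vol (\<lambda>p. indicator C p *\<^sub>R grad_sq (\<phi> j) p)" if "j < n" "C \<in> \<F> q" for j C q
      using contG[OF that(1)] by (intro integrable_indicator_continuous[OF Cb[OF that(2)]])
    have G0: "G j C \<ge> 0" if "j < n" for j C
      unfolding G_def using sm that grad_sq_nonneg by (intro integral_nonneg_AE) (auto simp: indicator_def)
    have cell: "(\<Sum>j<n. S2 j C) \<le> 1 + \<eta> / 2 * (\<Sum>j<n. G j C)" if C: "C \<in> \<F> p" for C p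
    proof (cases "measure vol C = 0")
      case True
      have "S2 j C = 0" if "j < n" for j
      proof -
        have "emeasure vol C = 0" using True by (simp add: vol.emeasure_eq_measure)
        then have "C \<in> null_sets vol" using Cb[OF C] by auto
        then have "AE p in vol. p \<notin> C" by (rule AE_not_in)
        then have "AE p in vol. indicator C p *\<^sub>R (cmod (\<phi> j p))\<^sup>2 = 0"
          by eventually_elim simp
        then show ?thesis unfolding S2_def by (rule integral_eq_zero_AE)
      qed
      moreover have "(\<Sum>j<n. G j C) \<ge> 0" by (intro sum_nonneg G0) auto
      ultimately show ?thesis using \<eta> by simp
    next
      case False
      then have mC: "measure vol C > 0" by (simp add: zero_less_measure_iff)
      have "measure vol C * (\<Sum>j<n. S2 j C) = (\<Sum>j<n. measure vol C * S2 j C)" by (rule sum_distrib_left)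
      also have "\<dots> \<le> (\<Sum>j<n. (cmod (LINT p|vol. indicator C p *\<^sub>R \<phi> j p))\<^sup>2 + \<eta> / 2 * measure vol C * G j C)"
        unfolding S2_def G_def using \<F>[of p] C sm \<eta> by (intro sum_mono poincare_cell_mean) auto
      also have "\<dots> = (\<Sum>j<n. (cmod (LINT p|vol. indicator C p *\<^sub>R \<phi> j p))\<^sup>2) + \<eta> / 2 * measure vol C * (\<Sum>j<n. G j C)"
        by (simp add: sum.distrib sum_distrib_left)
      also have "\<dots> \<le> measure vol C + \<eta> / 2 * measure vol C * (\<Sum>j<n. G j C)"
        using Bessel_indicator[OF on Cb[OF C]] by simp
      also have "\<dots> = measure vol C * (1 + \<eta> / 2 * (\<Sum>j<n. G j C))" by (simp add: algebra_simps)
      finally show ?thesis using mC by (simp add: mult_le_cancel_left_pos)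
    qed
    have one_cover: "1 \<le> (\<Sum>p\<in>F. \<Sum>C\<in>\<F> p. S2 j C)" if j: "j < n" for j
    proof -
      have "complex_of_real (LINT p|vol. (cmod (\<phi> j p))\<^sup>2) = 1"
        using on j unfolding ip_self[symmetric] by (simp add: orthonormal_def)
      then have "1 = (LINT p|vol. (cmod (\<phi> j p))\<^sup>2)" by (simp only: of_real_eq_1_iff)
      also have "\<dots> \<le> (LINT q|vol. (\<Sum>p\<in>F. \<Sum>C\<in>\<F> p. indicator C q *\<^sub>R (cmod (\<phi> j q))\<^sup>2))"
      proof (rule integral_mono)
        show "integrable vol (\<lambda>q. (cmod (\<phi> j q))\<^sup>2)"
          using cont[OF j] by (intro integrable_continuous continuous_intros)
        show "integrable vol (\<lambda>q. \<Sum>p\<in>F. \<Sum>C\<in>\<F> p. indicator C q *\<^sub>R (cmod (\<phi> j q))\<^sup>2)"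
          using iS[OF j] by (intro Bochner_Integration.integrable_sum)
        fix q
        obtain p where p: "p \<in> F" "q \<in> U p" using F(2) by blast
        then obtain C where C: "C \<in> \<F> p" "q \<in> C" using \<F>[of p] by blast
        have nn: "0 \<le> indicator C' q *\<^sub>R (cmod (\<phi> j q))\<^sup>2" for C' :: "'a set" by simp
        have "(cmod (\<phi> j q))\<^sup>2 = indicator C q *\<^sub>R (cmod (\<phi> j q))\<^sup>2" using C(2) by simp
        also have "\<dots> \<le> (\<Sum>C\<in>\<F> p. indicator C q *\<^sub>R (cmod (\<phi> j q))\<^sup>2)"
          using \<F>[of p] by (intro member_le_sum C(1) nn) auto
        also have "\<dots> \<le> (\<Sum>p\<in>F. \<Sum>C\<in>\<F> p. indicator C q *\<^sub>R (cmod (\<phi> j q))\<^sup>2)"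
          by (intro member_le_sum[of p F "\<lambda>p. \<Sum>C\<in>\<F> p. indicator C q *\<^sub>R (cmod (\<phi> j q))\<^sup>2"] p(1) F(1) sum_nonneg nn)
        finally show "(cmod (\<phi> j q))\<^sup>2 \<le> (\<Sum>p\<in>F. \<Sum>C\<in>\<F> p. indicator C q *\<^sub>R (cmod (\<phi> j q))\<^sup>2)" .
      qed
      also have "\<dots> = (\<Sum>p\<in>F. (LINT q|vol. (\<Sum>C\<in>\<F> p. indicator C q *\<^sub>R (cmod (\<phi> j q))\<^sup>2)))"
        using iS[OF j] by (intro Bochner_Integration.integral_sum Bochner_Integration.integrable_sum)
      also have "\<dots> = (\<Sum>p\<in>F. \<Sum>C\<in>\<F> p. S2 j C)"
        unfolding S2_def using iS[OF j] by (intro sum.cong refl Bochner_Integration.integral_sum)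
      finally show ?thesis .
    qed
    have sumG: "(\<Sum>C\<in>\<F> p. G j C) \<le> \<Lambda>" if j: "j < n" for j p
    proof -
      have "(\<Sum>C\<in>\<F> p. G j C) = (LINT q|vol. (\<Sum>C\<in>\<F> p. indicator C q *\<^sub>R grad_sq (\<phi> j) q))"
        unfolding G_def using iG[OF j] by (intro Bochner_Integration.integral_sum[symmetric])
      also have "\<dots> \<le> (LINT q|vol. grad_sq (\<phi> j) q)"
      proof (rule integral_mono)
        show "integrable vol (\<lambda>q. \<Sum>C\<in>\<F> p. indicator C q *\<^sub>R grad_sq (\<phi> j) q)"
          using iG[OF j] by (intro Bochner_Integration.integrable_sum)
        show "integrable vol (grad_sq (\<phi> j))" by (intro integrable_continuous contG[OF j])
        fix q
        have "(\<Sum>C\<in>\<F> p. indicator C q :: real) \<le> 1"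
        proof (cases "q \<in> U p")
          case True
          then obtain C where C: "C \<in> \<F> p" "q \<in> C" using \<F>[of p] by blast
          have "(\<Sum>D\<in>\<F> p. indicator D q :: real) = (\<Sum>D\<in>\<F> p. if D = C then 1 else 0)"
          proof (rule sum.cong)
            fix D assume D: "D \<in> \<F> p"
            have "disjoint (\<F> p)" using \<F>[of p] by blast
            then have "D \<noteq> C \<Longrightarrow> q \<notin> D" using D C unfolding disjoint_def by blast
            then show "(indicator D q :: real) = (if D = C then 1 else 0)" using C(2) by (auto simp: indicator_def)
          qed simp
          then show ?thesis using C(1) \<F>[of p] by simp
        next
          case False
          then have "q \<notin> D" if "D \<in> \<F> p" for D using \<F>[of p] that by blast
          then show ?thesis by (simp add: sum.neutral)
        qed
        then have "(\<Sum>C\<in>\<F> p. indicator C q) * grad_sq (\<phi> j) q \<le> 1 * grad_sq (\<phi> j) q"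
          using sm j grad_sq_nonneg by (intro mult_right_mono) auto
        then show "(\<Sum>C\<in>\<F> p. indicator C q *\<^sub>R grad_sq (\<phi> j) q) \<le> grad_sq (\<phi> j) q"
          by (simp add: sum_distrib_right)
      qed
      also have "\<dots> \<le> \<Lambda>" using en j by blast
      finally show ?thesis .
    qed
    have "real n = (\<Sum>j<n. 1)" by simp
    also have "\<dots> \<le> (\<Sum>j<n. \<Sum>p\<in>F. \<Sum>C\<in>\<F> p. S2 j C)" using one_cover by (intro sum_mono) auto
    also have "\<dots> = (\<Sum>p\<in>F. \<Sum>j<n. \<Sum>C\<in>\<F> p. S2 j C)" by (rule sum.swap)
    also have "\<dots> = (\<Sum>p\<in>F. \<Sum>C\<in>\<F> p. \<Sum>j<n. S2 j C)" by (intro sum.cong refl sum.swap)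
    also have "\<dots> \<le> (\<Sum>p\<in>F. \<Sum>C\<in>\<F> p. 1 + \<eta> / 2 * (\<Sum>j<n. G j C))" using cell by (intro sum_mono) auto
    also have "\<dots> = (\<Sum>p\<in>F. real (card (\<F> p)) + \<eta> / 2 * (\<Sum>j<n. \<Sum>C\<in>\<F> p. G j C))"
    proof (intro sum.cong refl)
      fix p
      have "(\<Sum>C\<in>\<F> p. \<Sum>j<n. G j C) = (\<Sum>j<n. \<Sum>C\<in>\<F> p. G j C)" by (rule sum.swap)
      then show "(\<Sum>C\<in>\<F> p. 1 + \<eta> / 2 * (\<Sum>j<n. G j C)) = real (card (\<F> p)) + \<eta> / 2 * (\<Sum>j<n. \<Sum>C\<in>\<F> p. G j C)"
        unfolding sum.distrib sum_distrib_left[symmetric] by simp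
    qed
    also have "\<dots> \<le> (\<Sum>p\<in>F. real (card (\<F> p)) + \<eta> / 2 * (real n * \<Lambda>))"
    proof (intro sum_mono add_left_mono mult_left_mono)
      fix p
      have "(\<Sum>j<n. \<Sum>C\<in>\<F> p. G j C) \<le> (\<Sum>j<n. \<Lambda>)" using sumG by (intro sum_mono) auto
      then show "(\<Sum>j<n. \<Sum>C\<in>\<F> p. G j C) \<le> real n * \<Lambda>" by simp
    qed (use \<eta> in auto)
    also have "\<dots> = real (\<Sum>p\<in>F. card (\<F> p)) + real (card F) * (\<eta> / 2 * (real n * \<Lambda>))"
      by (simp add: sum.distrib)
    also have "real (card F) * (\<eta> / 2 * (real n * \<Lambda>)) \<le> real n / 2"
    proof -
      have "real (card F) * (\<eta> / 2 * (real n * \<Lambda>)) = (real (card F) / m) * (real n / 2)"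
        using \<Lambda> by (simp add: \<eta>_def)
      also have "\<dots> \<le> 1 * (real n / 2)" using m by (intro mult_right_mono) (auto simp: m_def)
      finally show ?thesis by simp
    qed
    finally have "real n \<le> real (\<Sum>p\<in>F. card (\<F> p)) + real n / 2" by simp
    then have "real n \<le> real (2 * (\<Sum>p\<in>F. card (\<F> p)))" by simp
    then show ?thesis by (simp only: of_nat_le_iff)
  qed
  then show ?thesis by blast
qed

end

section \<open>The sum of the low eigenspaces\<close>

lemma sum_function_apply: "(\<Sum>a\<in>t. F a) x = (\<Sum>a\<in>t. F a x)"
  by (induction t rule: infinite_finite_induct) auto

context compact_riem
begin

definition low_space :: "real \<Rightarrow> ('a \<Rightarrow> complex) set" where
  "low_space \<Lambda> = complex_funs.span (\<Union>\<kappa>\<in>{..\<Lambda>}. eigenspace A g \<kappa>)"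

definition dirichlet :: "('a \<Rightarrow> complex) \<Rightarrow> ('a \<Rightarrow> complex) \<Rightarrow> complex" where
  "dirichlet u v = (LINT p|vol. grad_ip u v p)"

lemma eigenspace_smooth: "u \<in> eigenspace A g \<kappa> \<Longrightarrow> smooth_fun A u"
  by (simp add: eigenspace_def has_laplacian_def)

text \<open>The weak eigenvalue equation, tested with \<open>v\<close>.\<close>

lemma eigenspace_dirichlet:
  assumes "u \<in> eigenspace A g \<kappa>" "smooth_fun A v"
  shows "dirichlet u v = complex_of_real \<kappa> * ip u v"
proof -
  have "(LINT p|vol. complex_of_real \<kappa> * u p * cnj (v p)) = dirichlet u v"
    using assms by (auto simp: eigenspace_def has_laplacian_def dirichlet_def grad_ip_def)
  then show ?thesis by (simp add: ip_def mult.assoc)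
qed

lemma dirichlet_hermitian:
  assumes "smooth_fun A u" "smooth_fun A v"
  shows "dirichlet v u = cnj (dirichlet u v)"
proof -
  have "dirichlet v u = (LINT p|vol. cnj (grad_ip u v p))"
    unfolding dirichlet_def
    by (rule Bochner_Integration.integral_cong[OF refl]) (rule grad_ip_hermitian[OF assms])
  then show ?thesis by (simp add: dirichlet_def)
qed

text \<open>The Dirichlet form of \<open>u\<close> and \<open>v\<close> is
  \<open>\<kappa>\<close> times, and by symmetry also \<open>\<kappa>'\<close> times, their
  inner product.\<close>

lemma eigenspaces_orthogonal:
  assumes "u \<in> eigenspace A g \<kappa>" "v \<in> eigenspace A g \<kappa>'" "\<kappa> \<noteq> \<kappa>'"
  shows "ip u v = 0"
proof -
  note s = eigenspace_smooth[OF assms(1)] eigenspace_smooth[OF assms(2)]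
  have "complex_of_real \<kappa>' * ip v u = cnj (complex_of_real \<kappa> * ip u v)"
    using dirichlet_hermitian[OF s] eigenspace_dirichlet[OF assms(1) s(2)] eigenspace_dirichlet[OF assms(2) s(1)]
    by simp
  then have "complex_of_real \<kappa>' * cnj (ip u v) = complex_of_real \<kappa> * cnj (ip u v)"
    by (simp add: ip_hermitian[of v u])
  then show ?thesis using assms(3) by simp
qed

lemma low_space_explicit:
  assumes "u \<in> low_space \<Lambda>"
  shows "\<exists>t r \<kappa>. finite t \<and> (\<forall>a\<in>t. \<kappa> a \<le> \<Lambda> \<and> a \<in> eigenspace A g (\<kappa> a)) \<and> u = (\<lambda>p. \<Sum>a\<in>t. r a * a p)"
proof -
  obtain t r where t: "finite t" "t \<subseteq> (\<Union>\<kappa>\<in>{..\<Lambda>}. eigenspace A g \<kappa>)" "u = (\<Sum>a\<in>t. (\<lambda>x. r a * a x))"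
    using assms unfolding low_space_def complex_funs.span_explicit by blast
  have "\<forall>a\<in>t. \<exists>\<kappa>. \<kappa> \<le> \<Lambda> \<and> a \<in> eigenspace A g \<kappa>" using t(2) by auto
  then obtain \<kappa> where "\<forall>a\<in>t. \<kappa> a \<le> \<Lambda> \<and> a \<in> eigenspace A g (\<kappa> a)" by metis
  moreover have "u = (\<lambda>p. \<Sum>a\<in>t. r a * a p)" unfolding t(3) by (rule ext) (rule sum_function_apply)
  ultimately show ?thesis using t(1) by blast
qed

lemma low_space_smooth:
  assumes "u \<in> low_space \<Lambda>"
  shows "smooth_fun A u"
proof -
  obtain t r \<kappa> where t: "finite t" "\<forall>a\<in>t. \<kappa> a \<le> \<Lambda> \<and> a \<in> eigenspace A g (\<kappa> a)" "u = (\<lambda>p. \<Sum>a\<in>t. r a * a p)"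
    using low_space_explicit[OF assms] by blast
  show ?thesis unfolding t(3) using t(2) eigenspace_smooth by (intro smooth_fun_sum smooth_fun_cmult) blast
qed

lemma low_space_continuous: "u \<in> low_space \<Lambda> \<Longrightarrow> continuous_on UNIV u"
  by (rule smooth_fun_continuous[OF low_space_smooth])

lemma low_space_add: "u \<in> low_space \<Lambda> \<Longrightarrow> v \<in> low_space \<Lambda> \<Longrightarrow> (\<lambda>p. u p + v p) \<in> low_space \<Lambda>"
  unfolding low_space_def using complex_funs.span_add[of u _ v] by (simp add: plus_fun_def)

lemma low_space_scale: "u \<in> low_space \<Lambda> \<Longrightarrow> (\<lambda>p. a * u p) \<in> low_space \<Lambda>"
  unfolding low_space_def by (rule complex_funs.span_scale)

lemma low_space_sum:
  assumes "\<And>i. i \<in> I \<Longrightarrow> u i \<in> low_space \<Lambda>"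
  shows "(\<lambda>p. \<Sum>i\<in>I. a i * u i p) \<in> low_space \<Lambda>"
proof -
  have "(\<Sum>i\<in>I. (\<lambda>p. a i * u i p)) \<in> low_space \<Lambda>"
    unfolding low_space_def
    by (rule complex_funs.span_sum) (use assms low_space_scale in \<open>auto simp: low_space_def\<close>)
  also have "(\<Sum>i\<in>I. (\<lambda>p. a i * u i p)) = (\<lambda>p. \<Sum>i\<in>I. a i * u i p)" by (rule ext) (rule sum_function_apply)
  finally show ?thesis .
qed

lemma grad_ip_sum_left:
  assumes "\<And>i. i \<in> I \<Longrightarrow> smooth_fun A (u i)" "smooth_fun A w"
  shows "grad_ip (\<lambda>x. \<Sum>i\<in>I. a i * u i x) w p = (\<Sum>i\<in>I. a i * grad_ip (u i) w p)"
  using assms(1)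
proof (induction I rule: infinite_finite_induct)
  case (insert i I)
  then show ?case
    using grad_ip_add_left[OF smooth_fun_cmult[of "u i" "a i"] smooth_fun_sum[of I "\<lambda>i x. a i * u i x"] assms(2)]
    by (simp add: smooth_fun_cmult grad_ip_cmult_left assms(2))
next
  case empty
  show ?case using grad_ip_cmult_left[OF smooth_fun_zero assms(2), of 0] by simp
next
  case (infinite I)
  then show ?case using grad_ip_cmult_left[OF smooth_fun_zero assms(2), of 0] by simp
qed

text \<open>Write \<open>u = \<Sum> r a * a\<close> with eigenfunctions \<open>a\<close> of
  eigenvalue \<open>\<kappa> a\<close>. Then \<open>\<Lambda>\<close> times the square norm of
  \<open>u\<close> minus its energy is the square norm of \<open>w = \<Sum> sqrt (\<Lambda> -
  \<kappa> a) * r a * a\<close>: this needs \<open>\<Lambda> - \<kappa> a = sqrt (\<Lambda> -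
  \<kappa> a) * sqrt (\<Lambda> - \<kappa> b)\<close> only for pairs with \<open>\<kappa> a =
  \<kappa> b\<close>, the others being orthogonal.\<close>

lemma low_space_energy:
  assumes "u \<in> low_space \<Lambda>"
  shows "(LINT p|vol. grad_sq u p) \<le> \<Lambda> * (LINT p|vol. (cmod (u p))\<^sup>2)"
proof -
  obtain t r \<kappa> where t: "finite t" "\<forall>a\<in>t. \<kappa> a \<le> \<Lambda> \<and> a \<in> eigenspace A g (\<kappa> a)" and u: "u = (\<lambda>p. \<Sum>a\<in>t. r a * a p)"
    using low_space_explicit[OF assms] by blast
  have sm: "smooth_fun A a" if "a \<in> t" for a using t(2) that eigenspace_smooth by blast
  have cont: "continuous_on UNIV a" if "a \<in> t" for a by (rule smooth_fun_continuous[OF sm[OF that]])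
  have su: "smooth_fun A u" by (rule low_space_smooth[OF assms])
  have uc: "continuous_on UNIV u" by (rule smooth_fun_continuous[OF su])
  define \<sigma> where "\<sigma> a = sqrt (\<Lambda> - \<kappa> a)" for a
  define w where "w p = (\<Sum>a\<in>t. (complex_of_real (\<sigma> a) * r a) * a p)" for p
  have wc: "continuous_on UNIV w" unfolding w_def using cont by (intro continuous_intros)
  have ip_au: "ip a u = (\<Sum>b\<in>t. cnj (r b) * ip a b)" if "a \<in> t" for a
    unfolding u using cont that by (intro ip_sum_right) auto
  have "dirichlet u u = (LINT p|vol. (\<Sum>a\<in>t. r a * grad_ip a u p))"
    unfolding dirichlet_def
    by (rule Bochner_Integration.integral_cong[OF refl], subst (1) u, rule grad_ip_sum_left[OF sm su])
  also have "\<dots> = (\<Sum>a\<in>t. r a * dirichlet a u)"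
  proof -
    have "integrable vol (\<lambda>p. r a * grad_ip a u p)" if "a \<in> t" for a
      by (intro integrable_mult_right integrable_continuous continuous_grad_ip sm[OF that] su)
    then show ?thesis by (simp add: dirichlet_def)
  qed
  also have "\<dots> = (\<Sum>a\<in>t. r a * (complex_of_real (\<kappa> a) * ip a u))"
  proof (intro sum.cong refl)
    fix a assume "a \<in> t"
    then have "a \<in> eigenspace A g (\<kappa> a)" using t(2) by blast
    then show "r a * dirichlet a u = r a * (complex_of_real (\<kappa> a) * ip a u)"
      by (simp only: eigenspace_dirichlet[OF _ su])
  qed
  finally have D: "dirichlet u u = (\<Sum>a\<in>t. r a * (complex_of_real (\<kappa> a) * ip a u))" .
  have N: "ip u u = (\<Sum>a\<in>t. r a * ip a u)"
    by (subst (1) u) (intro ip_sum_left cont uc)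
  have "complex_of_real \<Lambda> * ip u u - dirichlet u u = (\<Sum>a\<in>t. r a * (complex_of_real (\<Lambda> - \<kappa> a) * ip a u))"
    unfolding N D by (simp add: sum_distrib_left sum_subtractf[symmetric] algebra_simps)
  also have "\<dots> = (\<Sum>a\<in>t. \<Sum>b\<in>t. r a * cnj (r b) * (complex_of_real (\<Lambda> - \<kappa> a) * ip a b))"
    by (intro sum.cong refl) (simp add: ip_au sum_distrib_left mult_ac)
  also have "\<dots> = (\<Sum>a\<in>t. \<Sum>b\<in>t. r a * cnj (r b) * (complex_of_real (\<sigma> a * \<sigma> b) * ip a b))"
  proof (intro sum.cong refl)
    fix a b assume ab: "a \<in> t" "b \<in> t"
    have "complex_of_real (\<Lambda> - \<kappa> a) * ip a b = complex_of_real (\<sigma> a * \<sigma> b) * ip a b"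
    proof (cases "\<kappa> a = \<kappa> b")
      case True
      then have "\<sigma> a * \<sigma> b = \<Lambda> - \<kappa> a" using t(2) ab by (simp add: \<sigma>_def)
      then show ?thesis by simp
    next
      case False
      then have "ip a b = 0" using eigenspaces_orthogonal t(2) ab by blast
      then show ?thesis by simp
    qed
    then show "r a * cnj (r b) * (complex_of_real (\<Lambda> - \<kappa> a) * ip a b) =
        r a * cnj (r b) * (complex_of_real (\<sigma> a * \<sigma> b) * ip a b)" by simp
  qed
  also have "\<dots> = ip w w"
  proof -
    have "ip w w = (\<Sum>a\<in>t. (complex_of_real (\<sigma> a) * r a) * ip a w)"
      by (subst (1) w_def[abs_def]) (intro ip_sum_left cont wc)
    also have "\<dots> = (\<Sum>a\<in>t. \<Sum>b\<in>t. r a * cnj (r b) * (complex_of_real (\<sigma> a * \<sigma> b) * ip a b))"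
    proof (intro sum.cong refl)
      fix a assume "a \<in> t"
      have "ip a w = (\<Sum>b\<in>t. cnj (complex_of_real (\<sigma> b) * r b) * ip a b)"
        unfolding w_def using cont \<open>a \<in> t\<close> by (intro ip_sum_right) auto
      then show "(complex_of_real (\<sigma> a) * r a) * ip a w =
          (\<Sum>b\<in>t. r a * cnj (r b) * (complex_of_real (\<sigma> a * \<sigma> b) * ip a b))"
        by (simp add: sum_distrib_left mult_ac)
    qed
    finally show ?thesis ..
  qed
  finally have "Re (complex_of_real \<Lambda> * ip u u - dirichlet u u) = Re (ip w w)" by simp
  moreover have w0: "(LINT p|vol. (cmod (w p))\<^sup>2) \<ge> 0" by (intro integral_nonneg_AE) auto
  moreover have "Re (dirichlet u u) = (LINT p|vol. grad_sq u p)"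
  proof -
    have "grad_ip u u = (\<lambda>p. complex_of_real (grad_sq u p))" by (rule ext) (rule grad_ip_self[OF su])
    then show ?thesis by (simp add: dirichlet_def)
  qed
  ultimately have "\<Lambda> * (LINT p|vol. (cmod (u p))\<^sup>2) - (LINT p|vol. grad_sq u p) = (LINT p|vol. (cmod (w p))\<^sup>2)"
    unfolding ip_self by simp
  then show ?thesis using w0 by linarith
qed

lemma integral_isometry:
  fixes F :: "'a \<Rightarrow> complex"
  assumes "isometry_of A g f" "continuous_on UNIV F"
  shows "(LINT p|vol. F (f p)) = (LINT p|vol. F p)"
proof -
  have f: "f \<in> measurable vol borel"
    using assms(1) continuous_borel[of f] by (auto simp: isometry_of_def smooth_map_def cong: measurable_cong_sets)
  have "(LINT p|vol. F p) = (LINT p|distr vol borel f. F p)" by (simp add: distr_isometry[OF assms(1)])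
  also have "\<dots> = (LINT p|vol. F (f p))" by (rule integral_distr[OF f continuous_borel[OF assms(2)]])
  finally show ?thesis ..
qed

text \<open>Test functions \<open>v\<close> correspond to test functions \<open>v \<circ> inv
  f\<close>, and both sides of the weak equation are invariant under the isometry.\<close>

lemma eigenspace_isometry:
  assumes f: "isometry_of A g f" and u: "u \<in> eigenspace A g \<kappa>"
  shows "u \<circ> f \<in> eigenspace A g \<kappa>"
proof -
  have f': "bij f" "smooth_map A f" "smooth_map A (inv f)" "preserves_metric A g f"
    using f by (auto simp: isometry_of_def)
  have su: "smooth_fun A u" by (rule eigenspace_smooth[OF u])
  have suf: "smooth_fun A (u \<circ> f)" by (rule smooth_fun_comp[OF f'(2) su])
  have "(LINT p|vol. complex_of_real \<kappa> * (u \<circ> f) p * cnj (v p)) =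
      (LINT p|vol. gradient_product A g (u \<circ> f) (\<lambda>q. cnj (v q)) p)" if v: "smooth_fun A v" for v
  proof -
    let ?w = "v \<circ> inv f"
    have sw: "smooth_fun A ?w" by (rule smooth_fun_comp[OF f'(3) v])
    have wf: "?w (f p) = v p" for p using f'(1) by (simp add: bij_is_inj)
    have "(LINT p|vol. complex_of_real \<kappa> * (u \<circ> f) p * cnj (v p)) =
        (LINT p|vol. (\<lambda>q. complex_of_real \<kappa> * u q * cnj (?w q)) (f p))"
      using wf by simp
    also have "\<dots> = (LINT q|vol. complex_of_real \<kappa> * u q * cnj (?w q))"
      by (rule integral_isometry[OF f]) (intro continuous_intros smooth_fun_continuous su sw)
    also have "\<dots> = (LINT q|vol. grad_ip u ?w q)"
      using u sw unfolding eigenspace_def has_laplacian_def grad_ip_def by blast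
    also have "\<dots> = (LINT p|vol. grad_ip u ?w (f p))"
      by (rule integral_isometry[OF f continuous_grad_ip[OF su sw], symmetric])
    also have "\<dots> = (LINT p|vol. grad_ip (u \<circ> f) (?w \<circ> f) p)"
      by (simp only: grad_ip_comp[OF f'(2,4) su sw])
    also have "?w \<circ> f = v" using wf by (simp add: fun_eq_iff)
    finally show ?thesis by (simp only: grad_ip_def)
  qed
  then show ?thesis
    using suf smooth_fun_cmult[OF suf] unfolding eigenspace_def has_laplacian_def by blast
qed

lemma low_space_isometry:
  assumes "isometry_of A g f" "u \<in> low_space \<Lambda>"
  shows "u \<circ> f \<in> low_space \<Lambda>"
proof -
  obtain t r \<kappa> where t: "finite t" "\<forall>a\<in>t. \<kappa> a \<le> \<Lambda> \<and> a \<in> eigenspace A g (\<kappa> a)" and u: "u = (\<lambda>p. \<Sum>a\<in>t. r a * a p)"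
    using low_space_explicit[OF assms(2)] by blast
  have "a \<circ> f \<in> low_space \<Lambda>" if "a \<in> t" for a
    unfolding low_space_def using t(2) that eigenspace_isometry[OF assms(1)]
    by (intro complex_funs.span_base) auto
  then have "(\<lambda>p. \<Sum>a\<in>t. r a * (a \<circ> f) p) \<in> low_space \<Lambda>" by (rule low_space_sum)
  then show ?thesis by (simp add: u o_def)
qed

section \<open>Maximal orthonormal systems\<close>

text \<open>Otherwise \<open>w\<close> would be nonzero on a nonempty open set, which has
  positive volume.\<close>

lemma continuous_null:
  assumes "continuous_on UNIV w" "ip w w = 0"
  shows "w p = 0"
proof (rule ccontr)
  assume "w p \<noteq> 0"
  have "complex_of_real (LINT p|vol. (cmod (w p))\<^sup>2) = 0" using assms(2) by (simp only: ip_self)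
  then have "(LINT p|vol. (cmod (w p))\<^sup>2) = 0" by (simp only: of_real_eq_0_iff)
  moreover have "integrable vol (\<lambda>p. (cmod (w p))\<^sup>2)"
    by (intro integrable_continuous continuous_intros assms(1))
  ultimately have "AE p in vol. (cmod (w p))\<^sup>2 = 0"
    by (subst (asm) integral_nonneg_eq_0_iff_AE) auto
  then have ae: "AE p in vol. \<not> w p \<noteq> 0" by simp
  have op: "open {p. w p \<noteq> 0}"
  proof -
    have "open (w -` (- {0}))" by (intro open_vimage assms(1)) auto
    also have "w -` (- {0}) = {p. w p \<noteq> 0}" by auto
    finally show ?thesis .
  qed
  then have "emeasure vol {p. w p \<noteq> 0} = 0"
    using ae by (subst (asm) AE_iff_measurable[of "{p. w p \<noteq> 0}"]) auto
  then show False
    using emeasure_vol_open_pos[OF op] \<open>w p \<noteq> 0\<close> by auto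
qed

text \<open>The number \<open>n\<close> is an upper bound; it is the maximum where an
  orthonormal system of \<open>n\<close> members is also given.\<close>

definition max_system_size :: "real \<Rightarrow> nat \<Rightarrow> bool" where
  "max_system_size \<Lambda> n \<longleftrightarrow> (\<forall>m \<phi>. orthonormal {..<m} \<phi> \<and> (\<forall>j<m. \<phi> j \<in> low_space \<Lambda>) \<longrightarrow> m \<le> n)"

lemma orthonormal_norm:
  assumes "orthonormal I \<phi>" "j \<in> I"
  shows "(LINT p|vol. (cmod (\<phi> j p))\<^sup>2) = 1"
proof -
  have "complex_of_real (LINT p|vol. (cmod (\<phi> j p))\<^sup>2) = 1"
    using assms unfolding ip_self[symmetric] by (simp add: orthonormal_def)
  then show ?thesis by (simp only: of_real_eq_1_iff)
qed

text \<open>Members of \<open>V\<close> of norm \<open>1\<close> have energy at most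
  \<open>\<Lambda>\<close>, so the sizes of orthonormal systems in \<open>V\<close> are
  bounded.\<close>

lemma ex_maximal_system:
  assumes "\<Lambda> > 0"
  shows "\<exists>n \<phi>. max_system_size \<Lambda> n \<and> orthonormal {..<n} \<phi> \<and> (\<forall>j<n. \<phi> j \<in> low_space \<Lambda>)"
proof -
  obtain N where N: "\<And>(n::nat) \<phi>. orthonormal {..<n} \<phi> \<Longrightarrow> (\<forall>j<n. smooth_fun A (\<phi> j)) \<Longrightarrow>
    (\<forall>j<n. (LINT p|vol. grad_sq (\<phi> j) p) \<le> \<Lambda>) \<Longrightarrow> n \<le> N"
    using orthonormal_system_bound[OF assms] by blast
  let ?P = "\<lambda>n::nat. \<exists>\<phi>. orthonormal {..<n} \<phi> \<and> (\<forall>j<n. \<phi> j \<in> low_space \<Lambda>)"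
  have "n \<le> N" if "?P n" for n
  proof -
    obtain \<phi> where \<phi>: "orthonormal {..<n} \<phi>" "\<forall>j<n. \<phi> j \<in> low_space \<Lambda>" using \<open>?P n\<close> by blast
    have "(LINT p|vol. grad_sq (\<phi> j) p) \<le> \<Lambda>" if "j < n" for j
      using low_space_energy[of "\<phi> j" \<Lambda>] \<phi>(2) orthonormal_norm[OF \<phi>(1), of j] that by simp
    then show ?thesis using N[OF \<phi>(1)] \<phi>(2) low_space_smooth by blast
  qed
  note bound = this
  have P0: "?P 0" by (simp add: orthonormal_def)
  have "?P (Greatest ?P)" using P0 bound by (rule GreatestI_nat)
  moreover have "m \<le> Greatest ?P" if "?P m" for m using that bound by (rule Greatest_le_nat)
  ultimately show ?thesis unfolding max_system_size_def by blast
qed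

text \<open>If \<open>u\<close> differed from its projection, the normalised remainder
  \<open>e\<close> would enlarge the system. As the remainder is continuous, it vanishes at
  every point and not just almost everywhere.\<close>

lemma maximal_system_expansion:
  assumes max: "max_system_size \<Lambda> n" and on: "orthonormal {..<n} \<phi>" and V: "\<forall>j<n. \<phi> j \<in> low_space \<Lambda>"
    and u: "u \<in> low_space \<Lambda>"
  shows "u p = (\<Sum>j<n. ip u (\<phi> j) * \<phi> j p)"
proof -
  have cont: "continuous_on UNIV (\<phi> j)" if "j < n" for j using on that by (auto simp: orthonormal_def)
  define v where "v p = (\<Sum>j<n. ip u (\<phi> j) * \<phi> j p)" for p
  have vV: "v \<in> low_space \<Lambda>" unfolding v_def using V by (intro low_space_sum) auto
  define w where "w p = u p + (- 1) * v p" for p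
  have wV: "w \<in> low_space \<Lambda>" unfolding w_def by (intro low_space_add low_space_scale u vV)
  have wc: "continuous_on UNIV w" and uc: "continuous_on UNIV u" and vc: "continuous_on UNIV v"
    by (rule low_space_continuous, fact)+
  have w\<phi>: "ip w (\<phi> j) = 0" if j: "j < n" for j
  proof -
    have "ip w (\<phi> j) = ip u (\<phi> j) + ip (\<lambda>p. (- 1) * v p) (\<phi> j)"
      unfolding w_def by (intro ip_add_left uc continuous_intros vc cont j)
    also have "ip (\<lambda>p. (- 1) * v p) (\<phi> j) = (- 1) * ip v (\<phi> j)" by (rule ip_cmult_left)
    also have "ip v (\<phi> j) = ip u (\<phi> j)"
      unfolding v_def using j by (intro orthonormal_ip_basis[OF on]) simp
    finally show ?thesis by simp
  qed
  have "ip w w = 0"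
  proof (rule ccontr)
    assume nz: "ip w w \<noteq> 0"
    define s where "s = (LINT p|vol. (cmod (w p))\<^sup>2)"
    have ww: "ip w w = complex_of_real s" unfolding s_def by (rule ip_self)
    have "s \<ge> 0" unfolding s_def by (intro integral_nonneg_AE) auto
    then have s: "s > 0" using nz ww by (cases "s = 0") auto
    define e where "e p = complex_of_real (1 / sqrt s) * w p" for p
    have ec: "continuous_on UNIV e" unfolding e_def by (intro continuous_intros wc)
    have e\<phi>: "ip e (\<phi> j) = 0" if "j < n" for j
      unfolding e_def ip_cmult_left using w\<phi>[OF that] by simp
    then have \<phi>e: "ip (\<phi> j) e = 0" if "j < n" for j
      using that by (simp add: ip_hermitian[of "\<phi> j" e])
    have "ip w e = complex_of_real (1 / sqrt s) * ip w w"
      unfolding ip_hermitian[of w e] e_def ip_cmult_left by (simp add: ww)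
    then have "ip e e = complex_of_real (1 / sqrt s) * (complex_of_real (1 / sqrt s) * complex_of_real s)"
      by (subst (1) e_def[abs_def]) (simp only: ip_cmult_left ww)
    also have "\<dots> = complex_of_real (1 / sqrt s * (1 / sqrt s) * s)" by (simp only: of_real_mult mult.assoc)
    also have "1 / sqrt s * (1 / sqrt s) * s = 1" using s by (simp add: real_div_sqrt)
    finally have ee: "ip e e = 1" by simp
    let ?\<psi> = "\<phi>(n := e)"
    have "orthonormal {..<Suc n} ?\<psi>"
      using on ee e\<phi> \<phi>e ec unfolding orthonormal_def by (auto simp: less_Suc_eq)
    moreover have "\<forall>j<Suc n. ?\<psi> j \<in> low_space \<Lambda>"
      using V low_space_scale[OF wV, of "complex_of_real (1 / sqrt s)", folded e_def[abs_def]]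
      by (auto simp: less_Suc_eq)
    ultimately have "Suc n \<le> n" using max unfolding max_system_size_def by blast
    then show False by simp
  qed
  then have "w p = 0" by (rule continuous_null[OF wc])
  then show ?thesis by (simp add: w_def v_def)
qed

lemma ip_isometry:
  assumes "isometry_of A g f" "continuous_on UNIV u" "continuous_on UNIV v"
  shows "ip (u \<circ> f) (v \<circ> f) = ip u v"
  unfolding ip_def
  using integral_isometry[OF assms(1), of "\<lambda>p. u p * cnj (v p)"] assms(2,3)
  by (simp add: continuous_on_mult continuous_on_cnj)

text \<open>The trace of a sesquilinear form in an orthonormal basis does not depend on the
  basis; the unitary matrix \<open>a\<close> enters through the orthonormality of its
  columns.\<close>

lemma trace_unitary_invariance:
  fixes a :: "nat \<Rightarrow> nat \<Rightarrow> complex"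
  assumes "\<And>l m. l < n \<Longrightarrow> m < n \<Longrightarrow> (\<Sum>j<n. a j l * cnj (a j m)) = (if l = m then 1 else 0)"
  shows "(\<Sum>j<n. \<Sum>l<n. \<Sum>m<n. a j l * cnj (a j m) * S l m) = (\<Sum>l<n. S l l)"
proof -
  have "(\<Sum>j<n. \<Sum>l<n. \<Sum>m<n. a j l * cnj (a j m) * S l m) = (\<Sum>l<n. \<Sum>j<n. \<Sum>m<n. a j l * cnj (a j m) * S l m)"
    by (rule sum.swap)
  also have "\<dots> = (\<Sum>l<n. \<Sum>m<n. \<Sum>j<n. a j l * cnj (a j m) * S l m)"
    by (intro sum.cong refl sum.swap)
  also have "\<dots> = (\<Sum>l<n. \<Sum>m<n. if l = m then S l m else 0)"
    using assms by (intro sum.cong refl) (simp add: sum_distrib_right[symmetric])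
  also have "\<dots> = (\<Sum>l<n. S l l)" by simp
  finally show ?thesis .
qed

context
  fixes \<Lambda> n \<phi> f
  assumes max: "max_system_size \<Lambda> n" and on: "orthonormal {..<n} \<phi>" and V: "\<forall>j<n. \<phi> j \<in> low_space \<Lambda>"
    and f: "isometry_of A g f"
begin

text \<open>The functions \<open>\<phi> j \<circ> f\<close> form an orthonormal system of
  maximal size too. Expanding them in the \<open>\<phi> l\<close> gives the matrix; expanding
  the \<open>\<phi> l\<close> in them shows that its columns are orthonormal.\<close>

lemma rotated_system:
  shows "\<And>j p. j < n \<Longrightarrow> \<phi> j (f p) = (\<Sum>l<n. ip (\<phi> j \<circ> f) (\<phi> l) * \<phi> l p)"
    and "\<And>l m. l < n \<Longrightarrow> m < n \<Longrightarrow>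
      (\<Sum>j<n. ip (\<phi> j \<circ> f) (\<phi> l) * cnj (ip (\<phi> j \<circ> f) (\<phi> m))) = (if l = m then 1 else 0)"
proof -
  let ?\<psi> = "\<lambda>j. \<phi> j \<circ> f"
  have \<psi>V: "\<forall>j<n. ?\<psi> j \<in> low_space \<Lambda>" using V low_space_isometry[OF f] by blast
  have on\<psi>: "orthonormal {..<n} ?\<psi>"
    unfolding orthonormal_def
  proof (intro conjI ballI)
    show "continuous_on UNIV (?\<psi> j)" if "j \<in> {..<n}" for j
      using \<psi>V low_space_continuous that by blast
    show "ip (?\<psi> i) (?\<psi> j) = (if i = j then 1 else 0)" if "i \<in> {..<n}" "j \<in> {..<n}" for i j
    proof -
      have "ip (?\<psi> i) (?\<psi> j) = ip (\<phi> i) (\<phi> j)"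
        using on that unfolding orthonormal_def by (intro ip_isometry[OF f]) blast+
      then show ?thesis using on that unfolding orthonormal_def by simp
    qed
  qed simp
  show "\<phi> j (f p) = (\<Sum>l<n. ip (?\<psi> j) (\<phi> l) * \<phi> l p)" if "j < n" for j p
    using maximal_system_expansion[OF max on V, of "?\<psi> j" p] \<psi>V that by simp
  fix l m assume lm: "l < n" "m < n"
  have exp: "\<phi> l = (\<lambda>p. \<Sum>j<n. ip (\<phi> l) (?\<psi> j) * ?\<psi> j p)" if "l < n" for l
    using maximal_system_expansion[OF max on\<psi> \<psi>V, of "\<phi> l"] V that by blast
  have "ip (\<phi> m) (\<phi> l) = (\<Sum>j<n. ip (\<phi> m) (?\<psi> j) * cnj (ip (\<phi> l) (?\<psi> j)))"
    by (subst (1) exp[OF lm(1)], subst (1) exp[OF lm(2)]) (rule orthonormal_ip_sum[OF on\<psi>])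
  moreover have "ip (\<phi> m) (\<phi> l) = (if l = m then 1 else 0)"
    using on lm by (auto simp: orthonormal_def)
  ultimately show "(\<Sum>j<n. ip (?\<psi> j) (\<phi> l) * cnj (ip (?\<psi> j) (\<phi> m))) = (if l = m then 1 else 0)"
    by (simp add: ip_hermitian[of "\<phi> _" "?\<psi> _"] mult.commute)
qed

text \<open>The sum is the trace of the form \<open>\<phi> l p * cnj (\<phi> m
  p)\<close>.\<close>

lemma kernel_isometry: "(\<Sum>j<n. (cmod (\<phi> j (f p)))\<^sup>2) = (\<Sum>j<n. (cmod (\<phi> j p))\<^sup>2)"
proof -
  let ?a = "\<lambda>j l. ip (\<phi> j \<circ> f) (\<phi> l)"
  have "complex_of_real (\<Sum>j<n. (cmod (\<phi> j (f p)))\<^sup>2) = (\<Sum>j<n. \<phi> j (f p) * cnj (\<phi> j (f p)))"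
    unfolding of_real_sum by (simp only: complex_norm_square)
  also have "\<dots> = (\<Sum>j<n. \<Sum>l<n. \<Sum>m<n. ?a j l * cnj (?a j m) * (\<phi> l p * cnj (\<phi> m p)))"
    by (intro sum.cong refl) (simp add: rotated_system(1) sum_product mult_ac)
  also have "\<dots> = (\<Sum>l<n. \<phi> l p * cnj (\<phi> l p))"
    by (rule trace_unitary_invariance[OF rotated_system(2)])
  also have "\<dots> = complex_of_real (\<Sum>j<n. (cmod (\<phi> j p))\<^sup>2)"
    unfolding of_real_sum by (simp only: complex_norm_square)
  finally show ?thesis by (simp only: of_real_eq_iff)
qed

text \<open>The sum is the trace of the form \<open>grad_ip (\<phi> l) (\<phi> m)
  p\<close>.\<close>

lemma energy_isometry: "(\<Sum>j<n. grad_sq (\<phi> j) (f p)) = (\<Sum>j<n. grad_sq (\<phi> j) p)"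
proof -
  let ?a = "\<lambda>j l. ip (\<phi> j \<circ> f) (\<phi> l)"
  have f': "smooth_map A f" "preserves_metric A g f" using f by (auto simp: isometry_of_def)
  have sm: "smooth_fun A (\<phi> j)" if "j < n" for j using V that low_space_smooth by blast
  have expand: "grad_ip (\<phi> j) (\<phi> j) (f p) = (\<Sum>l<n. \<Sum>m<n. ?a j l * cnj (?a j m) * grad_ip (\<phi> l) (\<phi> m) p)"
    if j: "j < n" for j
  proof -
    have eq: "\<phi> j \<circ> f = (\<lambda>p. \<Sum>l<n. ?a j l * \<phi> l p)" using rotated_system(1)[OF j] by (simp add: fun_eq_iff)
    have sj: "smooth_fun A (\<phi> j \<circ> f)" by (rule smooth_fun_comp[OF f'(1) sm[OF j]])
    have "grad_ip (\<phi> j) (\<phi> j) (f p) = grad_ip (\<phi> j \<circ> f) (\<phi> j \<circ> f) p"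
      by (rule grad_ip_comp[OF f' sm[OF j] sm[OF j], symmetric])
    also have "\<dots> = (\<Sum>l<n. ?a j l * grad_ip (\<phi> l) (\<phi> j \<circ> f) p)"
      by (subst (1) eq, rule grad_ip_sum_left) (use sm sj in auto)
    also have "\<dots> = (\<Sum>l<n. \<Sum>m<n. ?a j l * cnj (?a j m) * grad_ip (\<phi> l) (\<phi> m) p)"
    proof (intro sum.cong refl)
      fix l assume "l \<in> {..<n}"
      then have l: "l < n" by simp
      have "grad_ip (\<phi> l) (\<phi> j \<circ> f) p = cnj (grad_ip (\<phi> j \<circ> f) (\<phi> l) p)"
        by (rule grad_ip_hermitian[OF sj sm[OF l]])
      also have "grad_ip (\<phi> j \<circ> f) (\<phi> l) p = (\<Sum>m<n. ?a j m * grad_ip (\<phi> m) (\<phi> l) p)"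
        by (subst (1) eq, rule grad_ip_sum_left) (use sm l in auto)
      also have "cnj \<dots> = (\<Sum>m<n. cnj (?a j m) * grad_ip (\<phi> l) (\<phi> m) p)"
        unfolding cnj_sum complex_cnj_mult
        by (intro sum.cong refl) (simp add: grad_ip_hermitian[OF sm sm[OF l], symmetric])
      finally show "?a j l * grad_ip (\<phi> l) (\<phi> j \<circ> f) p = (\<Sum>m<n. ?a j l * cnj (?a j m) * grad_ip (\<phi> l) (\<phi> m) p)"
        by (simp only: sum_distrib_left mult.assoc)
    qed
    finally show ?thesis .
  qed
  have "complex_of_real (\<Sum>j<n. grad_sq (\<phi> j) (f p)) = (\<Sum>j<n. grad_ip (\<phi> j) (\<phi> j) (f p))"
    unfolding of_real_sum by (intro sum.cong refl) (simp add: grad_ip_self sm)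
  also have "\<dots> = (\<Sum>j<n. \<Sum>l<n. \<Sum>m<n. ?a j l * cnj (?a j m) * grad_ip (\<phi> l) (\<phi> m) p)"
    by (intro sum.cong refl) (simp add: expand)
  also have "\<dots> = (\<Sum>l<n. grad_ip (\<phi> l) (\<phi> l) p)"
    by (rule trace_unitary_invariance[OF rotated_system(2)])
  also have "\<dots> = complex_of_real (\<Sum>j<n. grad_sq (\<phi> j) p)"
    unfolding of_real_sum by (intro sum.cong refl) (simp add: grad_ip_self sm)
  finally show ?thesis by (simp only: of_real_eq_iff)
qed

end

lemma edim_low_space:
  assumes "max_system_size \<Lambda> n" "orthonormal {..<n} \<phi>" "\<forall>j<n. \<phi> j \<in> low_space \<Lambda>"
  shows "edim (low_space \<Lambda>) \<le> enat n"
  unfolding edim_def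
proof (rule Sup_least)
  fix x assume "x \<in> {enat (card B) | B. B \<subseteq> low_space \<Lambda> \<and> finite B \<and> complex_funs.independent B}"
  then obtain B where B: "x = enat (card B)" "B \<subseteq> low_space \<Lambda>" "complex_funs.independent B" by blast
  have "low_space \<Lambda> \<subseteq> complex_funs.span (\<phi> ` {..<n})"
  proof
    fix u assume u: "u \<in> low_space \<Lambda>"
    have "u = (\<Sum>j<n. (\<lambda>p. ip u (\<phi> j) * \<phi> j p))"
      using maximal_system_expansion[OF assms u] by (simp add: fun_eq_iff sum_function_apply)
    also have "\<dots> \<in> complex_funs.span (\<phi> ` {..<n})"
      by (intro complex_funs.span_sum complex_funs.span_scale complex_funs.span_base) auto
    finally show "u \<in> complex_funs.span (\<phi> ` {..<n})" .
  qed
  then have "card B \<le> card (\<phi> ` {..<n})"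
    using complex_funs.independent_span_bound[of "\<phi> ` {..<n}" B] B by auto
  also have "\<dots> \<le> n" using card_image_le[of "{..<n}" \<phi>] by simp
  finally show "x \<le> enat n" using B(1) by simp
qed

end

section \<open>Layer cake on metric balls\<close>

text \<open>The derivative of \<open>- (cos (s r))\<^sup>2\<close> is \<open>s sin (2 s
  r)\<close>, and the cosine vanishes at the upper end. This represents the squared cosine by
  its level sets.\<close>

lemma has_integral_sin_double:
  fixes s \<rho> :: real
  assumes "s > 0" "\<rho> \<le> pi / (2 * s)"
  shows "((\<lambda>r. s * sin (2 * s * r)) has_integral (cos (s * \<rho>))\<^sup>2) {\<rho>..pi / (2 * s)}"
proof -
  have "((\<lambda>r. s * sin (2 * s * r)) has_integral
      (- (cos (s * (pi / (2 * s))))\<^sup>2 - (- (cos (s * \<rho>))\<^sup>2))) {\<rho>..pi / (2 * s)}"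
  proof (rule fundamental_theorem_of_calculus[OF assms(2)])
    fix r
    have "((\<lambda>r. - (cos (s * r))\<^sup>2) has_real_derivative s * sin (2 * s * r)) (at r)"
    proof -
      have "sin (2 * s * r) = 2 * sin (s * r) * cos (s * r)"
        using sin_double[of "s * r"] by (simp add: mult.assoc)
      then show ?thesis by (auto intro!: derivative_eq_intros)
    qed
    then show "((\<lambda>r. - (cos (s * r))\<^sup>2) has_vector_derivative s * sin (2 * s * r)) (at r within {\<rho>..pi / (2 * s)})"
      by (simp add: has_real_derivative_iff_has_vector_derivative has_vector_derivative_at_within)
  qed
  moreover have "- (cos (s * (pi / (2 * s))))\<^sup>2 - (- (cos (s * \<rho>))\<^sup>2) = (cos (s * \<rho>))\<^sup>2"
  proof -
    have "s * (pi / (2 * s)) = pi / 2" using assms(1) by simp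
    then show ?thesis by (simp only: cos_pi_half) simp
  qed
  ultimately show ?thesis by (simp only:)
qed

lemma moment_integrand_nonneg: "\<theta> \<in> {0..pi/2} \<Longrightarrow> 0 \<le> \<theta> ^ d * sin (2 * \<theta>)"
  by (intro mult_nonneg_nonneg sin_ge_zero) auto

lemma has_integral_moment: "((\<lambda>\<theta>. \<theta> ^ d * sin (2 * \<theta>)) has_integral moment d) {0..pi/2}"
  unfolding moment_def by (intro integrable_integral integrable_continuous_interval continuous_intros)

lemma moment_pos: "moment d > 0"
proof -
  have "moment d \<ge> 0"
    using has_integral_nonneg[OF has_integral_moment moment_integrand_nonneg] .
  moreover have "moment d \<noteq> 0"
  proof
    assume "moment d = 0"
    then have "((\<lambda>\<theta>. \<theta> ^ d * sin (2 * \<theta>)) has_integral 0) (cbox 0 (pi/2))"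
      using has_integral_moment[of d] by simp
    then have "(pi / 4) ^ d * sin (2 * (pi / 4)) = 0"
      by (rule has_integral_0_cbox_imp_0[rotated 2])
        (auto intro!: continuous_intros moment_integrand_nonneg simp: box_real pi_gt_zero[THEN not_le[THEN iffD2]])
    then show False by simp
  qed
  ultimately show ?thesis by simp
qed

text \<open>The substitution \<open>\<theta> = s r\<close>.\<close>

lemma has_integral_scaled_moment:
  fixes s :: real
  assumes s: "s > 0"
  shows "((\<lambda>r. s * sin (2 * s * r) * (c * r ^ d)) has_integral c * moment d / s ^ d) {0..pi / (2 * s)}"
proof -
  have "((\<lambda>r. (s * r) ^ d * sin (2 * (s * r))) has_integral (1 / s) * moment d) ((\<lambda>x. x / s) ` {0..pi/2})"
  proof -
    have "((\<lambda>\<theta>. \<theta> ^ d * sin (2 * \<theta>)) has_integral moment d) (cbox 0 (pi/2))"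
      using has_integral_moment by simp
    from has_integral_affinity[OF this, of s 0] s show ?thesis by simp
  qed
  also have "(\<lambda>x. x / s) ` {0..pi/2} = {0..pi / (2 * s)}"
    using s by (simp add: image_divide_atLeastAtMost)
  finally have "((\<lambda>r. (c * s / s ^ d) * ((s * r) ^ d * sin (2 * (s * r)))) has_integral
      (c * s / s ^ d) * ((1 / s) * moment d)) {0..pi / (2 * s)}"
    by (rule has_integral_mult_right)
  moreover have "(c * s / s ^ d) * ((s * r) ^ d * sin (2 * (s * r))) = s * sin (2 * s * r) * (c * r ^ d)" for r
    using s by (simp add: power_mult_distrib mult.assoc)
  ultimately show ?thesis using s by simp
qed

text \<open>The squared cosine at \<open>\<rho> x\<close> is the integral of \<open>s sin (2 s
  r)\<close> over the radii \<open>r\<close> between \<open>\<rho> x\<close> and \<open>pi / (2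
  s)\<close>. After exchanging the integrals, the inner one is the measure of the ball of radius
  \<open>r\<close>, for which the lower bound is inserted.\<close>

lemma nn_integral_layer_cake_cos:
  fixes \<rho> :: "'x \<Rightarrow> real"
  assumes M: "finite_measure M" and s: "s > 0" and \<rho>0: "\<And>x. x \<in> space M \<Longrightarrow> \<rho> x \<ge> 0"
    and balls: "\<And>r. 0 < r \<Longrightarrow> r \<le> pi / (2 * s) \<Longrightarrow> {x \<in> space M. \<rho> x < r} \<in> sets M"
    and vol: "\<And>r. 0 < r \<Longrightarrow> r \<le> pi / (2 * s) \<Longrightarrow> c * r ^ d \<le> measure M {x \<in> space M. \<rho> x < r}"
    and c: "c \<ge> 0"
  shows "ennreal (c * moment d / s ^ d) \<le>
    (\<integral>\<^sup>+x. ennreal (if \<rho> x < pi / (2 * s) then (cos (s * \<rho> x))\<^sup>2 else 0) \<partial>M)"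
proof -
  interpret finite_measure M by (rule M)
  interpret pair_sigma_finite M "lborel :: real measure" ..
  define R where "R = pi / (2 * s)"
  have R: "R > 0" using s by (simp add: R_def)
  \<comment> \<open>Only the balls up to radius \<open>R\<close> are known to be measurable, so
    \<open>\<rho>\<close> is cut off there.\<close>
  define \<tau> where "\<tau> x = min (\<rho> x) R" for x
  have \<tau> [measurable]: "\<tau> \<in> borel_measurable M"
  proof (rule borel_measurableI_less)
    fix r
    consider "r \<le> 0" | "0 < r" "r \<le> R" | "r > R" by linarith
    then show "{x \<in> space M. \<tau> x < r} \<in> sets M"
    proof cases
      case 1
      then have eq: "{x \<in> space M. \<tau> x < r} = {}" using \<rho>0 R by (force simp: \<tau>_def)
      show ?thesis unfolding eq by simp
    next
      case 2
      then have eq: "{x \<in> space M. \<tau> x < r} = {x \<in> space M. \<rho> x < r}" by (auto simp: \<tau>_def)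
      show ?thesis unfolding eq using 2 by (intro balls) (simp_all add: R_def)
    next
      case 3
      then have eq: "{x \<in> space M. \<tau> x < r} = space M" by (auto simp: \<tau>_def)
      show ?thesis unfolding eq by simp
    qed
  qed
  define w where "w r = ennreal (indicator {0..R} r * (s * sin (2 * s * r)))" for r
  have w [measurable]: "w \<in> borel_measurable borel"
    unfolding w_def by measurable
  have sin0: "0 \<le> s * sin (2 * s * r)" if "r \<in> {0..R}" for r
  proof -
    have "2 * s * r \<le> 2 * s * R" using that s by (intro mult_left_mono) auto
    then have "2 * s * r \<le> pi" using s by (simp add: R_def)
    then show ?thesis using that s by (intro mult_nonneg_nonneg sin_ge_zero) auto
  qed
  have inner: "(\<integral>\<^sup>+r. w r * indicator {r. \<tau> x < r} r \<partial>lborel) =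
      ennreal (if \<rho> x < R then (cos (s * \<rho> x))\<^sup>2 else 0)" if x: "x \<in> space M" for x
  proof (cases "\<rho> x < R")
    case True
    have hi: "((\<lambda>r. s * sin (2 * s * r)) has_integral (cos (s * \<rho> x))\<^sup>2) {\<rho> x..R}"
      using has_integral_sin_double[OF s, of "\<rho> x"] True by (simp add: R_def)
    have "(\<lambda>r. s * sin (2 * s * r)) absolutely_integrable_on {\<rho> x..R}"
      by (intro absolutely_integrable_continuous_real continuous_intros)
    moreover have "(\<lambda>r. indicator {\<rho> x..R} r * (s * sin (2 * s * r))) \<in> borel_measurable borel"
      by measurable
    ultimately have "(\<integral>\<^sup>+r\<in>{\<rho> x..R}. ennreal (s * sin (2 * s * r)) \<partial>lborel) =
        ennreal (integral {\<rho> x..R} (\<lambda>r. s * sin (2 * s * r)))"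
      using sin0 \<rho>0[OF x] by (intro nn_integral_eq_integral_on) auto
    also have "integral {\<rho> x..R} (\<lambda>r. s * sin (2 * s * r)) = (cos (s * \<rho> x))\<^sup>2"
      by (rule integral_unique[OF hi])
    finally have "(\<integral>\<^sup>+r\<in>{\<rho> x..R}. ennreal (s * sin (2 * s * r)) \<partial>lborel) = ennreal ((cos (s * \<rho> x))\<^sup>2)" .
    moreover have "(\<integral>\<^sup>+r. w r * indicator {r. \<tau> x < r} r \<partial>lborel) =
        (\<integral>\<^sup>+r\<in>{\<rho> x..R}. ennreal (s * sin (2 * s * r)) \<partial>lborel)"
    proof (rule nn_integral_cong_AE)
      show "AE r in lborel. w r * indicator {r. \<tau> x < r} r = ennreal (s * sin (2 * s * r)) * indicator {\<rho> x..R} r"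
        using AE_lborel_singleton[of "\<rho> x"]
        by eventually_elim (use True \<rho>0[OF x] in \<open>auto simp: w_def \<tau>_def indicator_def\<close>)
    qed
    ultimately show ?thesis using True by simp
  next
    case False
    then have eq: "w r * indicator {r. \<tau> x < r} r = 0" for r by (auto simp: w_def \<tau>_def indicator_def)
    show ?thesis unfolding eq using False by simp
  qed
  have mJ: "(\<lambda>(x, r). w r * indicator {r. \<tau> x < r} r) \<in> borel_measurable (M \<Otimes>\<^sub>M lborel)"
  proof -
    have "(\<lambda>(x, r). w r * (if \<tau> x < r then 1 else 0 :: ennreal)) \<in> borel_measurable (M \<Otimes>\<^sub>M lborel)"
      by measurable
    also have "(\<lambda>(x, r). w r * (if \<tau> x < r then 1 else 0 :: ennreal)) = (\<lambda>(x, r). w r * indicator {r. \<tau> x < r} r)"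
      by (auto simp: indicator_def)
    finally show ?thesis .
  qed
  have "ennreal (c * moment d / s ^ d) = (\<integral>\<^sup>+r\<in>{0..R}. ennreal (s * sin (2 * s * r) * (c * r ^ d)) \<partial>lborel)"
  proof -
    have "(\<lambda>r. s * sin (2 * s * r) * (c * r ^ d)) absolutely_integrable_on {0..R}"
      by (intro absolutely_integrable_continuous_real continuous_intros)
    moreover have "(\<lambda>r. indicator {0..R} r * (s * sin (2 * s * r) * (c * r ^ d))) \<in> borel_measurable borel"
      by measurable
    ultimately have "(\<integral>\<^sup>+r\<in>{0..R}. ennreal (s * sin (2 * s * r) * (c * r ^ d)) \<partial>lborel) =
        ennreal (integral {0..R} (\<lambda>r. s * sin (2 * s * r) * (c * r ^ d)))"
      using sin0 c by (intro nn_integral_eq_integral_on) (auto intro!: mult_nonneg_nonneg[of "_ * sin _"])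
    then show ?thesis
      using integral_unique[OF has_integral_scaled_moment[OF s, of c d]] by (simp add: R_def)
  qed
  also have "\<dots> \<le> (\<integral>\<^sup>+r. (\<integral>\<^sup>+x. w r * indicator {r. \<tau> x < r} r \<partial>M) \<partial>lborel)"
  proof (rule nn_integral_mono_AE)
    show "AE r in lborel. ennreal (s * sin (2 * s * r) * (c * r ^ d)) * indicator {0..R} r \<le>
        (\<integral>\<^sup>+x. w r * indicator {r. \<tau> x < r} r \<partial>M)"
      using AE_lborel_singleton[of 0]
    proof eventually_elim
      fix r :: real assume "r \<noteq> 0"
      show "ennreal (s * sin (2 * s * r) * (c * r ^ d)) * indicator {0..R} r \<le>
        (\<integral>\<^sup>+x. w r * indicator {r. \<tau> x < r} r \<partial>M)"
      proof (cases "r \<in> {0..R}")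
        case True
        then have r: "0 < r" "r \<le> R" using \<open>r \<noteq> 0\<close> by auto
        let ?B = "{x \<in> space M. \<rho> x < r}"
        have B: "?B \<in> sets M" using balls r by (simp add: R_def)
        have "(\<integral>\<^sup>+x. w r * indicator {r. \<tau> x < r} r \<partial>M) = (\<integral>\<^sup>+x. w r * indicator ?B x \<partial>M)"
          using r by (intro nn_integral_cong) (auto simp: \<tau>_def indicator_def)
        also have "\<dots> = w r * ennreal (measure M ?B)"
          using B by (simp add: nn_integral_cmult_indicator emeasure_eq_measure)
        finally have eq: "(\<integral>\<^sup>+x. w r * indicator {r. \<tau> x < r} r \<partial>M) = w r * ennreal (measure M ?B)" .
        have "ennreal (s * sin (2 * s * r) * (c * r ^ d)) = w r * ennreal (c * r ^ d)"
          using True sin0[OF True] r(1) c by (simp add: w_def ennreal_mult)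
        also have "\<dots> \<le> w r * ennreal (measure M ?B)"
          using vol r by (intro mult_left_mono ennreal_leI) (auto simp: R_def)
        finally show ?thesis using True by (simp add: eq)
      qed simp
    qed
  qed
  also have "\<dots> = (\<integral>\<^sup>+x. (\<integral>\<^sup>+r. w r * indicator {r. \<tau> x < r} r \<partial>lborel) \<partial>M)"
    by (rule Fubini'[OF mJ])
  also have "\<dots> = (\<integral>\<^sup>+x. ennreal (if \<rho> x < R then (cos (s * \<rho> x))\<^sup>2 else 0) \<partial>M)"
    by (intro nn_integral_cong inner)
  finally show ?thesis by (simp add: R_def)
qed

section \<open>The bound on the counting function\<close>

context compact_riem
begin

text \<open>The map \<open>\<Phi> = (\<phi> 0, \<dots>, \<phi> (n - 1))\<close> satisfies the
  conditions of the sphere estimate with \<open>L = \<Lambda>\<close>: the constants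
  \<open>k\<close> and \<open>G\<close> exist by homogeneity and are computed by integration.
  The function \<open>u\<close> is the reproducing kernel of \<open>V\<close> at
  \<open>p\<close>, whose square norm \<open>k\<close> is compared with its lower bound on the
  ball of radius \<open>pi / (2 sqrt \<Lambda>)\<close>.\<close>

lemma kernel_lower_bound:
  fixes n :: nat
  assumes hom: "\<And>x y. \<exists>f. isometry_of A g f \<and> f x = y" and conn: "connected (UNIV :: 'a set)"
    and max: "max_system_size \<Lambda> n" and on: "orthonormal {..<n} \<phi>" and V: "\<forall>j<n. \<phi> j \<in> low_space \<Lambda>"
    and n: "n > 0" and c: "c > 0" and r0: "r0 > 0" and \<Lambda>: "\<Lambda> \<ge> (pi / (2 * r0))\<^sup>2"
    and balls: "\<And>r. 0 < r \<Longrightarrow> r \<le> r0 \<Longrightarrow> ball_volume A g p r \<ge> c * r ^ d"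
  shows "real n * (c * moment d / sqrt \<Lambda> ^ d) \<le> measure vol UNIV"
proof -
  have "0 < (pi / (2 * r0))\<^sup>2" using r0 by simp
  then have "\<Lambda> > 0" using \<Lambda> by linarith
  then have s: "sqrt \<Lambda> > 0" by simp
  have Rr0: "pi / (2 * sqrt \<Lambda>) \<le> r0"
  proof -
    have "pi / (2 * r0) \<le> sqrt \<Lambda>" using \<Lambda> by (rule real_le_rsqrt)
    then show ?thesis using r0 s by (simp add: field_simps)
  qed
  have sm: "smooth_fun A (\<phi> j)" if "j < n" for j using V that low_space_smooth by blast
  have cont: "continuous_on UNIV (\<phi> j)" if "j < n" for j by (rule smooth_fun_continuous[OF sm[OF that]])
  define k where "k = (\<Sum>j<n. (cmod (\<phi> j p))\<^sup>2)"
  have k: "(\<Sum>j<n. (cmod (\<phi> j x))\<^sup>2) = k" for x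
    using hom[of p x] kernel_isometry[OF max on V] unfolding k_def by metis
  define G where "G = (\<Sum>j<n. grad_sq (\<phi> j) p)"
  have G: "(\<Sum>j<n. grad_sq (\<phi> j) x) = G" for x
    using hom[of p x] energy_isometry[OF max on V] unfolding G_def by metis
  let ?vol = "measure vol UNIV"
  have "(LINT x|vol. (\<Sum>j<n. (cmod (\<phi> j x))\<^sup>2)) = (\<Sum>j<n. (LINT x|vol. (cmod (\<phi> j x))\<^sup>2))"
    using cont by (intro Bochner_Integration.integral_sum integrable_continuous continuous_intros) auto
  also have "\<dots> = real n" using orthonormal_norm[OF on] by simp
  finally have kvol: "?vol * k = real n" unfolding k by simp
  have volpos: "?vol > 0" using kvol n by (metis measure_nonneg mult_zero_left of_nat_0_less_iff order_le_less)
  have kpos: "k > 0" using kvol n volpos by (metis of_nat_0_less_iff zero_less_mult_pos)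
  have "(LINT x|vol. (\<Sum>j<n. grad_sq (\<phi> j) x)) = (\<Sum>j<n. (LINT x|vol. grad_sq (\<phi> j) x))"
    using sm by (intro Bochner_Integration.integral_sum integrable_continuous continuous_grad_sq) auto
  also have "\<dots> \<le> (\<Sum>j<n. \<Lambda> * 1)"
    using low_space_energy[of "\<phi> _" \<Lambda>] V orthonormal_norm[OF on] by (intro sum_mono) (metis lessThan_iff)
  finally have "?vol * G \<le> ?vol * (\<Lambda> * k)" unfolding G using kvol by (simp add: mult_ac)
  then have energy: "(\<Sum>j<n. grad_sq (\<phi> j) x) \<le> \<Lambda> * k" for x unfolding G using volpos by simp
  let ?h = "correlation {..<n} \<phi> k p"
  have corr: "cos (sqrt \<Lambda> * rdist A g p y) \<le> ?h y" if "sqrt \<Lambda> * rdist A g p y \<le> pi" for y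
    using sm kpos \<open>\<Lambda> > 0\<close> k energy conn that by (intro cos_rdist_le_correlation) auto
  have h_eq: "?h y = (\<Sum>j<n. \<phi> j y \<bullet> \<phi> j p) / k" for y
    by (rule correlation_def)
  define u where "u y = (\<Sum>j<n. cnj (\<phi> j p) * \<phi> j y)" for y
  have uc: "continuous_on UNIV u" unfolding u_def using cont by (intro continuous_intros) auto
  have Re_u: "Re (u y) = k * ?h y" for y
    using kpos by (simp add: h_eq u_def inner_complex_def algebra_simps)
  have "ip u u = (\<Sum>j<n. cnj (\<phi> j p) * cnj (cnj (\<phi> j p)))"
    unfolding u_def by (rule orthonormal_ip_sum[OF on])
  also have "\<dots> = complex_of_real k"
    by (simp add: k_def complex_norm_square mult.commute del: of_real_power)
  finally have u2: "(LINT y|vol. (cmod (u y))\<^sup>2) = k" unfolding ip_self by (simp only: of_real_eq_iff)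
  let ?F = "\<lambda>y. if rdist A g p y < pi / (2 * sqrt \<Lambda>) then (cos (sqrt \<Lambda> * rdist A g p y))\<^sup>2 else 0"
  \<comment> \<open>A nonmeasurable set has measure \<open>0\<close> by convention, so the
    positive lower bound on the volume of a ball entails that the ball is measurable.\<close>
  have ball: "{y \<in> space vol. rdist A g p y < r} \<in> sets vol \<and> c * r ^ d \<le> measure vol {y \<in> space vol. rdist A g p y < r}"
    if "0 < r" "r \<le> pi / (2 * sqrt \<Lambda>)" for r
  proof -
    have "c * r ^ d \<le> ball_volume A g p r" using balls that Rr0 by simp
    moreover have "0 < c * r ^ d" using c that by simp
    ultimately show ?thesis
      unfolding ball_volume_def using measure_notin_sets[of "{q. rdist A g p q < r}" vol] by fastforce
  qed
  have "ennreal (c * moment d / sqrt \<Lambda> ^ d) \<le> (\<integral>\<^sup>+y. ennreal (?F y) \<partial>vol)"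
    using ball rdist_nonneg[OF conn] c
    by (intro nn_integral_layer_cake_cos[OF vol.finite_measure_axioms s]) auto
  also have "\<dots> \<le> (\<integral>\<^sup>+y. ennreal ((cmod (u y))\<^sup>2 / k\<^sup>2) \<partial>vol)"
  proof (intro nn_integral_mono ennreal_leI)
    fix y
    show "?F y \<le> (cmod (u y))\<^sup>2 / k\<^sup>2"
    proof (cases "rdist A g p y < pi / (2 * sqrt \<Lambda>)")
      case True
      then have lt: "sqrt \<Lambda> * rdist A g p y < pi / 2" using s by (simp add: field_simps)
      moreover have "0 \<le> sqrt \<Lambda> * rdist A g p y" using s rdist_nonneg[OF conn] by simp
      ultimately have c0: "0 \<le> cos (sqrt \<Lambda> * rdist A g p y)" by (intro cos_ge_zero) auto
      have "cos (sqrt \<Lambda> * rdist A g p y) \<le> ?h y" using lt pi_gt_zero by (intro corr) linarith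
      also have "\<dots> = Re (u y) / k" using kpos by (simp add: Re_u)
      also have "\<dots> \<le> cmod (u y) / k" using kpos complex_Re_le_cmod by (intro divide_right_mono) auto
      finally have "(cos (sqrt \<Lambda> * rdist A g p y))\<^sup>2 \<le> (cmod (u y) / k)\<^sup>2" using c0 by (rule power_mono)
      then show ?thesis using True by (simp add: power_divide)
    qed simp
  qed
  also have "\<dots> = ennreal (LINT y|vol. (cmod (u y))\<^sup>2 / k\<^sup>2)"
    by (intro nn_integral_eq_integral integrable_continuous continuous_intros uc) (use kpos in auto)
  also have "(LINT y|vol. (cmod (u y))\<^sup>2 / k\<^sup>2) = 1 / k"
    using u2 kpos by (simp add: power2_eq_square)
  finally have "c * moment d / sqrt \<Lambda> ^ d \<le> 1 / k"
    using kpos by (subst (asm) ennreal_le_iff) auto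
  then have "k * (c * moment d / sqrt \<Lambda> ^ d) \<le> 1" using kpos by (simp add: pos_le_divide_eq mult.commute)
  then have "?vol * (k * (c * moment d / sqrt \<Lambda> ^ d)) \<le> ?vol * 1" by (intro mult_left_mono) auto
  then show ?thesis using kvol by (simp add: mult.assoc[symmetric])
qed

end

theorem corollary1p2:
  fixes A :: "('m::{t2_space, second_countable_topology}, 'n::finite) chart set"
    and g :: "('m, 'n) metric_components"
    and p :: 'm
    and d :: nat
    and r0 c \<Lambda> :: real
  assumes "riemannian_homogeneous_space A g"
    and "compact (UNIV :: 'm set)"
    and "connected (UNIV :: 'm set)"
    and "d = CARD('n)"
    and "r0 > 0"
    and "c > 0"
    and "\<forall>r. 0 < r \<and> r \<le> r0 \<longrightarrow> ball_volume A g p r \<ge> c * r ^ d"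
    and "\<Lambda> \<ge> (pi / (2 * r0))\<^sup>2"
  shows "ereal_of_enat (eigenvalue_count A g \<Lambda>)
    \<le> ereal (measure (riemannian_volume A g) UNIV / (c * moment d) * \<Lambda> powr (real d / 2))"
proof -
  interpret compact_riem A g
    using assms(1,2) by unfold_locales (auto simp: riemannian_homogeneous_space_def)
  have hom: "\<exists>f. isometry_of A g f \<and> f x = y" for x y
    using assms(1) by (auto simp: riemannian_homogeneous_space_def)
  have "0 < (pi / (2 * r0))\<^sup>2" using assms(5) by simp
  then have \<Lambda>: "\<Lambda> > 0" using assms(8) by linarith
  obtain n \<phi> where n: "max_system_size \<Lambda> n" "orthonormal {..<n} \<phi>" "\<forall>j<n. \<phi> j \<in> low_space \<Lambda>"
    using ex_maximal_system[OF \<Lambda>] by blast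
  have cm: "c * moment d > 0" using assms(6) moment_pos by simp
  have pow: "\<Lambda> powr (real d / 2) = sqrt \<Lambda> ^ d"
  proof -
    have "sqrt \<Lambda> ^ d = (\<Lambda> powr (1/2)) powr real d"
      using \<Lambda> by (simp add: powr_half_sqrt powr_realpow)
    also have "\<dots> = \<Lambda> powr (real d / 2)" by (simp add: powr_powr)
    finally show ?thesis ..
  qed
  have le: "real n \<le> measure vol UNIV / (c * moment d) * \<Lambda> powr (real d / 2)"
  proof (cases "n = 0")
    case True
    then show ?thesis using cm by simp
  next
    case False
    then have "real n * (c * moment d / sqrt \<Lambda> ^ d) \<le> measure vol UNIV"
      using kernel_lower_bound[where p = p and d = d, OF hom assms(3) n _ assms(6,5,8)] assms(7) by auto
    then show ?thesis
      unfolding pow using cm \<Lambda> by (simp add: field_simps)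
  qed
  have "eigenvalue_count A g \<Lambda> \<le> enat n"
    using edim_low_space[OF n] by (simp add: eigenvalue_count_def low_space_def)
  then have "ereal_of_enat (eigenvalue_count A g \<Lambda>) \<le> ereal_of_enat (enat n)"
    by (simp only: ereal_of_enat_le_iff)
  also have "\<dots> = ereal (real n)" by simp
  also have "\<dots> \<le> ereal (measure vol UNIV / (c * moment d) * \<Lambda> powr (real d / 2))" using le by simp
  finally show ?thesis .
qed

end
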